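(* Let $t\ge 0$ be an integer and let $f_0,\dots,f_t\colon \mathbb{Z}_{\ge 0}\to\mathbb{R}$ be a central moment function sequence (CMFS). Suppose that for all integers $d\ge 0$ and all $0\le k\le t$, \[ \mathbb{E}\Big[\big(\mathcal{X}_d-\tfrac d2\big)^k\Big]\le f_k(d). \] Then for every (loopless) matroid $\mathrm{M}$ of rank $d+1$, \[ \mathbb{E}\Big[\big(\mathcal{X}_{\mathrm{M}}-\tfrac d2\big)^t\Big]\le f_t(d). \]
   Context: All matroids are loopless. For a matroid $\mathrm{M}$ on ground set $E$, its Chow ring is $A^*(\mathrm{M})=\mathbb{Z}[x_F : F \text{ a nonempty proper flat}]/(I+J)$, where $I$ is generated by $x_Fx_G$ for incomparable flats $F,G$ and $J$ by $\sum_{F\ni i}x_F-\sum_{F\ni j}x_F$ for $i,j\in E$; it is graded by degree. If $\mathrm{M}$ has rank $d+1$, write $a_k(\mathrm{M})=\dim_{\mathbb{Q}}A^k(\mathrm{M})\otimes\mathbb{Q}$ ($0\le k\le d$) and let the Chow polynomial be $\underline{H}_{\mathrm{M}}(x)=\sum_k a_k(\mathrm{M})x^k$. The random variable $\mathcal{X}_{\mathrm{M}}$ takes value $k\in\{0,\dots,d\}$ with probability $a_k(\mathrm{M})/\sum_{i=0}^d a_i(\mathrm{M})$. $\mathcal{X}_d$ denotes $\mathcal{X}_{\mathrm{U}_{d+1}}$ for the Boolean matroid $\mathrm{U}_{d+1}$ on $d+1$ elements. A sequence of functions $f_0,\dots,f_t\colon\mathbb{Z}_{\ge0}\to\mathbb{R}$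 with $f_0\equiv 1$ is a CMFS if for all integers $a,b\ge0$ and all $0\le k\le t$: $f_k(a+b+2)\ge\sum_{i+j=k}\binom{k}{i}f_i(a)f_j(b)$. *)

theory Defs
  imports Complex_Main "HOL-Library.Poly_Mapping"
begin

definition matroid :: "'a set \<Rightarrow> ('a set \<Rightarrow> bool) \<Rightarrow> bool" where
  "matroid E indep \<longleftrightarrow> finite E \<and> (\<forall>X. indep X \<longrightarrow> X \<subseteq> E) \<and> indep {} \<and>
     (\<forall>X Y. indep Y \<and> X \<subseteq> Y \<longrightarrow> indep X) \<and>
     (\<forall>X Y. indep X \<and> indep Y \<and> card X < card Y \<longrightarrow> (\<exists>y\<in>Y - X. indep (insert y X)))"

definition loopless :: "'a set \<Rightarrow> ('a set \<Rightarrow> bool) \<Rightarrow> bool" where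
  "loopless E indep \<longleftrightarrow> (\<forall>e\<in>E. indep {e})"

definition mrank :: "('a set \<Rightarrow> bool) \<Rightarrow> 'a set \<Rightarrow> nat" where
  "mrank indep X = Max {card I | I. I \<subseteq> X \<and> indep I}"

definition flat :: "'a set \<Rightarrow> ('a set \<Rightarrow> bool) \<Rightarrow> 'a set \<Rightarrow> bool" where
  "flat E indep F \<longleftrightarrow> F \<subseteq> E \<and> (\<forall>e\<in>E - F. mrank indep (insert e F) > mrank indep F)"

definition proper_flats :: "'a set \<Rightarrow> ('a set \<Rightarrow> bool) \<Rightarrow> 'a set set" where
  "proper_flats E indep = {F. flat E indep F \<and> F \<noteq> {} \<and> F \<noteq> E}"

type_synonym 'v qpoly = "('v \<Rightarrow>\<^sub>0 nat) \<Rightarrow>\<^sub>0 rat"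

definition pvar :: "'v \<Rightarrow> 'v qpoly" where
  "pvar v = Poly_Mapping.single (Poly_Mapping.single v 1) 1"

definition qscale :: "rat \<Rightarrow> 'v qpoly \<Rightarrow> 'v qpoly" where
  "qscale c p = Poly_Mapping.single 0 c * p"

definition in_polyring :: "'v set \<Rightarrow> 'v qpoly \<Rightarrow> bool" where
  "in_polyring V (p :: 'v qpoly) \<longleftrightarrow> (\<forall>m :: 'v \<Rightarrow>\<^sub>0 nat. m \<in> Poly_Mapping.keys p \<longrightarrow> Poly_Mapping.keys m \<subseteq> V)"

definition homogeneous :: "nat \<Rightarrow> 'v qpoly \<Rightarrow> bool" where
  "homogeneous k (p :: 'v qpoly) \<longleftrightarrow> (\<forall>m\<in>Poly_Mapping.keys p. (\<Sum>v\<in>Poly_Mapping.keys m. Poly_Mapping.lookup m v) = k)"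

definition gen_ideal :: "'v set \<Rightarrow> 'v qpoly set \<Rightarrow> 'v qpoly set" where
  "gen_ideal V G = {(\<Sum>g\<in>S. c g * g) | S c. finite S \<and> S \<subseteq> G \<and> (\<forall>g\<in>S. in_polyring V (c g))}"

definition chow_I :: "'a set \<Rightarrow> ('a set \<Rightarrow> bool) \<Rightarrow> 'a set qpoly set" where
  "chow_I E indep = {pvar F * pvar G | F G. F \<in> proper_flats E indep \<and> G \<in> proper_flats E indep
      \<and> \<not> F \<subseteq> G \<and> \<not> G \<subseteq> F}"

definition chow_J :: "'a set \<Rightarrow> ('a set \<Rightarrow> bool) \<Rightarrow> 'a set qpoly set" where
  "chow_J E indep = {(\<Sum>F\<in>{F\<in>proper_flats E indep. i \<in> F}. pvar F)
      - (\<Sum>F\<in>{F\<in>proper_flats E indep. j \<in> F}. pvar F) | i j. i \<in> E \<and> j \<in> E}"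

definition chow_ideal :: "'a set \<Rightarrow> ('a set \<Rightarrow> bool) \<Rightarrow> 'a set qpoly set" where
  "chow_ideal E indep = gen_ideal (proper_flats E indep) (chow_I E indep \<union> chow_J E indep)"

definition homog_part :: "'a set \<Rightarrow> ('a set \<Rightarrow> bool) \<Rightarrow> nat \<Rightarrow> 'a set qpoly set" where
  "homog_part E indep k = {p. in_polyring (proper_flats E indep) p \<and> homogeneous k p}"

text \<open>a_k(M) = dim_Q (A^k(M) \<otimes> Q) = dim_Q (S_k / (S_k \<inter> (I+J)_Q)),
  computed as dim S_k - dim (S_k \<inter> (I+J)_Q).\<close>
definition chow_dim :: "'a set \<Rightarrow> ('a set \<Rightarrow> bool) \<Rightarrow> nat \<Rightarrow> nat" where
  "chow_dim E indep k =
     vector_space.dim qscale (homog_part E indep k)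
     - vector_space.dim qscale (homog_part E indep k \<inter> chow_ideal E indep)"

text \<open>E[(X_M - c)^t] for the random variable X_M with P(X_M = k) = a_k / sum_i a_i, 0 \<le> k \<le> d,
  where rank M = d+1.\<close>
definition chow_moment :: "'a set \<Rightarrow> ('a set \<Rightarrow> bool) \<Rightarrow> real \<Rightarrow> nat \<Rightarrow> real" where
  "chow_moment E indep c t =
     (let d = mrank indep E - 1 in
       (\<Sum>k\<le>d. real (chow_dim E indep k) * (real k - c) ^ t) / (\<Sum>k\<le>d. real (chow_dim E indep k)))"

definition boolean_ground :: "nat \<Rightarrow> nat set" where
  "boolean_ground d = {..<Suc d}"

definition boolean_indep :: "nat \<Rightarrow> nat set \<Rightarrow> bool" where
  "boolean_indep d X \<longleftrightarrow> X \<subseteq> boolean_ground d"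

definition CMFS :: "nat \<Rightarrow> (nat \<Rightarrow> nat \<Rightarrow> real) \<Rightarrow> bool" where
  "CMFS t f \<longleftrightarrow> (\<forall>n. f 0 n = 1) \<and>
     (\<forall>a b k. k \<le> t \<longrightarrow> f k (a + b + 2) \<ge> (\<Sum>i\<le>k. real (k choose i) * f i a * f (k - i) b))"

end

theory Submission
  imports Defs "HOL-Library.Multiset" "HOL-Computational_Algebra.Polynomial"
begin

text \<open>
  Adjoin \<open>x\<^sub>E = - (\<Sum>G \<ni> i. x\<^sub>G)\<close> and put \<open>h\<^sub>F = - (\<Sum>G \<supseteq> F. x\<^sub>G)\<close>. In these simplicial generators of Backman,
  Eur and Simpson the Chow ring has the relations \<open>(h\<^sub>F - h\<^sub>K) (h\<^sub>G - h\<^sub>K) = 0\<close> for \<open>K\<close> the join of \<open>F\<close> and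
  \<open>G\<close>, and \<open>h\<^sub>F = 0\<close> for \<open>F\<close> of rank one. They rewrite every monomial into nested ones, i.e. products
  over chains \<open>F\<^sub>1 \<subset> F\<^sub>2 \<subset> \<dots>\<close> in which the exponent of \<open>F\<^sub>j\<close> is less than \<open>r F\<^sub>j - r F\<^sub>j\<^sub>-\<^sub>1\<close>. The functional
  that sends a monomial to 1 if each nonempty submultiset \<open>J\<close> satisfies \<open>size J < r (\<Union>J)\<close>, and to 0
  otherwise, vanishes on the ideal by submodularity, and under the resulting pairing the nested monomials
  have a triangular system of dual elements. So the nested monomials form a basis.

  Counting them by their least flat gives a recursion for the Chow polynomial \<open>H\<close>, and from it, for every
  element \<open>i\<close>, the deletion formula \<open>H(M) = H(M - i) + x (\<Sum>G. H(M|G) H(M/(G + i)))\<close>, summed over the nonempty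
  flats \<open>G\<close> avoiding \<open>i\<close> for which \<open>G + i\<close> is a flat too. If \<open>i\<close> is not a coloop then all summands are
  symmetric about \<open>d / 2\<close>, and the CMFS inequality carries the moment bound from the smaller matroids to
  \<open>M\<close>. The recursion ends at the matroids all of whose elements are coloops, the Boolean ones.

  A minor \<open>(M|E)/A\<close> is represented by the pair \<open>(E, A)\<close> with the rank function of \<open>M\<close> left unchanged.
\<close>

section \<open>Rank functions and flats\<close>

text \<open>A product H(M|G) H(M/(G + i)) is the generating function of a sum of independent
  variables, so its central moments are the binomial convolutions that occur in a CMFS. The shift by
  2 comes from the ranks: if M|G has rank a + 1 and M/(G + i) has rank b + 1, then i supplies one
  more, so d = a + b + 2, and the factor x moves the centre a/2 + b/2 to d/2. Multiplying two upper
  bounds requires nonnegative moments and nonnegative f: the moments follow by the same recursion, f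
  from the Boolean hypothesis. Deleting a coloop lowers the rank, so that H(M - i) is centred at (d
  - 1)/2. The summand G = E - i then turns H(M - i) into H(M - i) (1 + x), which has the right
  centre. This suffices for nonnegativity, but the CMFS inequality does not control such a factor,
  so the upper bound has to start from the Boolean matroids. The functional lives on polynomials
  with a variable for every set, flat or not. Joins become unions there and submodularity applies
  directly; a closure and its generating set are identified afterwards, and Moebius inversion
  expresses the variables of the Chow ring.\<close>

definition rflat :: "('a set \<Rightarrow> nat) \<Rightarrow> 'a set \<Rightarrow> 'a set \<Rightarrow> bool" where
  "rflat r E F \<longleftrightarrow> F \<subseteq> E \<and> (\<forall>e\<in>E - F. r F < r (insert e F))"

definition rclosure :: "('a set \<Rightarrow> nat) \<Rightarrow> 'a set \<Rightarrow> 'a set \<Rightarrow> 'a set" where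
  "rclosure r E X = {e \<in> E. r (insert e X) = r X}"

text \<open>The axioms mention no ground set and range over all sets of the type, so that every
  minor shares one instance.\<close>

locale rank_function =
  fixes r :: "'a set \<Rightarrow> nat"
  assumes rank_empty: "r {} = 0"
    and rank_mono: "X \<subseteq> Y \<Longrightarrow> r X \<le> r Y"
    and rank_submodular: "r (X \<union> Y) + r (X \<inter> Y) \<le> r X + r Y"
    and rank_insert_le: "r (insert e X) \<le> Suc (r X)"
begin

lemma rank_insert_eq_mono:
  assumes "r (insert e X) = r X" "X \<subseteq> Y"
  shows "r (insert e Y) = r Y"
proof -
  have "insert e X \<union> Y = insert e Y" using assms(2) by auto
  moreover have "r X \<le> r (insert e X \<inter> Y)" using assms(2) by (intro rank_mono) auto
  ultimately have "r (insert e Y) \<le> r Y"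
    using rank_submodular[of "insert e X" Y] assms(1) by simp
  then show ?thesis using rank_mono[OF subset_insertI[of Y e]] by simp
qed

lemma rank_union_eq:
  assumes "finite Z" "\<And>e. e \<in> Z \<Longrightarrow> r (insert e X) = r X"
  shows "r (X \<union> Z) = r X"
  using assms
proof (induction Z)
  case (insert e Z)
  then have "r (X \<union> Z) = r X" by auto
  moreover have "r (insert e (X \<union> Z)) = r (X \<union> Z)"
    using insert.prems by (rule rank_insert_eq_mono[of e X]) auto
  ultimately show ?case by simp
qed simp

lemma subset_rclosure: "X \<subseteq> E \<Longrightarrow> X \<subseteq> rclosure r E X"
  by (auto simp: rclosure_def insert_absorb)

lemma rclosure_subset: "rclosure r E X \<subseteq> E"
  by (auto simp: rclosure_def)

lemma rank_rclosure:
  assumes "finite E" "X \<subseteq> E"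
  shows "r (rclosure r E X) = r X"
proof -
  have "r (X \<union> rclosure r E X) = r X"
    by (rule rank_union_eq) (use assms in \<open>auto simp: rclosure_def\<close>)
  then show ?thesis using subset_rclosure[OF assms(2)] by (simp add: Un_absorb1)
qed

lemma rank_union_rclosure:
  assumes "finite E" "X \<subseteq> E"
  shows "r (Y \<union> rclosure r E X) = r (Y \<union> X)"
proof -
  have "r ((Y \<union> X) \<union> rclosure r E X) = r (Y \<union> X)"
  proof (rule rank_union_eq)
    show "finite (rclosure r E X)" using assms by (simp add: rclosure_def)
    fix e assume "e \<in> rclosure r E X"
    then have "r (insert e X) = r X" by (simp add: rclosure_def)
    then show "r (insert e (Y \<union> X)) = r (Y \<union> X)" by (rule rank_insert_eq_mono) simp
  qed
  moreover have "(Y \<union> X) \<union> rclosure r E X = Y \<union> rclosure r E X"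
    using subset_rclosure[OF assms(2)] by auto
  ultimately show ?thesis by simp
qed

lemma rflat_rclosure:
  assumes "finite E" "X \<subseteq> E"
  shows "rflat r E (rclosure r E X)"
  unfolding rflat_def
proof (intro conjI ballI)
  fix e assume e: "e \<in> E - rclosure r E X"
  show "r (rclosure r E X) < r (insert e (rclosure r E X))"
  proof (rule ccontr)
    assume "\<not> ?thesis"
    then have "r (insert e (rclosure r E X)) \<le> r X" using rank_rclosure[OF assms] by simp
    moreover have "r (insert e X) \<le> r (insert e (rclosure r E X))"
      using subset_rclosure[OF assms(2)] by (intro rank_mono) auto
    ultimately have "r (insert e X) = r X" using rank_mono[OF subset_insertI[of X e]] by simp
    then show False using e by (auto simp: rclosure_def)
  qed
qed (rule rclosure_subset)

lemma rclosure_subset_iff: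
  assumes "X \<subseteq> E" "rflat r E F"
  shows "rclosure r E X \<subseteq> F \<longleftrightarrow> X \<subseteq> F"
proof
  assume "X \<subseteq> F"
  show "rclosure r E X \<subseteq> F"
  proof
    fix e assume "e \<in> rclosure r E X"
    then have e: "e \<in> E" "r (insert e X) = r X" by (auto simp: rclosure_def)
    have "r (insert e F) = r F" using e(2) \<open>X \<subseteq> F\<close> by (rule rank_insert_eq_mono)
    then show "e \<in> F" using assms(2) e(1) by (force simp: rflat_def)
  qed
qed (use subset_rclosure[OF assms(1)] in auto)

lemma rflat_rank_insert:
  assumes "rflat r E F" "e \<in> E" "e \<notin> F"
  shows "r (insert e F) = Suc (r F)"
proof -
  have "r F < r (insert e F)" using assms by (auto simp: rflat_def)
  then show ?thesis using rank_insert_le[of e F] by linarith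
qed

lemma rflat_rank_union_eq:
  assumes "rflat r E F" "X \<subseteq> E" "r (F \<union> X) \<le> r F"
  shows "X \<subseteq> F"
proof
  fix e assume "e \<in> X"
  show "e \<in> F"
  proof (rule ccontr)
    assume "e \<notin> F"
    then have "r (insert e F) = Suc (r F)"
      using assms(2) \<open>e \<in> X\<close> by (intro rflat_rank_insert[OF assms(1)]) auto
    moreover have "r (insert e F) \<le> r (F \<union> X)" using \<open>e \<in> X\<close> by (intro rank_mono) auto
    ultimately show False using assms(3) by simp
  qed
qed

lemma rflat_rank_less:
  assumes "rflat r E F" "F \<subset> G" "G \<subseteq> E"
  shows "r F < r G"
proof (rule ccontr)
  assume "\<not> ?thesis"
  then have "r (F \<union> G) \<le> r F" using assms(2) by (simp add: Un_absorb1 less_imp_le)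
  then show False using rflat_rank_union_eq[OF assms(1,3)] assms(2) by auto
qed

lemma rflat_self: "rflat r E E"
  by (simp add: rflat_def)

text \<open>An element outside the flat \<open>G\<close> raises the rank of \<open>G\<close>, hence
  by submodularity that of every subset of \<open>G\<close>. Intervals below a flat can therefore be
  read in the restriction or in the whole matroid.\<close>

lemma rflat_restrict:
  assumes "rflat r E G" "F \<subseteq> G"
  shows "rflat r G F \<longleftrightarrow> rflat r E F"
proof
  assume F: "rflat r G F"
  show "rflat r E F"
    unfolding rflat_def
  proof (intro conjI ballI)
    show "F \<subseteq> E" using assms by (auto simp: rflat_def)
    fix e assume e: "e \<in> E - F"
    show "r F < r (insert e F)"
    proof (cases "e \<in> G")
      case True
      then show ?thesis using F e by (auto simp: rflat_def)
    next
      case False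
      have "r (insert e F) \<noteq> r F"
      proof
        assume "r (insert e F) = r F"
        then have "r (insert e G) = r G" using assms(2) by (rule rank_insert_eq_mono)
        then show False using rflat_rank_insert[OF assms(1) _ False] e by auto
      qed
      then show ?thesis using rank_mono[OF subset_insertI[of F e]] by simp
    qed
  qed
qed (use assms in \<open>auto simp: rflat_def\<close>)

lemma rflat_subground:
  assumes "rflat r E F" "F \<subseteq> G" "G \<subseteq> E"
  shows "rflat r G F"
  using assms by (auto simp: rflat_def)

end

section \<open>Nested monomials and the Chow polynomial\<close>

definition flats_above :: "('a set \<Rightarrow> nat) \<Rightarrow> 'a set \<Rightarrow> 'a set \<Rightarrow> 'a set set" where
  "flats_above r E A = {F. rflat r E F \<and> A \<subset> F}"

text \<open>Bounding an exponent against every smaller flat of the multiset amounts to bounding it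
  against the predecessor in the chain; for the least flat \<open>A\<close> plays the predecessor.
  The flat \<open>E\<close> may itself occur.\<close>

definition nested :: "('a set \<Rightarrow> nat) \<Rightarrow> 'a set \<Rightarrow> 'a set \<Rightarrow> 'a set multiset set" where
  "nested r E A = {M.
     (\<forall>F\<in>#M. F \<in> flats_above r E A \<and> r A + count M F < r F) \<and>
     (\<forall>F\<in>#M. \<forall>G\<in>#M. F \<subseteq> G \<or> G \<subseteq> F) \<and>
     (\<forall>F\<in>#M. \<forall>G\<in>#M. F \<subset> G \<longrightarrow> r F + count M G < r G)}"

definition chow_poly :: "('a set \<Rightarrow> nat) \<Rightarrow> 'a set \<Rightarrow> 'a set \<Rightarrow> real poly" where
  "chow_poly r E A = (\<Sum>M\<in>nested r E A. monom 1 (size M))"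

text \<open>Enumerates the admissible exponents of the least flat when it lies at rank distance
  \<open>n\<close> above the contracted set.\<close>

definition gap_poly :: "nat \<Rightarrow> real poly" where
  "gap_poly n = (\<Sum>a\<in>{1..<n}. monom 1 a)"

lemma gap_poly_1: "gap_poly (Suc 0) = 0"
  by (simp add: gap_poly_def)

text \<open>In the deletion formula this trades the gap below \<open>insert i G\<close> for the gap
  below \<open>G\<close>, and it is the source of the factor x.\<close>

lemma gap_poly_Suc:
  assumes "0 < n"
  shows "gap_poly (Suc n) = monom 1 1 * (1 + gap_poly n)"
proof -
  have "gap_poly (Suc n) = monom 1 1 + (\<Sum>a\<in>{Suc 1..<Suc n}. monom 1 a)"
    using assms unfolding gap_poly_def by (subst sum.atLeast_Suc_lessThan) auto
  also have "(\<Sum>a\<in>{Suc 1..<Suc n}. monom (1::real) a) = (\<Sum>a\<in>{1..<n}. monom 1 (Suc a))"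
    by (subst sum.shift_bounds_Suc_ivl) simp
  also have "\<dots> = monom 1 1 * gap_poly n"
    by (simp add: gap_poly_def sum_distrib_left mult_monom)
  finally show ?thesis by (simp add: algebra_simps)
qed

lemma finite_flats_above: "finite E \<Longrightarrow> finite (flats_above r E A)"
  by (rule finite_subset[of _ "Pow E"]) (auto simp: flats_above_def rflat_def)

lemma flats_above_card:
  assumes "finite E" "F \<in> flats_above r E A"
  shows "card (E - F) < card (E - A)"
  using assms by (intro psubset_card_mono) (auto simp: flats_above_def rflat_def)

context rank_function
begin

section \<open>Splitting off the least flat of a nested monomial\<close>

lemma nested_empty_mset: "{#} \<in> nested r E A"
  by (simp add: nested_def)

lemma replicate_add_nested:
  assumes "F \<in> flats_above r E A" "0 < a" "r A + a < r F" "M \<in> nested r E F"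
  shows "replicate_mset a F + M \<in> nested r E A"
proof -
  have M: "\<And>G. G \<in># M \<Longrightarrow> rflat r E G \<and> F \<subset> G \<and> r F + count M G < r G"
    using assms(4) by (auto simp: nested_def flats_above_def)
  have cF: "count M F = 0" using M by (auto simp: count_eq_zero_iff)
  have AF: "A \<subset> F" "r A \<le> r F" using assms(1) rank_mono by (auto simp: flats_above_def)
  have set: "set_mset (replicate_mset a F + M) = insert F (set_mset M)" using assms(2) by auto
  have ne: "G \<noteq> F" if "G \<in># M" for G using M that by auto
  show ?thesis
    unfolding nested_def mem_Collect_eq set
  proof (intro conjI ballI impI)
    fix G assume G: "G \<in> insert F (set_mset M)"
    then show "G \<in> flats_above r E A" using assms(1) M AF by (auto simp: flats_above_def)
    show "r A + count (replicate_mset a F + M) G < r G"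
    proof (cases "G = F")
      case True
      then show ?thesis using assms(3) cF by simp
    next
      case False
      then have "r F + count M G < r G" using G M by blast
      then show ?thesis using False AF(2) by simp
    qed
  next
    fix G H assume "G \<in> insert F (set_mset M)" "H \<in> insert F (set_mset M)"
    moreover have "\<forall>G\<in>#M. \<forall>H\<in>#M. G \<subseteq> H \<or> H \<subseteq> G" using assms(4) by (simp add: nested_def)
    ultimately show "G \<subseteq> H \<or> H \<subseteq> G" using M by blast
  next
    fix G H assume GH: "G \<in> insert F (set_mset M)" "H \<in> insert F (set_mset M)" "G \<subset> H"
    then have "H \<in># M" using M by auto
    have "r G + count M H < r H"
    proof (cases "G = F")
      case True
      then show ?thesis using M \<open>H \<in># M\<close> by blast
    next
      case False
      then have "G \<in># M" using GH(1) by simp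
      then show ?thesis using assms(4) GH(3) \<open>H \<in># M\<close> by (simp add: nested_def)
    qed
    then show "r G + count (replicate_mset a F + M) H < r H"
      using ne[OF \<open>H \<in># M\<close>] by simp
  qed
qed

lemma nested_obtain_least:
  assumes "M \<in> nested r E A" "M \<noteq> {#}"
  obtains F a M' where "F \<in> flats_above r E A" "0 < a" "r A + a < r F" "M' \<in> nested r E F"
    "M = replicate_mset a F + M'"
proof -
  have "\<exists>F\<in>set_mset M. \<forall>G\<in>set_mset M. G \<subseteq> F \<longrightarrow> F = G"
    using assms(2) by (intro finite_has_minimal) auto
  then obtain F where F: "F \<in># M" and min: "\<And>G. G \<in># M \<Longrightarrow> G \<subseteq> F \<Longrightarrow> F = G" by auto
  have least: "F \<subseteq> G" if "G \<in># M" for G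
    using assms(1) F min[of G] that by (auto simp: nested_def)
  define M' where "M' = filter_mset (\<lambda>G. G \<noteq> F) M"
  have eq: "M = replicate_mset (count M F) F + M'"
    by (rule multiset_eqI) (auto simp: M'_def)
  have mem: "G \<in># M' \<longleftrightarrow> G \<in># M \<and> G \<noteq> F" for G by (auto simp: M'_def)
  have cnt: "count M' G = count M G" if "G \<noteq> F" for G using that by (simp add: M'_def)
  have "M' \<in> nested r E F"
    unfolding nested_def mem_Collect_eq
  proof (intro conjI ballI impI)
    fix G assume G: "G \<in># M'"
    then show "G \<in> flats_above r E F"
      using assms(1) least mem by (auto simp: nested_def flats_above_def)
    have "F \<subset> G" using G least[of G] mem by auto
    then show "r F + count M' G < r G"
      using assms(1) F G mem cnt by (auto simp: nested_def)
  next
    fix G H assume "G \<in># M'" "H \<in># M'"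
    then show "G \<subseteq> H \<or> H \<subseteq> G" using assms(1) mem by (auto simp: nested_def)
  next
    fix G H assume "G \<in># M'" "H \<in># M'" "G \<subset> H"
    then show "r G + count M' H < r H" using assms(1) mem cnt by (auto simp: nested_def)
  qed
  moreover have "F \<in> flats_above r E A" "r A + count M F < r F" "0 < count M F"
    using assms(1) F by (auto simp: nested_def)
  ultimately show ?thesis using eq that by blast
qed

definition nested_triples :: "'a set \<Rightarrow> 'a set \<Rightarrow> ('a set \<times> nat \<times> 'a set multiset) set" where
  "nested_triples E A = (SIGMA F:flats_above r E A. {1..<r F - r A} \<times> nested r E F)"

lemma nested_decomp:
  "nested r E A = insert {#} ((\<lambda>(F, a, M). replicate_mset a F + M) ` nested_triples E A)"
proof (intro equalityI subsetI)
  fix M assume M: "M \<in> nested r E A"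
  show "M \<in> insert {#} ((\<lambda>(F, a, M). replicate_mset a F + M) ` nested_triples E A)"
  proof (cases "M = {#}")
    case False
    obtain F a M' where *: "F \<in> flats_above r E A" "0 < a" "r A + a < r F" "M' \<in> nested r E F"
      "M = replicate_mset a F + M'"
      by (rule nested_obtain_least[OF M False])
    then have "(F, a, M') \<in> nested_triples E A" by (auto simp: nested_triples_def)
    then show ?thesis using *(5) by (auto intro!: image_eqI)
  qed simp
next
  fix M assume "M \<in> insert {#} ((\<lambda>(F, a, M). replicate_mset a F + M) ` nested_triples E A)"
  then show "M \<in> nested r E A"
    by (auto simp: nested_triples_def nested_empty_mset intro!: replicate_add_nested)
qed

lemma nested_above: "M \<in> nested r E F \<Longrightarrow> G \<in># M \<Longrightarrow> F \<subset> G"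
  by (auto simp: nested_def flats_above_def)

lemma inj_on_nested_triples: "inj_on (\<lambda>(F, a, M). replicate_mset a F + M) (nested_triples E A)"
proof (rule inj_onI)
  fix p q
  assume "p \<in> nested_triples E A" "q \<in> nested_triples E A"
    and eq': "(\<lambda>(F, a, M). replicate_mset a F + M) p = (\<lambda>(F, a, M). replicate_mset a F + M) q"
  moreover obtain F a M where p: "p = (F, a, M)" by (cases p)
  moreover obtain G b N where q: "q = (G, b, N)" by (cases q)
  ultimately have 1: "(F, a, M) \<in> nested_triples E A" and 2: "(G, b, N) \<in> nested_triples E A"
    and eq: "replicate_mset a F + M = replicate_mset b G + N" by auto
  have M: "M \<in> nested r E F" "0 < a" and N: "N \<in> nested r E G" "0 < b"
    using 1 2 by (auto simp: nested_triples_def)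
  have "F \<in># replicate_mset b G + N" using eq M(2) by (metis in_replicate_mset union_iff)
  then have "G \<subseteq> F" using nested_above[OF N(1)] by (auto split: if_splits)
  moreover have "G \<in># replicate_mset a F + M" using eq N(2) by (metis in_replicate_mset union_iff)
  then have "F \<subseteq> G" using nested_above[OF M(1)] by (auto split: if_splits)
  ultimately have FG: "F = G" by simp
  have "count M F = 0" "count N F = 0"
    using nested_above[OF M(1), of F] nested_above[OF N(1), of F] FG
    by (auto simp: count_eq_zero_iff)
  then have "a = b" using arg_cong[OF eq, of "\<lambda>M. count M F"] FG by simp
  then show "p = q" using eq FG p q by simp
qed

lemma empty_notin_nested_triples:
  "{#} \<notin> (\<lambda>(F, a, M). replicate_mset a F + M) ` nested_triples E A"
  by (auto simp: nested_triples_def)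

lemma finite_nested:
  assumes "finite E"
  shows "finite (nested r E A)"
proof (induction "card (E - A)" arbitrary: A rule: less_induct)
  case less
  have "finite (nested_triples E A)"
    unfolding nested_triples_def
    using assms less flats_above_card[OF assms] finite_flats_above[OF assms]
    by (intro finite_SigmaI finite_cartesian_product) auto
  then show ?case by (simp add: nested_decomp)
qed

lemma chow_poly_rec:
  assumes "finite E"
  shows "chow_poly r E A = 1 + (\<Sum>F\<in>flats_above r E A. gap_poly (r F - r A) * chow_poly r E F)"
proof -
  have "finite (nested_triples E A)"
    unfolding nested_triples_def
    using finite_nested[OF assms] finite_flats_above[OF assms]
    by (intro finite_SigmaI finite_cartesian_product) auto
  then have "chow_poly r E A =
      1 + (\<Sum>(F, a, M)\<in>nested_triples E A. monom 1 (a + size M))"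
    unfolding chow_poly_def nested_decomp[of E A]
    by (subst sum.insert[OF _ empty_notin_nested_triples], simp,
        subst sum.reindex[OF inj_on_nested_triples])
       (auto simp: monom_0 one_pCons intro!: sum.cong)
  also have "(\<Sum>(F, a, M)\<in>nested_triples E A. monom (1::real) (a + size M)) =
      (\<Sum>F\<in>flats_above r E A. \<Sum>(a, M)\<in>{1..<r F - r A} \<times> nested r E F. monom 1 (a + size M))"
    unfolding nested_triples_def
    by (subst sum.Sigma) (use finite_nested[OF assms] finite_flats_above[OF assms] in
        \<open>auto intro!: sum.cong\<close>)
  also have "\<dots> = (\<Sum>F\<in>flats_above r E A. gap_poly (r F - r A) * chow_poly r E F)"
    by (simp add: gap_poly_def chow_poly_def sum_product sum.cartesian_product mult_monom)
  finally show ?thesis .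
qed

lemma chow_poly_self: "finite E \<Longrightarrow> chow_poly r E E = 1"
proof -
  assume "finite E"
  moreover have "flats_above r E E = {}" by (auto simp: flats_above_def rflat_def)
  ultimately show ?thesis using chow_poly_rec[of E E] by simp
qed

lemma coeff_chow_poly:
  assumes "finite E"
  shows "coeff (chow_poly r E A) k = real (card {M \<in> nested r E A. size M = k})"
proof -
  have "coeff (chow_poly r E A) k = (\<Sum>M\<in>nested r E A. if size M = k then 1 else 0)"
    by (simp add: chow_poly_def coeff_sum)
  also have "\<dots> = real (card {M \<in> nested r E A. size M = k})"
    using finite_nested[OF assms] by (simp add: sum.If_cases Int_def)
  finally show ?thesis .
qed

text \<open>Each flat of the chain contributes at most one less than its gap, and the gaps
  telescope. Hence moment sums cut off at \<open>r E - r A - 1\<close> see every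
  coefficient.\<close>

lemma degree_chow_poly:
  assumes "finite E" "rflat r E A"
  shows "degree (chow_poly r E A) \<le> r E - r A - 1"
  using assms(2)
proof (induction "card (E - A)" arbitrary: A rule: less_induct)
  case less
  have "degree (gap_poly (r F - r A) * chow_poly r E F) \<le> r E - r A - 1"
    if F: "F \<in> flats_above r E A" for F
  proof -
    have FE: "rflat r E F" "A \<subset> F" "F \<subseteq> E" using F by (auto simp: flats_above_def rflat_def)
    have AF: "r A < r F" using rflat_rank_less less.prems FE by blast
    have d1: "degree (gap_poly (r F - r A)) \<le> r F - r A - 1"
      unfolding gap_poly_def by (intro degree_sum_le) (auto intro: order_trans[OF degree_monom_le])
    show ?thesis
    proof (cases "F = E")
      case True
      then show ?thesis using d1 chow_poly_self[OF assms(1)] by simp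
    next
      case False
      then have "r F < r E" using rflat_rank_less[OF FE(1), of E] FE by auto
      moreover have "degree (chow_poly r E F) \<le> r E - r F - 1"
        using less.hyps flats_above_card[OF assms(1) F] FE(1) by blast
      ultimately show ?thesis
        using d1 AF degree_mult_le[of "gap_poly (r F - r A)" "chow_poly r E F"] by linarith
    qed
  qed
  then show ?case
    using chow_poly_rec[OF assms(1), of A]
    by (auto intro!: degree_add_le degree_sum_le finite_flats_above[OF assms(1)])
qed


section \<open>Deleting an element\<close>

lemma rflat_delete:
  assumes "rflat r E F" "i \<in> F" "\<not> rflat r E (F - {i})"
  shows "r (F - {i}) = r F" "rflat r (E - {i}) (F - {i})"
proof -
  have FE: "F \<subseteq> E" using assms(1) by (simp add: rflat_def)
  have *: "r (F - {i}) < r (insert e (F - {i}))" if e: "e \<in> E" "e \<notin> F" for e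
  proof -
    have "r (insert e (F - {i})) \<noteq> r (F - {i})"
    proof
      assume "r (insert e (F - {i})) = r (F - {i})"
      then have "r (insert e F) = r F" by (rule rank_insert_eq_mono) auto
      then show False using rflat_rank_insert[OF assms(1) e] by simp
    qed
    then show ?thesis using rank_mono[OF subset_insertI[of "F - {i}" e]] by simp
  qed
  then show "rflat r (E - {i}) (F - {i})" using FE assms(2) by (auto simp: rflat_def)
  obtain e where e: "e \<in> E - (F - {i})" "\<not> r (F - {i}) < r (insert e (F - {i}))"
    using assms(3) FE by (auto simp: rflat_def)
  then have "e = i" using * by auto
  then have "r F \<le> r (F - {i})" using e(2) assms(2) by (simp add: insert_absorb)
  then show "r (F - {i}) = r F" using rank_mono[of "F - {i}" F] by auto
qed

text \<open>As \<open>G\<close> is a flat of the deletion, only \<open>i\<close> can fail to raise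
  its rank, so \<open>i\<close> lies in its closure. Together with \<open>rflat_delete\<close> this
  matches the flats of the deletion that are not flats of \<open>E\<close> with the flats
  \<open>F\<close> of \<open>E\<close> that contain \<open>i\<close> without \<open>F - {i}\<close>
  being a flat.\<close>

lemma rflat_insert_of_delete:
  assumes "rflat r (E - {i}) G" "i \<in> E" "\<not> rflat r E G"
  shows "r (insert i G) = r G" "rflat r E (insert i G)"
proof -
  have G: "G \<subseteq> E" "i \<notin> G" using assms(1) by (auto simp: rflat_def)
  obtain e where e: "e \<in> E - G" "\<not> r G < r (insert e G)"
    using assms(3) G by (auto simp: rflat_def)
  then have "e = i" using assms(1) by (auto simp: rflat_def)
  then show eq: "r (insert i G) = r G" using e rank_mono[OF subset_insertI[of G i]] by simp
  show "rflat r E (insert i G)"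
    unfolding rflat_def
  proof (intro conjI ballI)
    show "insert i G \<subseteq> E" using G assms(2) by simp
    fix e assume e: "e \<in> E - insert i G"
    then have "r G < r (insert e G)" using assms(1) by (auto simp: rflat_def)
    also have "\<dots> \<le> r (insert e (insert i G))" by (rule rank_mono) auto
    finally show "r (insert i G) < r (insert e (insert i G))" using eq by simp
  qed
qed

text \<open>Contracting \<open>F - {i}\<close> makes \<open>i\<close> a loop. A loop lies in every
  flat, so removing it changes neither the lattice of flats nor the ranks.\<close>

lemma chow_poly_delete_contracted:
  assumes "finite E" "rflat r E F" "i \<in> F" "r (F - {i}) = r F"
  shows "chow_poly r E F = chow_poly r (E - {i}) (F - {i})"
  using assms(2-)
proof (induction "card (E - F)" arbitrary: F rule: less_induct)
  case less
  have i: "i \<in> E" using less.prems by (auto simp: rflat_def)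
  have rk: "r (G - {i}) = r G" if "F \<subseteq> G" for G
  proof -
    have "r (insert i (F - {i})) = r (F - {i})"
      using less.prems by (simp add: insert_absorb)
    then have "r (insert i (G - {i})) = r (G - {i})"
      by (rule rank_insert_eq_mono) (use that in auto)
    then show ?thesis using that less.prems(2) by (simp add: insert_absorb subset_iff)
  qed
  have nf: "\<not> rflat r E (G - {i})" if "F \<subseteq> G" for G
    using rflat_rank_insert[of E "G - {i}" i] rk[OF that] that less.prems(2) i
    by (auto simp: insert_absorb)
  have bij: "bij_betw (\<lambda>G. G - {i}) (flats_above r E F) (flats_above r (E - {i}) (F - {i}))"
  proof (rule bij_betw_byWitness[where f' = "insert i"])
    show "\<forall>G\<in>flats_above r E F. insert i (G - {i}) = G"
      using less.prems(2) by (auto simp: flats_above_def)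
    show "\<forall>G\<in>flats_above r (E - {i}) (F - {i}). insert i G - {i} = G"
      by (auto simp: flats_above_def rflat_def)
    show "(\<lambda>G. G - {i}) ` flats_above r E F \<subseteq> flats_above r (E - {i}) (F - {i})"
    proof
      fix H assume "H \<in> (\<lambda>G. G - {i}) ` flats_above r E F"
      then obtain G where G: "H = G - {i}" "rflat r E G" "F \<subset> G"
        by (auto simp: flats_above_def)
      have "rflat r (E - {i}) H"
        unfolding G(1) using nf G less.prems(2) by (intro rflat_delete) auto
      moreover have "F - {i} \<subset> H" using G less.prems(2) by auto
      ultimately show "H \<in> flats_above r (E - {i}) (F - {i})" by (simp add: flats_above_def)
    qed
    show "insert i ` flats_above r (E - {i}) (F - {i}) \<subseteq> flats_above r E F"
    proof
      fix H assume "H \<in> insert i ` flats_above r (E - {i}) (F - {i})"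
      then obtain G where G: "H = insert i G" "rflat r (E - {i}) G" "F - {i} \<subset> G"
        by (auto simp: flats_above_def)
      have iG: "i \<notin> G" using G(2) by (auto simp: rflat_def)
      have "\<not> rflat r E G" using nf[of "insert i G"] G(3) iG by auto
      then have "rflat r E H" unfolding G(1) using G(2) i by (intro rflat_insert_of_delete)
      moreover have "F \<subset> H" using G less.prems(2) iG by auto
      ultimately show "H \<in> flats_above r E F" by (simp add: flats_above_def)
    qed
  qed
  have "chow_poly r E F = 1 + (\<Sum>G\<in>flats_above r E F. gap_poly (r G - r F) * chow_poly r E G)"
    by (rule chow_poly_rec[OF assms(1)])
  also have "(\<Sum>G\<in>flats_above r E F. gap_poly (r G - r F) * chow_poly r E G) =
    (\<Sum>G\<in>flats_above r E F. gap_poly (r (G - {i}) - r (F - {i})) * chow_poly r (E - {i}) (G - {i}))"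
  proof (rule sum.cong)
    fix G assume G: "G \<in> flats_above r E F"
    have FG: "F \<subseteq> G" using G by (auto simp: flats_above_def)
    have "chow_poly r E G = chow_poly r (E - {i}) (G - {i})"
      using less.hyps[OF flats_above_card[OF assms(1) G]] G rk[OF FG] less.prems(2)
      by (auto simp: flats_above_def)
    then show "gap_poly (r G - r F) * chow_poly r E G =
        gap_poly (r (G - {i}) - r (F - {i})) * chow_poly r (E - {i}) (G - {i})"
      using rk[OF FG] rk[of F] by simp
  qed simp
  also have "\<dots> = (\<Sum>G\<in>flats_above r (E - {i}) (F - {i}).
      gap_poly (r G - r (F - {i})) * chow_poly r (E - {i}) G)"
    by (rule sum.reindex_bij_betw[OF bij])
  finally show ?case using chow_poly_rec[of "E - {i}" "F - {i}"] assms(1) by simp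
qed

text \<open>These are the flats \<open>G\<close> above \<open>A\<close> for which \<open>i\<close>
  is a coloop of the restriction to the flat \<open>insert i G\<close>.\<close>

definition split_flats :: "'a set \<Rightarrow> 'a set \<Rightarrow> 'a \<Rightarrow> 'a set set" where
  "split_flats E A i = {G. A \<subset> G \<and> i \<notin> G \<and> rflat r E G \<and> rflat r E (insert i G)}"

lemma split_flats_subset: "split_flats E A i \<subseteq> flats_above r E A"
  by (auto simp: split_flats_def flats_above_def)

lemma finite_split_flats: "finite E \<Longrightarrow> finite (split_flats E A i)"
  using finite_subset[OF split_flats_subset finite_flats_above] .

text \<open>This is the numerical shadow of the semi-small decomposition of the Chow ring with respect
  to the deletion of \<open>i\<close>; a coloop \<open>i\<close> contributes the extra summand \<open>G = E - {i}\<close>.\<close>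

theorem chow_poly_deletion:
  assumes "finite E" "rflat r E A" "i \<in> E" "i \<notin> A"
  shows "chow_poly r E A = chow_poly r (E - {i}) A +
    monom 1 1 * (\<Sum>G\<in>split_flats E A i. chow_poly r G A * chow_poly r E (insert i G))"
  using assms(2,4)
proof (induction "card (E - A)" arbitrary: A rule: less_induct)
  case less
  note A = less.prems
  let ?t = "\<lambda>F. gap_poly (r F - r A)"
  \<comment> \<open>\<open>N\<close> is treated by the induction hypothesis. \<open>N\<close>
    together with the sets \<open>F - {i}\<close> for \<open>F\<close> in \<open>D\<close> gives
    exactly the flats of the deletion. \<open>C\<close> consists of the flats
    \<open>insert i G\<close> lying over a flat \<open>G\<close>, and supplies what the correction
    terms from \<open>N\<close> lack.\<close>
  define N where "N = {F \<in> flats_above r E A. i \<notin> F}"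
  define C where "C = {F \<in> flats_above r E A. i \<in> F \<and> rflat r E (F - {i})}"
  define D where "D = {F \<in> flats_above r E A. i \<in> F \<and> \<not> rflat r E (F - {i})}"
  let ?S = "\<lambda>A. split_flats E A i"
  have fin: "finite N" "finite C" "finite D" "finite (?S A)"
    using finite_flats_above[OF assms(1), of r A] finite_split_flats[OF assms(1)]
    by (auto simp: N_def C_def D_def)
  have Fl: "flats_above r E A = N \<union> (C \<union> D)" "N \<inter> (C \<union> D) = {}" "C \<inter> D = {}"
    by (auto simp: N_def C_def D_def)
  have sumN: "(\<Sum>F\<in>N. ?t F * chow_poly r E F) = (\<Sum>F\<in>N. ?t F * chow_poly r (E - {i}) F) +
      (\<Sum>F\<in>N. \<Sum>G\<in>?S F. monom 1 1 * (?t F * chow_poly r G F * chow_poly r E (insert i G)))"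
    unfolding sum.distrib[symmetric]
  proof (rule sum.cong)
    fix F assume F: "F \<in> N"
    then have F': "F \<in> flats_above r E A" by (simp add: N_def)
    have "chow_poly r E F = chow_poly r (E - {i}) F +
      monom 1 1 * (\<Sum>G\<in>?S F. chow_poly r G F * chow_poly r E (insert i G))"
      using less.hyps[OF flats_above_card[OF assms(1) F']] F by (auto simp: N_def flats_above_def)
    then show "?t F * chow_poly r E F = ?t F * chow_poly r (E - {i}) F +
      (\<Sum>G\<in>?S F. monom 1 1 * (?t F * chow_poly r G F * chow_poly r E (insert i G)))"
      by (simp add: algebra_simps sum_distrib_left)
  qed simp
  \<comment> \<open>The order of summation is reversed so that \<open>G\<close> comes first; the
    flats \<open>F\<close> strictly between \<open>A\<close> and \<open>G\<close> then form the
    recursion for the restriction to \<open>G\<close>, with the summand \<open>F = G\<close>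
    missing.\<close>
  have swap: "(\<Sum>F\<in>N. \<Sum>G\<in>?S F. monom 1 1 * (?t F * chow_poly r G F * chow_poly r E (insert i G))) =
    (\<Sum>G\<in>?S A. \<Sum>F\<in>flats_above r G A - {G}.
        monom 1 1 * (?t F * chow_poly r G F * chow_poly r E (insert i G)))"
  proof -
    have iff: "F \<in> N \<and> G \<in> ?S F \<longleftrightarrow> G \<in> ?S A \<and> F \<in> flats_above r G A - {G}" for F G
    proof
      assume "F \<in> N \<and> G \<in> ?S F"
      then show "G \<in> ?S A \<and> F \<in> flats_above r G A - {G}"
        using rflat_restrict[of E G F] by (auto simp: N_def split_flats_def flats_above_def)
    next
      assume asm: "G \<in> ?S A \<and> F \<in> flats_above r G A - {G}"
      then have "F \<subset> G" by (auto simp: flats_above_def rflat_def)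
      then show "F \<in> N \<and> G \<in> ?S F"
        using asm rflat_restrict[of E G F] by (auto simp: N_def split_flats_def flats_above_def)
    qed
    define R where "R = (\<lambda>F G. G \<in> ?S F)"
    have 1: "?S F = {G. G \<in> ?S A \<and> R F G}" if "F \<in> N" for F
      using iff that by (auto simp: R_def)
    have 2: "flats_above r G A - {G} = {F. F \<in> N \<and> R F G}" if "G \<in> ?S A" for G
      using iff that by (auto simp: R_def)
    show ?thesis
      using sum.swap_restrict[OF fin(1,4), of
          "\<lambda>F G. monom 1 1 * (?t F * chow_poly r G F * chow_poly r E (insert i G))" R]
      by (simp add: 1 2 cong: sum.cong)
  qed
  have sumC: "(\<Sum>F\<in>C. ?t F * chow_poly r E F) =
      (\<Sum>G\<in>?S A. gap_poly (Suc (r G - r A)) * chow_poly r E (insert i G))"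
  proof -
    have C_eq: "C = insert i ` (?S A) \<union> (if rflat r E (insert i A) then {insert i A} else {})"
    proof (intro equalityI subsetI)
      fix F assume F: "F \<in> C"
      then have 1: "F = insert i (F - {i})" "rflat r E (insert i (F - {i}))" "rflat r E (F - {i})"
        "A \<subseteq> F - {i}"
        using A by (auto simp: C_def flats_above_def insert_absorb)
      show "F \<in> insert i ` (?S A) \<union> (if rflat r E (insert i A) then {insert i A} else {})"
      proof (cases "A = F - {i}")
        case True
        then have "rflat r E (insert i A)" "F = insert i A" using 1 by auto
        then show ?thesis by simp
      next
        case False
        then have "F - {i} \<in> ?S A" using 1 by (auto simp: split_flats_def)
        then show ?thesis using 1(1) by blast
      qed
    next
      fix F assume F: "F \<in> insert i ` (?S A) \<union> (if rflat r E (insert i A) then {insert i A} else {})"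
      then show "F \<in> C"
        using A by (auto simp: C_def flats_above_def split_flats_def split: if_splits)
    qed
    have inj: "inj_on (insert i) (?S A)"
      by (rule inj_onI) (auto simp: split_flats_def)
    have "insert i A \<notin> insert i ` (?S A)"
      using A by (auto simp: split_flats_def)
    \<comment> \<open>This flat would belong to \<open>G = A\<close>, which
      \<open>split_flats\<close> leaves out; a gap of length one admits no exponent.\<close>
    moreover have "?t (insert i A) = 0"
      using rflat_rank_insert[OF A(1) assms(3) A(2)] by (simp add: gap_poly_1)
    ultimately have "(\<Sum>F\<in>C. ?t F * chow_poly r E F) =
        (\<Sum>F\<in>insert i ` (?S A). ?t F * chow_poly r E F)"
      unfolding C_eq using fin by (auto simp: sum.union_disjoint)
    also have "\<dots> = (\<Sum>G\<in>?S A. ?t (insert i G) * chow_poly r E (insert i G))"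
      by (simp add: sum.reindex[OF inj])
    also have "\<dots> = (\<Sum>G\<in>?S A. gap_poly (Suc (r G - r A)) * chow_poly r E (insert i G))"
    proof (rule sum.cong)
      fix G assume G: "G \<in> ?S A"
      have "r (insert i G) = Suc (r G)" "r A \<le> r G"
        using G assms(3) rank_mono[of A G] rflat_rank_insert[of E G i]
        by (auto simp: split_flats_def)
      then show "?t (insert i G) * chow_poly r E (insert i G) =
          gap_poly (Suc (r G - r A)) * chow_poly r E (insert i G)"
        by (simp add: Suc_diff_le)
    qed simp
    finally show ?thesis .
  qed
  have del: "chow_poly r (E - {i}) A = 1 + (\<Sum>F\<in>N. ?t F * chow_poly r (E - {i}) F) +
      (\<Sum>F\<in>D. ?t F * chow_poly r E F)"
  proof -
    have Fl': "flats_above r (E - {i}) A = N \<union> (\<lambda>F. F - {i}) ` D"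
    proof (intro equalityI subsetI)
      fix G assume G: "G \<in> flats_above r (E - {i}) A"
      then have G': "rflat r (E - {i}) G" "A \<subset> G" "i \<notin> G" by (auto simp: flats_above_def rflat_def)
      show "G \<in> N \<union> (\<lambda>F. F - {i}) ` D"
      proof (cases "rflat r E G")
        case True
        then show ?thesis using G' by (auto simp: N_def flats_above_def)
      next
        case False
        have "insert i G \<in> D"
          using False G' rflat_insert_of_delete[OF G'(1) assms(3) False]
          by (auto simp: D_def flats_above_def)
        then show ?thesis using G'(3) by (auto intro!: image_eqI[of _ _ "insert i G"])
      qed
    next
      fix G assume "G \<in> N \<union> (\<lambda>F. F - {i}) ` D"
      then show "G \<in> flats_above r (E - {i}) A"
      proof
        assume "G \<in> N"
        then show ?thesis by (auto simp: N_def flats_above_def rflat_def)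
      next
        assume "G \<in> (\<lambda>F. F - {i}) ` D"
        then obtain F where F: "G = F - {i}" "rflat r E F" "A \<subset> F" "i \<in> F" "\<not> rflat r E G"
          by (auto simp: D_def flats_above_def)
        then have "rflat r (E - {i}) G" using rflat_delete by auto
        moreover have "A \<subset> G" using F A by auto
        ultimately show ?thesis by (simp add: flats_above_def)
      qed
    qed
    have disj: "N \<inter> (\<lambda>F. F - {i}) ` D = {}" by (auto simp: N_def D_def flats_above_def)
    have inj: "inj_on (\<lambda>F. F - {i}) D" by (rule inj_onI) (auto simp: D_def)
    have "chow_poly r (E - {i}) A = 1 + ((\<Sum>F\<in>N. ?t F * chow_poly r (E - {i}) F) +
      (\<Sum>F\<in>(\<lambda>F. F - {i}) ` D. ?t F * chow_poly r (E - {i}) F))"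
      using assms(1) fin disj by (subst chow_poly_rec) (auto simp: Fl' sum.union_disjoint)
    also have "(\<Sum>F\<in>(\<lambda>F. F - {i}) ` D. ?t F * chow_poly r (E - {i}) F) =
        (\<Sum>F\<in>D. ?t F * chow_poly r E F)"
      unfolding sum.reindex[OF inj] o_def
    proof (rule sum.cong)
      fix F assume "F \<in> D"
      then have F: "rflat r E F" "i \<in> F" "\<not> rflat r E (F - {i})"
        by (auto simp: D_def flats_above_def)
      note rk = rflat_delete(1)[OF F]
      show "?t (F - {i}) * chow_poly r (E - {i}) (F - {i}) = ?t F * chow_poly r E F"
        using rk chow_poly_delete_contracted[OF assms(1) F(1,2) rk] by simp
    qed simp
    finally show ?thesis by (simp add: add.assoc)
  qed
  \<comment> \<open>The contribution of \<open>C\<close> at \<open>G\<close> is x times 1 plus the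
    gap polynomial of \<open>G\<close>: precisely the constant term and the summand
    \<open>F = G\<close> that complete the recursion for \<open>chow_poly r G A\<close>.\<close>
  have main: "(\<Sum>F\<in>flats_above r G A - {G}.
        monom 1 1 * (?t F * chow_poly r G F * chow_poly r E (insert i G))) +
      gap_poly (Suc (r G - r A)) * chow_poly r E (insert i G) =
      monom 1 1 * (chow_poly r G A * chow_poly r E (insert i G))" if G: "G \<in> ?S A" for G
  proof -
    have G': "A \<subset> G" "rflat r E G" "G \<subseteq> E" using G by (auto simp: split_flats_def rflat_def)
    have finG: "finite G" using G' assms(1) finite_subset by blast
    have "r A < r G" using rflat_rank_less[OF A(1)] G' by blast
    then have gap: "gap_poly (Suc (r G - r A)) = monom 1 1 * (1 + ?t G)"
      by (intro gap_poly_Suc) simp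
    have GG: "G \<in> flats_above r G A" using G' by (simp add: flats_above_def rflat_self)
    have "chow_poly r G A = 1 + (?t G + (\<Sum>F\<in>flats_above r G A - {G}. ?t F * chow_poly r G F))"
      using chow_poly_rec[OF finG, of A] sum.remove[OF finite_flats_above[OF finG] GG, of "\<lambda>F. ?t F * chow_poly r G F"]
        chow_poly_self[OF finG] by simp
    then show ?thesis
      by (simp add: gap algebra_simps sum_distrib_left)
  qed
  have "chow_poly r E A = 1 + ((\<Sum>F\<in>N. ?t F * chow_poly r E F) +
      ((\<Sum>F\<in>C. ?t F * chow_poly r E F) + (\<Sum>F\<in>D. ?t F * chow_poly r E F)))"
    unfolding chow_poly_rec[OF assms(1), of A] Fl(1) using fin Fl by (simp add: sum.union_disjoint)
  also have "\<dots> = chow_poly r (E - {i}) A + (\<Sum>G\<in>?S A. (\<Sum>F\<in>flats_above r G A - {G}.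
        monom 1 1 * (?t F * chow_poly r G F * chow_poly r E (insert i G))) +
      gap_poly (Suc (r G - r A)) * chow_poly r E (insert i G))"
    unfolding sumN swap sumC del sum.distrib by (simp only: add_ac)
  also have "(\<Sum>G\<in>?S A. (\<Sum>F\<in>flats_above r G A - {G}.
        monom 1 1 * (?t F * chow_poly r G F * chow_poly r E (insert i G))) +
      gap_poly (Suc (r G - r A)) * chow_poly r E (insert i G)) =
      monom 1 1 * (\<Sum>G\<in>?S A. chow_poly r G A * chow_poly r E (insert i G))"
    unfolding sum_distrib_left by (rule sum.cong) (auto simp only: main)
  finally show ?case .
qed

end

section \<open>Central moments\<close>

text \<open>Left unnormalised so that it is additive in \<open>p\<close>; division by
  \<open>poly p 1\<close> gives the expectation.\<close>

definition cmoment :: "nat \<Rightarrow> real \<Rightarrow> real poly \<Rightarrow> real" where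
  "cmoment t c p = (\<Sum>k\<le>degree p. coeff p k * (real k - c) ^ t)"

lemma cmoment_bound:
  assumes "degree p \<le> n"
  shows "cmoment t c p = (\<Sum>k\<le>n. coeff p k * (real k - c) ^ t)"
  unfolding cmoment_def
  by (rule sum.mono_neutral_left) (use assms in \<open>auto simp: coeff_eq_0\<close>)

lemma cmoment_add: "cmoment t c (p + q) = cmoment t c p + cmoment t c q"
proof -
  let ?n = "max (degree p) (degree q)"
  have "degree (p + q) \<le> ?n" by (rule degree_add_le) auto
  then show ?thesis
    by (simp add: cmoment_bound[of _ ?n] distrib_right sum.distrib)
qed

lemma cmoment_0: "cmoment t c 0 = 0"
  by (simp add: cmoment_def)

lemma cmoment_sum: "cmoment t c (\<Sum>i\<in>I. p i) = (\<Sum>i\<in>I. cmoment t c (p i))"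
  by (induction I rule: infinite_finite_induct) (auto simp: cmoment_add cmoment_0)

lemma cmoment_monom: "cmoment t c (monom x n) = x * (real n - c) ^ t"
  by (subst cmoment_bound[OF degree_monom_le]) (simp add: if_distrib[of "\<lambda>y. y * _"] cong: if_cong)

text \<open>Multiplying generating polynomials adds independent variables; the binomial theorem
  expands the power of the summed deviations.\<close>

lemma cmoment_mult:
  "cmoment t (a + b) (p * q) =
    (\<Sum>i\<le>t. real (t choose i) * cmoment i a p * cmoment (t - i) b q)"
proof -
  have "p * q = (\<Sum>k\<le>degree p. \<Sum>l\<le>degree q. monom (coeff p k * coeff q l) (k + l))"
    by (subst (1 2) poly_as_sum_of_monoms[symmetric]) (simp add: sum_product mult_monom)
  then have "cmoment t (a + b) (p * q) = (\<Sum>k\<le>degree p. \<Sum>l\<le>degree q.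
      coeff p k * coeff q l * ((real k - a) + (real l - b)) ^ t)"
    by (simp add: cmoment_sum cmoment_monom algebra_simps)
  also have "\<dots> = (\<Sum>k\<le>degree p. \<Sum>l\<le>degree q. \<Sum>i\<le>t.
      real (t choose i) * (coeff p k * (real k - a) ^ i) * (coeff q l * (real l - b) ^ (t - i)))"
    by (simp add: binomial_ring sum_distrib_left mult_ac)
  also have "\<dots> = (\<Sum>k\<le>degree p. \<Sum>i\<le>t. \<Sum>l\<le>degree q.
      real (t choose i) * (coeff p k * (real k - a) ^ i) * (coeff q l * (real l - b) ^ (t - i)))"
    by (intro sum.cong refl sum.swap)
  also have "\<dots> = (\<Sum>i\<le>t. \<Sum>k\<le>degree p. \<Sum>l\<le>degree q.
      real (t choose i) * (coeff p k * (real k - a) ^ i) * (coeff q l * (real l - b) ^ (t - i)))"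
    by (rule sum.swap)
  also have "\<dots> = (\<Sum>i\<le>t. real (t choose i) * cmoment i a p * cmoment (t - i) b q)"
    by (simp add: cmoment_def sum_product sum_distrib_left sum_distrib_right mult_ac)
  finally show ?thesis .
qed

lemma cmoment_monom_mult: "cmoment t (c + 1) (monom 1 1 * p) = cmoment t c p"
proof -
  have "cmoment t (c + 1) (p * monom 1 1) =
      (\<Sum>i\<le>t. real (t choose i) * cmoment i c p * 0 ^ (t - i))"
    by (simp add: cmoment_mult cmoment_monom)
  also have "\<dots> = (\<Sum>i\<le>t. if i = t then cmoment t c p else 0)"
    by (rule sum.cong) auto
  finally show ?thesis by (simp add: mult.commute)
qed

lemma cmoment_monom_mult_mult:
  "cmoment t (a + b + 1) (monom 1 1 * (p * q)) =
    (\<Sum>i\<le>t. real (t choose i) * cmoment i a p * cmoment (t - i) b q)"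
  unfolding cmoment_monom_mult by (rule cmoment_mult)

lemma cmoment_0_eq_poly: "cmoment 0 c p = poly p 1"
  by (simp add: cmoment_def poly_altdef)

definition all_coloops :: "('a set \<Rightarrow> nat) \<Rightarrow> 'a set \<Rightarrow> 'a set \<Rightarrow> bool" where
  "all_coloops r E A \<longleftrightarrow> A \<subseteq> E \<and> (\<forall>i\<in>E - A. r (E - {i}) < r E)"

context rank_function
begin

lemma poly_chow_poly_pos:
  assumes "finite E"
  shows "0 < poly (chow_poly r E A) 1"
proof -
  have "poly (chow_poly r E A) 1 = real (card (nested r E A))"
    by (simp add: chow_poly_def poly_sum poly_monom)
  also have "\<dots> > 0"
    using finite_nested[OF assms] nested_empty_mset by (auto simp: card_gt_0_iff)
  finally show ?thesis .
qed

lemma rank_delete: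
  assumes "i \<in> E"
  shows "r E \<le> Suc (r (E - {i}))"
  using rank_insert_le[of i "E - {i}"] assms by (simp add: insert_absorb)

text \<open>The restriction to \<open>G\<close>, the element \<open>i\<close> and the contraction of
  \<open>insert i G\<close> have ranks \<open>a + 1\<close>, 1 and \<open>b + 1\<close>, adding up
  to \<open>d + 1\<close>. Excluding \<open>insert i G = E\<close> keeps the last rank
  positive.\<close>

lemma split_flats_ranks:
  assumes "finite E" "rflat r E A" "i \<in> E" "i \<notin> A" "r E = r A + d + 1"
    and G: "G \<in> split_flats E A i" and "insert i G \<noteq> E"
  obtains a b where "r G = r A + a + 1" "r E = r (insert i G) + b + 1" "d = a + b + 2"
    "rflat r G A" "rflat r E (insert i G)" "finite G"
    "card (G - A) < card (E - A)" "card (E - insert i G) < card (E - A)"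
proof -
  have G': "A \<subset> G" "i \<notin> G" "rflat r E G" "rflat r E (insert i G)" "G \<subseteq> E"
    using G by (auto simp: split_flats_def rflat_def)
  have 1: "r A < r G" using rflat_rank_less[OF assms(2)] G' by blast
  have 2: "r (insert i G) = Suc (r G)" using rflat_rank_insert G' assms(3) by blast
  have 3: "r (insert i G) < r E"
    using rflat_rank_less[OF G'(4), of E] G' assms(3,7) by auto
  have c1: "card (G - A) < card (E - A)"
    using assms(1,3,4) G' by (intro psubset_card_mono) auto
  have c2: "card (E - insert i G) < card (E - A)"
    using assms(1,3,4) G' by (intro psubset_card_mono) auto
  have fin: "finite G" using G' assms(1) finite_subset by blast
  have fl: "rflat r G A" using rflat_subground[OF assms(2)] G' by auto
  show ?thesis
    by (rule that[of "r G - r A - 1" "r E - r (insert i G) - 1"])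
       (use 1 2 3 assms(5) c1 c2 fin fl G' in auto)
qed

text \<open>The summand for \<open>G = E - {i}\<close> is x times the polynomial of the deletion,
  because the other factor is \<open>chow_poly r E E = 1\<close>. The resulting factor 1 + x is
  symmetric about 1/2 and makes up for the rank lost by deleting a coloop.\<close>

lemma chow_poly_coloop:
  assumes "finite E" "rflat r E A" "i \<in> E" "i \<notin> A" "r (E - {i}) < r E" "A \<noteq> E - {i}"
  shows "chow_poly r E A = chow_poly r (E - {i}) A * (1 + monom 1 1) +
    monom 1 1 * (\<Sum>G\<in>split_flats E A i - {E - {i}}. chow_poly r G A * chow_poly r E (insert i G))"
proof -
  have "A \<subset> E - {i}" using assms by (auto simp: rflat_def)
  moreover have "rflat r E (E - {i})" "rflat r E (insert i (E - {i}))"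
    using assms by (auto simp: rflat_def insert_absorb)
  ultimately have mem: "E - {i} \<in> split_flats E A i" by (auto simp: split_flats_def)
  have "insert i (E - {i}) = E" using assms by auto
  then show ?thesis
    using chow_poly_deletion[OF assms(1-4)] chow_poly_self[OF assms(1)]
      sum.remove[OF finite_split_flats[OF assms(1)] mem, of
        "\<lambda>G. chow_poly r G A * chow_poly r E (insert i G)"]
    by (simp add: algebra_simps)
qed

text \<open>Odd central moments vanish by Poincare duality, but nonnegativity is all that is needed and
  it propagates directly through the deletion formula.\<close>

lemma cmoment_chow_poly_nonneg:
  assumes "finite E" "rflat r E A" "r E = r A + d + 1"
  shows "0 \<le> cmoment t (real d / 2) (chow_poly r E A)"
  using assms
proof (induction "card (E - A)" arbitrary: E A d t rule: less_induct)
  case less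
  note prems = less.prems
  have AE: "A \<subseteq> E" using prems by (simp add: rflat_def)
  have "A \<noteq> E" using prems by auto
  then obtain i where i: "i \<in> E" "i \<notin> A" using AE by auto
  have fl: "rflat r (E - {i}) A" using AE i by (intro rflat_subground[OF prems(2)]) auto
  have card: "card (E - {i} - A) < card (E - A)"
    using prems i by (intro psubset_card_mono) auto
  have term_nonneg: "0 \<le> cmoment t (real d / 2)
      (monom 1 1 * (chow_poly r G A * chow_poly r E (insert i G)))"
    if G: "G \<in> split_flats E A i" "insert i G \<noteq> E" for G
  proof -
    obtain a b where ab: "r G = r A + a + 1" "r E = r (insert i G) + b + 1" "d = a + b + 2"
      "rflat r G A" "rflat r E (insert i G)" "finite G"
      "card (G - A) < card (E - A)" "card (E - insert i G) < card (E - A)"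
      by (rule split_flats_ranks[OF prems(1,2) i prems(3) G])
    have "0 \<le> cmoment j (real a / 2) (chow_poly r G A)"
      "0 \<le> cmoment j (real b / 2) (chow_poly r E (insert i G))" for j
      using less.hyps ab prems(1) by blast+
    moreover have "real d / 2 = (real a / 2 + real b / 2) + 1" using ab(3) by (simp add: field_simps)
    ultimately show ?thesis
      by (simp only: cmoment_monom_mult_mult) (auto intro!: sum_nonneg)
  qed
  show ?case
  proof (cases "r (E - {i}) = r E")
    case True
    have "insert i G \<noteq> E" if "G \<in> split_flats E A i" for G
    proof
      assume "insert i G = E"
      moreover have "i \<notin> G" "rflat r E G" using that by (auto simp: split_flats_def)
      moreover from calculation have "E - {i} = G" by auto
      ultimately show False using True rflat_rank_insert[of E G i] i by simp
    qed
    moreover have "0 \<le> cmoment t (real d / 2) (chow_poly r (E - {i}) A)"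
      using less.hyps[OF card] prems fl True by simp
    ultimately show ?thesis
      using chow_poly_deletion[OF prems(1,2) i] term_nonneg
      by (auto simp: cmoment_add sum_distrib_left cmoment_sum intro!: add_nonneg_nonneg sum_nonneg)
  next
    case False
    then have rk: "r (E - {i}) < r E" using rank_mono[of "E - {i}" E] by auto
    then have rk': "r (E - {i}) = r A + d" using rank_delete[OF i(1)] prems(3) by simp
    show ?thesis
    \<comment> \<open>In this case the minor has rank one and polynomial 1; otherwise
      \<open>E - {i}\<close> lies strictly above \<open>A\<close>, as
      \<open>chow_poly_coloop\<close> requires.\<close>
    proof (cases "A = E - {i}")
      case True
      then have "split_flats E A i = {}" by (auto simp: split_flats_def rflat_def)
      moreover have "d = 0" using True rk' by simp
      ultimately have "cmoment t (real d / 2) (chow_poly r E A) = cmoment t 0 1"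
        using chow_poly_deletion[OF prems(1,2) i] True chow_poly_self[of "E - {i}"] prems(1) by simp
      then show ?thesis by (simp add: cmoment_def)
    next
      case ne: False
      then have "r A < r (E - {i})" using rflat_rank_less[OF fl, of "E - {i}"] AE i by auto
      then obtain e where d: "d = Suc e" using rk' by (cases d) auto
      have IH: "0 \<le> cmoment j (real e / 2) (chow_poly r (E - {i}) A)" for j
        using less.hyps[OF card] prems fl rk' d by simp
      \<comment> \<open>The centre \<open>real d / 2\<close> splits into that of the deletion and
        that of 1 + x, whose moments about 1/2 are \<open>(- (1/2)) ^ j + (1/2) ^ j\<close>.\<close>
      have half: "real d / 2 = real e / 2 + 1 / 2" using d by simp
      have "0 \<le> (- (1/2)) ^ j + (1/2 :: real) ^ j" for j :: nat
        by (cases "even j") (auto simp: power_minus_odd)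
      then have step: "0 \<le> cmoment j (1/2) (1 + monom 1 1)" for j
        using cmoment_monom[of j "1/2" 1 0] cmoment_monom[of j "1/2" 1 1]
        by (simp add: cmoment_add monom_0 one_pCons)
      have "0 \<le> cmoment t (real d / 2) (chow_poly r (E - {i}) A * (1 + monom 1 1))"
        unfolding half cmoment_mult using IH step by (auto intro!: sum_nonneg)
      moreover have "insert i G \<noteq> E" if "G \<in> split_flats E A i - {E - {i}}" for G
        using that by (auto simp: split_flats_def)
      ultimately show ?thesis
        unfolding chow_poly_coloop[OF prems(1,2) i rk ne] using term_nonneg
        by (auto simp: cmoment_add sum_distrib_left cmoment_sum intro!: add_nonneg_nonneg sum_nonneg)
    qed
  qed
qed

text \<open>The induction runs over all orders \<open>k\<close> up to \<open>t\<close> at once,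
  since the convolution at order \<open>k\<close> involves all lower moments of the two smaller
  minors. Deleting a non-coloop keeps the rank and hence \<open>d\<close>.\<close>

lemma cmoment_chow_poly_le:
  assumes cmfs: "CMFS t f"
    and f_nonneg: "\<And>d k. k \<le> t \<Longrightarrow> 0 \<le> f k d"
    and base: "\<And>E A d k. finite E \<Longrightarrow> all_coloops r E A \<Longrightarrow> r E = r A + d + 1 \<Longrightarrow> k \<le> t \<Longrightarrow>
      cmoment k (real d / 2) (chow_poly r E A) \<le> f k d * poly (chow_poly r E A) 1"
    and "finite E" "rflat r E A" "r E = r A + d + 1" "k \<le> t"
  shows "cmoment k (real d / 2) (chow_poly r E A) \<le> f k d * poly (chow_poly r E A) 1"
  using assms(4-)
proof (induction "card (E - A)" arbitrary: E A d k rule: less_induct)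
  case less
  note prems = less.prems
  have AE: "A \<subseteq> E" using prems by (simp add: rflat_def)
  show ?case
  proof (cases "all_coloops r E A")
    case True
    then show ?thesis using base prems by blast
  next
    case False
    then obtain i where i: "i \<in> E" "i \<notin> A" "\<not> r (E - {i}) < r E"
      using AE by (auto simp: all_coloops_def)
    then have rk: "r (E - {i}) = r E" using rank_mono[of "E - {i}" E] by auto
    have fl: "rflat r (E - {i}) A" using AE i by (intro rflat_subground[OF prems(2)]) auto
    have card: "card (E - {i} - A) < card (E - A)"
      using prems i by (intro psubset_card_mono) auto
    have summand_le: "cmoment k (real d / 2) (monom 1 1 * (chow_poly r G A * chow_poly r E (insert i G)))
        \<le> f k d * (poly (chow_poly r G A) 1 * poly (chow_poly r E (insert i G)) 1)"
      if G: "G \<in> split_flats E A i" for G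
    proof -
      have ne: "insert i G \<noteq> E"
      proof
        assume "insert i G = E"
        moreover have "i \<notin> G" "rflat r E G" using that by (auto simp: split_flats_def)
        moreover from calculation have "E - {i} = G" by auto
        ultimately show False using rk rflat_rank_insert[of E G i] i by simp
      qed
      obtain a b where ab: "r G = r A + a + 1" "r E = r (insert i G) + b + 1" "d = a + b + 2"
        "rflat r G A" "rflat r E (insert i G)" "finite G"
        "card (G - A) < card (E - A)" "card (E - insert i G) < card (E - A)"
        by (rule split_flats_ranks[OF prems(1,2) i(1,2) prems(3) G ne])
      define p q where "p = chow_poly r G A" and "q = chow_poly r E (insert i G)"
      have pos: "0 < poly p 1" "0 < poly q 1"
        using poly_chow_poly_pos ab(6) prems(1) by (auto simp: p_def q_def)
      have le: "cmoment j (real a / 2) p \<le> f j a * poly p 1"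
        "cmoment j (real b / 2) q \<le> f j b * poly q 1" if "j \<le> t" for j
        using less.hyps ab prems(1) that unfolding p_def q_def by blast+
      have nn: "0 \<le> cmoment j (real a / 2) p" "0 \<le> cmoment j (real b / 2) q" for j
        using cmoment_chow_poly_nonneg ab prems(1) unfolding p_def q_def by blast+
      have "real d / 2 = (real a / 2 + real b / 2) + 1" using ab(3) by (simp add: field_simps)
      then have "cmoment k (real d / 2) (monom 1 1 * (p * q)) =
          (\<Sum>j\<le>k. real (k choose j) * (cmoment j (real a / 2) p * cmoment (k - j) (real b / 2) q))"
        by (simp only: cmoment_monom_mult_mult mult.assoc[of "real _"])
      \<comment> \<open>Two upper bounds are multiplied, which is legitimate because moments and
        bounds are nonnegative.\<close>
      also have "\<dots> \<le> (\<Sum>j\<le>k. real (k choose j) * ((f j a * poly p 1) * (f (k - j) b * poly q 1)))"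
        using le nn pos f_nonneg prems(4)
        by (intro sum_mono mult_left_mono mult_mono) (auto intro!: mult_nonneg_nonneg)
      also have "\<dots> = (\<Sum>j\<le>k. real (k choose j) * f j a * f (k - j) b) * (poly p 1 * poly q 1)"
        by (simp add: sum_distrib_right sum_distrib_left mult_ac)
      also have "\<dots> \<le> f k d * (poly p 1 * poly q 1)"
        using cmfs prems(4) pos ab(3) by (intro mult_right_mono) (auto simp: CMFS_def)
      finally show ?thesis unfolding p_def q_def .
    qed
    have "cmoment k (real d / 2) (chow_poly r (E - {i}) A) \<le> f k d * poly (chow_poly r (E - {i}) A) 1"
      using less.hyps[OF card] prems fl rk by simp
    moreover have "(\<Sum>G\<in>split_flats E A i.
          cmoment k (real d / 2) (monom 1 1 * (chow_poly r G A * chow_poly r E (insert i G))))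
        \<le> (\<Sum>G\<in>split_flats E A i.
          f k d * (poly (chow_poly r G A) 1 * poly (chow_poly r E (insert i G)) 1))"
      by (intro sum_mono summand_le)
    ultimately show ?thesis
      unfolding chow_poly_deletion[OF prems(1,2) i(1,2)] sum_distrib_left cmoment_add cmoment_sum
        poly_add poly_sum poly_mult poly_monom distrib_left
      by simp
  qed
qed

section \<open>Boolean minors\<close>

lemma all_coloops_rank:
  assumes "finite E" "all_coloops r E A" "A \<subseteq> X" "X \<subseteq> E"
  shows "r X = r A + card (X - A)" and "rflat r E X" and "all_coloops r E X"
proof -
  \<comment> \<open>If \<open>e\<close> did not raise the rank of \<open>Y\<close>, then by
    submodularity it would not raise that of \<open>E - {e}\<close> either and would not be a
    coloop.\<close>
  have ins: "r (insert e Y) = Suc (r Y)" if "A \<subseteq> Y" "Y \<subseteq> E" "e \<in> E" "e \<notin> Y" for e Y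
  proof -
    have "r (insert e Y) \<noteq> r Y"
    proof
      assume "r (insert e Y) = r Y"
      then have "r (insert e (E - {e})) = r (E - {e})"
        by (rule rank_insert_eq_mono) (use that in auto)
      moreover have "insert e (E - {e}) = E" "e \<in> E - A" using that by auto
      ultimately show False using assms(2) by (fastforce simp: all_coloops_def)
    qed
    then show ?thesis using rank_insert_le[of e Y] rank_mono[OF subset_insertI[of Y e]] by simp
  qed
  show "rflat r E X" using ins assms by (auto simp: rflat_def)
  show "all_coloops r E X" using assms by (auto simp: all_coloops_def)
  have fin: "finite (X - A)" using assms finite_subset by blast
  have rk: "finite S \<Longrightarrow> S \<subseteq> E - A \<Longrightarrow> r (A \<union> S) = r A + card S" for S
  proof (induction S rule: finite_induct)
    case (insert e S)
    have "r (insert e (A \<union> S)) = Suc (r (A \<union> S))"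
      using insert assms by (intro ins) (auto simp: all_coloops_def)
    then show ?case using insert by simp
  qed simp
  have "r (A \<union> (X - A)) = r A + card (X - A)" by (rule rk[OF fin]) (use assms(4) in blast)
  moreover have "A \<union> (X - A) = X" using assms by auto
  ultimately show "r X = r A + card (X - A)" by simp
qed

lemma chow_poly_all_coloops_rec:
  assumes "finite E" "all_coloops r E A"
  shows "chow_poly r E A = 1 +
    (\<Sum>S\<in>Pow (E - A) - {{}}. gap_poly (card S) * chow_poly r E (A \<union> S))"
proof -
  have AE: "A \<subseteq> E" using assms by (simp add: all_coloops_def)
  have bij: "bij_betw (\<lambda>S. A \<union> S) (Pow (E - A) - {{}}) (flats_above r E A)"
  proof (rule bij_betw_byWitness[where f' = "\<lambda>F. F - A"])
    show "(\<lambda>S. A \<union> S) ` (Pow (E - A) - {{}}) \<subseteq> flats_above r E A"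
    proof
      fix F assume "F \<in> (\<lambda>S. A \<union> S) ` (Pow (E - A) - {{}})"
      then have "A \<subset> F" "F \<subseteq> E" using AE by auto
      then show "F \<in> flats_above r E A"
        using all_coloops_rank(2)[OF assms] by (auto simp: flats_above_def)
    qed
  qed (auto simp: flats_above_def rflat_def)
  have "(\<Sum>F\<in>flats_above r E A. gap_poly (r F - r A) * chow_poly r E F) =
      (\<Sum>S\<in>Pow (E - A) - {{}}. gap_poly (r (A \<union> S) - r A) * chow_poly r E (A \<union> S))"
    by (rule sum.reindex_bij_betw[OF bij, symmetric])
  also have "\<dots> = (\<Sum>S\<in>Pow (E - A) - {{}}. gap_poly (card S) * chow_poly r E (A \<union> S))"
  proof (rule sum.cong)
    fix S assume "S \<in> Pow (E - A) - {{}}"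
    then have "A \<union> S - A = S" "A \<union> S \<subseteq> E" using AE by auto
    then show "gap_poly (r (A \<union> S) - r A) * chow_poly r E (A \<union> S) =
        gap_poly (card S) * chow_poly r E (A \<union> S)"
      using all_coloops_rank(1)[OF assms, of "A \<union> S"] by simp
  qed simp
  finally show ?thesis using chow_poly_rec[OF assms(1), of A] by simp
qed

end

text \<open>When every set between \<open>A\<close> and \<open>E\<close> is a flat, the recursion
  depends on cardinalities only and any bijection of the complements carries it over. The two
  element types differ because the standard Boolean matroid lives on \<open>nat\<close>.\<close>

lemma chow_poly_all_coloops_cong:
  fixes r :: "'a set \<Rightarrow> nat" and r' :: "'b set \<Rightarrow> nat"
  assumes r: "rank_function r" and r': "rank_function r'"
    and "finite E" "all_coloops r E A" "finite E'" "all_coloops r' E' A'"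
    and "card (E - A) = card (E' - A')"
  shows "chow_poly r E A = chow_poly r' E' A'"
  using assms(4,6,7)
proof (induction "card (E - A)" arbitrary: A A' rule: less_induct)
  case less
  obtain g where g: "bij_betw g (E - A) (E' - A')"
    using finite_same_card_bij[of "E - A" "E' - A'"] less.prems(3) assms(3,5) by auto
  have AE: "A \<subseteq> E" "A' \<subseteq> E'" using less.prems by (auto simp: all_coloops_def)
  have bij: "bij_betw (image g) (Pow (E - A) - {{}}) (Pow (E' - A') - {{}})"
    by (rule bij_betw_DiffI[OF bij_betw_Pow[OF g]]) (auto simp: bij_betw_def)
  have "(\<Sum>S\<in>Pow (E - A) - {{}}. gap_poly (card S) * chow_poly r E (A \<union> S)) =
      (\<Sum>S\<in>Pow (E - A) - {{}}. gap_poly (card (g ` S)) * chow_poly r' E' (A' \<union> g ` S))"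
  proof (rule sum.cong)
    fix S assume S: "S \<in> Pow (E - A) - {{}}"
    have inj: "inj_on g S" using g S by (auto simp: bij_betw_def intro: inj_on_subset)
    have gS: "g ` S \<subseteq> E' - A'" using g S by (auto simp: bij_betw_def)
    have fin: "finite S" using S assms(3) finite_subset by blast
    have "E - (A \<union> S) = (E - A) - S" "E' - (A' \<union> g ` S) = (E' - A') - g ` S" by auto
    then have c: "card (E - (A \<union> S)) = card (E - A) - card S"
      "card (E' - (A' \<union> g ` S)) = card (E' - A') - card (g ` S)"
      using S gS fin card_Diff_subset[of S "E - A"] card_Diff_subset[of "g ` S" "E' - A'"] by auto
    have "card S \<noteq> 0" using S fin by auto
    moreover have "card S \<le> card (E - A)" using S assms(3) by (intro card_mono) auto
    ultimately have lt: "card (E - (A \<union> S)) < card (E - A)" using c by simp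
    have "chow_poly r E (A \<union> S) = chow_poly r' E' (A' \<union> g ` S)"
    proof (rule less.hyps[OF lt])
      show "all_coloops r E (A \<union> S)"
        using S AE by (intro rank_function.all_coloops_rank(3)[OF r assms(3) less.prems(1)]) auto
      show "all_coloops r' E' (A' \<union> g ` S)"
        using gS AE by (intro rank_function.all_coloops_rank(3)[OF r' assms(5) less.prems(2)]) auto
      show "card (E - (A \<union> S)) = card (E' - (A' \<union> g ` S))"
        using c less.prems(3) card_image[OF inj] by simp
    qed
    then show "gap_poly (card S) * chow_poly r E (A \<union> S) =
        gap_poly (card (g ` S)) * chow_poly r' E' (A' \<union> g ` S)"
      using card_image[OF inj] by simp
  qed simp
  also have "\<dots> = (\<Sum>S\<in>Pow (E' - A') - {{}}. gap_poly (card S) * chow_poly r' E' (A' \<union> S))"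
    by (rule sum.reindex_bij_betw[OF bij])
  finally show ?case
    using rank_function.chow_poly_all_coloops_rec[OF r assms(3) less.prems(1)]
      rank_function.chow_poly_all_coloops_rec[OF r' assms(5) less.prems(2)] by simp
qed

section \<open>A degree functional from the Hall-Rado condition\<close>

text \<open>Rational polynomials with one variable for every set; a monomial is a multiset of
  sets.\<close>

type_synonym 'a mring = "'a set multiset \<Rightarrow>\<^sub>0 rat"

definition hvar :: "'a set \<Rightarrow> 'a mring" where
  "hvar F = Poly_Mapping.single {#F#} 1"

lemma poly_mapping_sum_single:
  fixes p :: "'b \<Rightarrow>\<^sub>0 'c::comm_monoid_add"
  shows "(\<Sum>m\<in>Poly_Mapping.keys p. Poly_Mapping.single m (Poly_Mapping.lookup p m)) = p"
  by (rule poly_mapping_eqI)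
     (auto simp: lookup_sum lookup_single when_def in_keys_iff)

lemma subseteq_add_mset_cases:
  assumes "J \<subseteq># add_mset x Y"
  obtains "J \<subseteq># Y" | J' where "J = add_mset x J'" "J' \<subseteq># Y"
proof (cases "x \<in># J")
  case True
  then obtain J' where "J = add_mset x J'" by (metis insert_DiffM)
  then show ?thesis using assms that(2) by simp
next
  case False
  have "J \<subseteq># Y"
    unfolding subseteq_mset_def
  proof
    fix a
    have "count J a \<le> count (add_mset x Y) a" using assms by (rule mset_subset_eq_count)
    then show "count J a \<le> count Y a" using False by (cases "a = x") (auto simp: not_in_iff)
  qed
  then show ?thesis by (rule that(1))
qed

context rank_function
begin

text \<open>The dragon Hall-Rado condition. The strict inequality reflects that the top degree of
  the Chow ring is one less than the rank.\<close>

definition hall :: "'a set multiset \<Rightarrow> bool" where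
  "hall M \<longleftrightarrow> (\<forall>J. J \<subseteq># M \<longrightarrow> J \<noteq> {#} \<longrightarrow> size J < r (\<Union>(set_mset J)))"

text \<open>All degrees count, not only the top one: for subsets of \<open>T\<close> and below the
  top degree, a monomial has the same value as its product with a power of \<open>hvar T\<close>
  that stays within degree \<open>r T - 1\<close>, by \<open>hall_add_replicate\<close>.\<close>

definition hall_deg :: "'a mring \<Rightarrow> rat" where
  "hall_deg y = (\<Sum>M\<in>Poly_Mapping.keys y. Poly_Mapping.lookup y M * of_bool (hall M))"

lemma hallD: "hall M \<Longrightarrow> J \<subseteq># M \<Longrightarrow> J \<noteq> {#} \<Longrightarrow> size J < r (\<Union>(set_mset J))"
  by (simp add: hall_def)

lemma hall_submset: "hall N \<Longrightarrow> M \<subseteq># N \<Longrightarrow> hall M"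
  unfolding hall_def by (meson subset_mset.order_trans)

lemma hall_enlarge:
  assumes "hall (add_mset F M)" "F \<subseteq> G"
  shows "hall (add_mset G M)"
  unfolding hall_def
proof (intro allI impI)
  fix J assume J: "J \<subseteq># add_mset G M" "J \<noteq> {#}"
  show "size J < r (\<Union>(set_mset J))"
  proof (rule subseteq_add_mset_cases[OF J(1)])
    assume "J \<subseteq># M"
    then show ?thesis
      using hall_submset[OF assms(1), of M] J(2) by (simp add: hall_def)
  next
    fix J' assume J': "J = add_mset G J'" "J' \<subseteq># M"
    then have "size (add_mset F J') < r (\<Union>(set_mset (add_mset F J')))"
      by (intro hallD[OF assms(1)]) auto
    also have "\<dots> \<le> r (\<Union>(set_mset J))" using J'(1) assms(2) by (intro rank_mono) auto
    finally show ?thesis using J'(1) by simp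
  qed
qed

lemma not_hallE:
  assumes "\<not> hall (add_mset F M)" "hall M"
  obtains J where "J \<subseteq># M" "r (F \<union> \<Union>(set_mset J)) \<le> Suc (size J)"
proof -
  obtain J where J: "J \<subseteq># add_mset F M" "J \<noteq> {#}" "\<not> size J < r (\<Union>(set_mset J))"
    using assms(1) by (auto simp: hall_def)
  show ?thesis
  proof (rule subseteq_add_mset_cases[OF J(1)])
    assume "J \<subseteq># M"
    then show ?thesis using assms(2) J by (auto simp: hall_def)
  next
    fix J' assume "J = add_mset F J'" "J' \<subseteq># M"
    then show ?thesis using J(3) that[of J'] by simp
  qed
qed

lemma not_hallI:
  assumes "J \<subseteq># M" "J \<noteq> {#}" "r (\<Union>(set_mset J)) \<le> size J"
  shows "\<not> hall M"
  using assms by (auto simp: hall_def not_less)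

text \<open>A violating submultiset has to use both \<open>F\<close> and \<open>G\<close>. Its union
  does not change when \<open>G\<close> is replaced by \<open>F \<union> G\<close>, so it also
  violates the condition for \<open>F\<close> and \<open>F \<union> G\<close>.\<close>

lemma hall_exchange_1:
  assumes FK: "hall (add_mset F (add_mset (F \<union> G) M))" and GK: "hall (add_mset G (add_mset (F \<union> G) M))"
  shows "hall (add_mset F (add_mset G M))"
proof (rule ccontr)
  assume neg: "\<not> ?thesis"
  have GM: "hall (add_mset G M)" by (rule hall_submset[OF GK]) simp
  have FM: "hall (add_mset F M)" by (rule hall_submset[OF FK]) simp
  obtain J where J: "J \<subseteq># add_mset G M" "r (F \<union> \<Union>(set_mset J)) \<le> Suc (size J)"
    by (rule not_hallE[OF neg GM])
  show False
  proof (rule subseteq_add_mset_cases[OF J(1)])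
    assume "J \<subseteq># M"
    then have "\<not> hall (add_mset F M)"
      using J(2) by (intro not_hallI[of "add_mset F J"]) auto
    then show False using FM by simp
  next
    fix J' assume J': "J = add_mset G J'" "J' \<subseteq># M"
    have "\<Union>(set_mset (add_mset F (add_mset (F \<union> G) J'))) = F \<union> \<Union>(set_mset J)" using J' by auto
    then have "\<not> hall (add_mset F (add_mset (F \<union> G) M))"
      using J(2) J' by (intro not_hallI[of "add_mset F (add_mset (F \<union> G) J')"]) auto
    then show False using FK by simp
  qed
qed

text \<open>Uncrossing: submodularity is applied to the violators \<open>J1\<close> of
  \<open>F\<close> and \<open>J2\<close> of \<open>G\<close>. If they are disjoint, their union
  violates together with two copies of \<open>F \<union> G\<close>; otherwise the Hall condition on
  their intersection gains one, and a single copy suffices.\<close>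

lemma hall_exchange_2:
  assumes FK: "\<not> hall (add_mset F (add_mset (F \<union> G) M))" and GK: "\<not> hall (add_mset G (add_mset (F \<union> G) M))"
  shows "\<not> hall (add_mset (F \<union> G) (add_mset (F \<union> G) M))"
proof
  let ?K = "F \<union> G"
  assume KK: "hall (add_mset ?K (add_mset ?K M))"
  have KM: "hall (add_mset ?K M)" by (rule hall_submset[OF KK]) simp
  have M: "hall M" by (rule hall_submset[OF KM]) simp
  have key: "\<exists>J. J \<subseteq># M \<and> r (H \<union> \<Union>(set_mset J)) \<le> Suc (size J)"
    if neg: "\<not> hall (add_mset H (add_mset ?K M))" and H: "H \<subseteq> ?K" for H
  proof -
    obtain J where J: "J \<subseteq># add_mset ?K M" "r (H \<union> \<Union>(set_mset J)) \<le> Suc (size J)"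
      by (rule not_hallE[OF neg KM])
    show ?thesis
    proof (rule subseteq_add_mset_cases[OF J(1)])
      fix J' assume J': "J = add_mset ?K J'" "J' \<subseteq># M"
      have "\<Union>(set_mset (add_mset ?K (add_mset ?K J'))) = H \<union> \<Union>(set_mset J)" using J' H by auto
      then have "\<not> hall (add_mset ?K (add_mset ?K M))"
        using J(2) J' by (intro not_hallI[of "add_mset ?K (add_mset ?K J')"]) auto
      then show ?thesis using KK by simp
    qed (use J in auto)
  qed
  obtain J1 where J1: "J1 \<subseteq># M" "r (F \<union> \<Union>(set_mset J1)) \<le> Suc (size J1)"
    using key[OF FK] by auto
  obtain J2 where J2: "J2 \<subseteq># M" "r (G \<union> \<Union>(set_mset J2)) \<le> Suc (size J2)"
    using key[OF GK] by auto
  let ?I = "J1 \<inter># J2" and ?U = "J1 \<union># J2"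
  have size: "size ?I + size ?U = size J1 + size J2"
    using size_Un_Int[of J1 J2] by simp
  have U: "?U \<subseteq># M" using J1 J2 by simp
  have "(F \<union> \<Union>(set_mset J1)) \<union> (G \<union> \<Union>(set_mset J2)) = ?K \<union> \<Union>(set_mset ?U)" by auto
  moreover have "r (\<Union>(set_mset ?I)) \<le> r ((F \<union> \<Union>(set_mset J1)) \<inter> (G \<union> \<Union>(set_mset J2)))"
    by (intro rank_mono) auto
  ultimately have sub: "r (?K \<union> \<Union>(set_mset ?U)) + r (\<Union>(set_mset ?I)) \<le> size J1 + size J2 + 2"
    using rank_submodular[of "F \<union> \<Union>(set_mset J1)" "G \<union> \<Union>(set_mset J2)"] J1(2) J2(2) by simp
  show False
  proof (cases "?I = {#}")
    case True
    then have "r (?K \<union> \<Union>(set_mset ?U)) \<le> size ?U + 2" using sub size by simp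
    then have "\<not> hall (add_mset ?K (add_mset ?K M))"
      using U by (intro not_hallI[of "add_mset ?K (add_mset ?K ?U)"]) (auto simp: Un_assoc)
    then show False using KK by simp
  next
    case False
    have "?I \<subseteq># M" using J1(1) by (meson subset_mset.inf_le1 subset_mset.order_trans)
    then have "size ?I < r (\<Union>(set_mset ?I))" using False by (intro hallD[OF M])
    then have "r (?K \<union> \<Union>(set_mset ?U)) \<le> size ?U + 1" using sub size by simp
    then have "\<not> hall (add_mset ?K M)"
      using U by (intro not_hallI[of "add_mset ?K ?U"]) auto
    then show False using KM by simp
  qed
qed

text \<open>With \<open>K = F \<union> G\<close> the truth values satisfy FG \<le> FK, GK \<le> KK
  by enlargement, and the two exchange lemmas make FG the minimum and KK the maximum of the middle
  pair. Minimum plus maximum equals the sum.\<close>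

lemma hall_exchange:
  "of_bool (hall (add_mset F (add_mset G M))) + of_bool (hall (add_mset (F \<union> G) (add_mset (F \<union> G) M))) =
   (of_bool (hall (add_mset F (add_mset (F \<union> G) M))) +
    of_bool (hall (add_mset G (add_mset (F \<union> G) M))) :: rat)"
proof -
  let ?K = "F \<union> G"
  have 1: "hall (add_mset F (add_mset G M)) \<Longrightarrow> hall (add_mset F (add_mset ?K M))"
    using hall_enlarge[of G "add_mset F M" ?K] by (simp add: add_mset_commute)
  have 2: "hall (add_mset F (add_mset G M)) \<Longrightarrow> hall (add_mset G (add_mset ?K M))"
    using hall_enlarge[of F "add_mset G M" ?K] by (simp add: add_mset_commute)
  have 3: "hall (add_mset F (add_mset ?K M)) \<Longrightarrow> hall (add_mset ?K (add_mset ?K M))"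
    using hall_enlarge[of F "add_mset ?K M" ?K] by simp
  have 4: "hall (add_mset G (add_mset ?K M)) \<Longrightarrow> hall (add_mset ?K (add_mset ?K M))"
    using hall_enlarge[of G "add_mset ?K M" ?K] by simp
  show ?thesis
    using 1 2 3 4 hall_exchange_1[of F G M] hall_exchange_2[of F G M] by (auto simp: of_bool_def)
qed

section \<open>Linearity of the functional and the radical of its pairing\<close>

lemma hall_deg_superset:
  assumes "finite K" "Poly_Mapping.keys y \<subseteq> K"
  shows "hall_deg y = (\<Sum>M\<in>K. Poly_Mapping.lookup y M * of_bool (hall M))"
  unfolding hall_deg_def using assms by (intro sum.mono_neutral_left) (auto simp: in_keys_iff)

lemma hall_deg_add: "hall_deg (y + z) = hall_deg y + hall_deg z"
proof -
  let ?K = "Poly_Mapping.keys y \<union> Poly_Mapping.keys z"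
  have "Poly_Mapping.keys (y + z) \<subseteq> ?K" by (rule keys_add)
  then show ?thesis
    by (simp add: hall_deg_superset[of ?K] lookup_add distrib_right sum.distrib)
qed

lemma hall_deg_0: "hall_deg 0 = 0"
  by (simp add: hall_deg_def)

lemma hall_deg_uminus: "hall_deg (- y) = - hall_deg y"
  using hall_deg_add[of y "- y"] by (simp add: hall_deg_0)

lemma hall_deg_diff: "hall_deg (y - z) = hall_deg y - hall_deg z"
  using hall_deg_add[of y "- z"] by (simp add: hall_deg_uminus)

lemma hall_deg_sum: "hall_deg (\<Sum>i\<in>I. y i) = (\<Sum>i\<in>I. hall_deg (y i))"
  by (induction I rule: infinite_finite_induct) (auto simp: hall_deg_add hall_deg_0)

lemma hall_deg_single: "hall_deg (Poly_Mapping.single M c) = c * of_bool (hall M)"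
  by (subst hall_deg_superset[of "{M}"]) auto

lemma hall_deg_single_scale:
  "hall_deg (z * Poly_Mapping.single N c) = c * hall_deg (z * Poly_Mapping.single N 1)"
proof -
  have *: "hall_deg (Poly_Mapping.single 0 c * w) = c * hall_deg w" for w
  proof -
    have "hall_deg (Poly_Mapping.single 0 c * w) =
      (\<Sum>M\<in>Poly_Mapping.keys w. hall_deg (Poly_Mapping.single M (c * Poly_Mapping.lookup w M)))"
      by (subst (1) poly_mapping_sum_single[of w, symmetric])
         (simp add: sum_distrib_left mult_single hall_deg_sum)
    also have "\<dots> = c * hall_deg w"
      unfolding hall_deg_single hall_deg_def[of w] sum_distrib_left by (simp only: mult.assoc)
    finally show ?thesis .
  qed
  have "z * Poly_Mapping.single N c = Poly_Mapping.single 0 c * (z * Poly_Mapping.single N 1)"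
    by (simp add: mult.left_commute[of _ z] mult_single)
  then show ?thesis using * by simp
qed

lemma hall_deg_mult_expand:
  "hall_deg (z * y) = (\<Sum>N\<in>Poly_Mapping.keys y.
     Poly_Mapping.lookup y N * hall_deg (z * Poly_Mapping.single N 1))"
proof -
  have "hall_deg (z * y) =
      (\<Sum>N\<in>Poly_Mapping.keys y. hall_deg (z * Poly_Mapping.single N (Poly_Mapping.lookup y N)))"
    by (subst (1) poly_mapping_sum_single[of y, symmetric]) (simp add: sum_distrib_left hall_deg_sum)
  then show ?thesis by (simp only: hall_deg_single_scale[of z _ "Poly_Mapping.lookup y _"])
qed

text \<open>The radical of the bilinear form sending \<open>z\<close> and \<open>y\<close> to
  \<open>hall_deg (z * y)\<close>, that is, the largest ideal on which the functional
  vanishes.\<close>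

definition null_ideal :: "'a mring set" where
  "null_ideal = {z. \<forall>y. hall_deg (z * y) = 0}"

lemma null_idealI:
  assumes "\<And>M. hall_deg (z * Poly_Mapping.single M 1) = 0"
  shows "z \<in> null_ideal"
  unfolding null_ideal_def using hall_deg_mult_expand[of z] assms by simp

lemma null_ideal_0: "0 \<in> null_ideal"
  by (simp add: null_ideal_def hall_deg_0)

lemma null_ideal_add: "y \<in> null_ideal \<Longrightarrow> z \<in> null_ideal \<Longrightarrow> y + z \<in> null_ideal"
  by (simp add: null_ideal_def distrib_right hall_deg_add)

lemma null_ideal_uminus: "z \<in> null_ideal \<Longrightarrow> - z \<in> null_ideal"
  by (simp add: null_ideal_def hall_deg_uminus)

lemma null_ideal_diff: "y \<in> null_ideal \<Longrightarrow> z \<in> null_ideal \<Longrightarrow> y - z \<in> null_ideal"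
  by (simp add: null_ideal_def left_diff_distrib hall_deg_diff)

lemma null_ideal_mult: "z \<in> null_ideal \<Longrightarrow> z * y \<in> null_ideal"
  by (simp add: null_ideal_def mult.assoc)

lemma null_ideal_mult_left: "z \<in> null_ideal \<Longrightarrow> y * z \<in> null_ideal"
  by (subst mult.commute) (rule null_ideal_mult)

lemma null_ideal_sum: "(\<And>i. i \<in> I \<Longrightarrow> z i \<in> null_ideal) \<Longrightarrow> (\<Sum>i\<in>I. z i) \<in> null_ideal"
  by (induction I rule: infinite_finite_induct) (auto simp: null_ideal_0 null_ideal_add)

lemma hvar_exchange_null: "(hvar F - hvar (F \<union> G)) * (hvar G - hvar (F \<union> G)) \<in> null_ideal"
proof (rule null_idealI)
  fix M
  show "hall_deg ((hvar F - hvar (F \<union> G)) * (hvar G - hvar (F \<union> G)) * Poly_Mapping.single M 1) = 0"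
    using hall_exchange[of F G M]
    by (simp add: hvar_def algebra_simps mult_single hall_deg_add hall_deg_diff hall_deg_single
        add_mset_commute)
qed

lemma hvar_rank1_null:
  assumes "r F \<le> 1"
  shows "hvar F \<in> null_ideal"
proof (rule null_idealI)
  fix M
  have "\<not> hall (add_mset F M)" using assms by (intro not_hallI[of "{#F#}"]) auto
  then show "hall_deg (hvar F * Poly_Mapping.single M 1) = 0"
    by (simp add: hvar_def mult_single hall_deg_single)
qed

lemma hvar_cong_rclosure:
  assumes "finite E" "X \<subseteq> E"
  shows "hvar (rclosure r E X) - hvar X \<in> null_ideal"
proof (rule null_idealI)
  fix M
  have le: "hall (add_mset X M)" if K: "hall (add_mset (rclosure r E X) M)"
  proof (rule ccontr)
    assume neg: "\<not> hall (add_mset X M)"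
    have M: "hall M" by (rule hall_submset[OF K]) simp
    obtain J where J: "J \<subseteq># M" "r (X \<union> \<Union>(set_mset J)) \<le> Suc (size J)"
      by (rule not_hallE[OF neg M])
    then have "\<not> hall (add_mset (rclosure r E X) M)"
      using rank_union_rclosure[OF assms, of "\<Union>(set_mset J)"]
      by (intro not_hallI[of "add_mset (rclosure r E X) J"]) (auto simp: Un_commute)
    then show False using K by simp
  qed
  have "hall (add_mset X M) \<longleftrightarrow> hall (add_mset (rclosure r E X) M)"
    using le hall_enlarge subset_rclosure[OF assms(2)] by blast
  then show "hall_deg ((hvar (rclosure r E X) - hvar X) * Poly_Mapping.single M 1) = 0"
    by (simp add: hvar_def algebra_simps mult_single hall_deg_diff hall_deg_single)
qed


text \<open>A submultiset containing \<open>T\<close> has union \<open>T\<close>, and even the whole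
  multiset is smaller than \<open>r T\<close>. So a violator avoids \<open>T\<close> and lies in
  \<open>Z\<close>.\<close>

lemma hall_add_replicate:
  assumes "\<And>G. G \<in># Z \<Longrightarrow> G \<subseteq> T" "size Z + s < r T"
  shows "hall (Z + replicate_mset s T) \<longleftrightarrow> hall Z"
proof
  assume Z: "hall Z"
  show "hall (Z + replicate_mset s T)"
    unfolding hall_def
  proof (intro allI impI)
    fix J assume J: "J \<subseteq># Z + replicate_mset s T" "J \<noteq> {#}"
    have sub: "G \<subseteq> T" if "G \<in># J" for G
      using mset_subset_eqD[OF J(1) that] assms(1) by (auto split: if_splits)
    show "size J < r (\<Union>(set_mset J))"
    proof (cases "T \<in># J")
      case True
      then have "\<Union>(set_mset J) = T" using sub by auto
      then show ?thesis using size_mset_mono[OF J(1)] assms(2) by simp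
    next
      case False
      have "J \<subseteq># Z"
        unfolding subseteq_mset_def
      proof
        fix a
        have "count J a \<le> count (Z + replicate_mset s T) a" using J(1) by (rule mset_subset_eq_count)
        then show "count J a \<le> count Z a" using False by (cases "a = T") (auto simp: not_in_iff)
      qed
      then show ?thesis using hallD[OF Z] J(2) by blast
    qed
  qed
qed (rule hall_submset, auto)

text \<open>Multiplying by \<open>h\<^sub>T\<^sup>s (h\<^sub>T - h\<^sub>F)\<close> in the top degree of \<open>T\<close> cuts the degree functional down to \<open>F\<close>.\<close>

lemma hall_deg_truncate:
  assumes T: "\<And>G. G \<in># Z \<Longrightarrow> G \<subseteq> T" "size Z + s + 2 = r T" "T \<subseteq> E"
    and F: "rflat r E F" "F \<subseteq> T" "size Z < r F"
  shows "hall_deg (Poly_Mapping.single (replicate_mset s T) 1 * (hvar T - hvar F) * Poly_Mapping.single Z 1) =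
    of_bool (Suc (size Z) = r F \<and> (\<forall>G\<in>#Z. G \<subseteq> F)) * of_bool (hall Z)"
proof -
  have "Poly_Mapping.single (replicate_mset s T) 1 * (hvar T - hvar F) * Poly_Mapping.single Z 1 =
      Poly_Mapping.single (Z + replicate_mset (Suc s) T) 1 -
      Poly_Mapping.single (add_mset F Z + replicate_mset s T) (1::rat)"
    by (simp add: hvar_def algebra_simps mult_single)
  moreover have "hall (Z + replicate_mset (Suc s) T) \<longleftrightarrow> hall Z"
    using T by (intro hall_add_replicate) auto
  moreover have "hall (add_mset F Z + replicate_mset s T) \<longleftrightarrow> hall (add_mset F Z)"
    using T F by (intro hall_add_replicate) auto
  ultimately have eq: "hall_deg (Poly_Mapping.single (replicate_mset s T) 1 * (hvar T - hvar F) *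
      Poly_Mapping.single Z 1) = of_bool (hall Z) - of_bool (hall (add_mset F Z))"
    by (simp add: hall_deg_diff hall_deg_single)
  have sub: "hall (add_mset F Z) \<Longrightarrow> hall Z" by (rule hall_submset) auto
  have "Suc (size Z) = r F \<and> (\<forall>G\<in>#Z. G \<subseteq> F)" if Z: "hall Z" and neg: "\<not> hall (add_mset F Z)"
  proof -
    obtain J where J: "J \<subseteq># Z" "r (F \<union> \<Union>(set_mset J)) \<le> Suc (size J)"
      by (rule not_hallE[OF neg Z])
    have "size J \<le> size Z" using J(1) by (rule size_mset_mono)
    moreover have "r F \<le> r (F \<union> \<Union>(set_mset J))" by (rule rank_mono) auto
    \<comment> \<open>The chain \<open>size J \<le> size Z < r F \<le> r (F \<union>
      \<Union>(set_mset J)) \<le> Suc (size J)\<close> leaves no room: the violator is all of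
      \<open>Z\<close> and adds no rank to \<open>F\<close>.\<close>
    ultimately have 1: "size J = size Z" "Suc (size Z) = r F" "r (F \<union> \<Union>(set_mset J)) \<le> r F"
      using J(2) F(3) by auto
    then have "J = Z" using J(1) by (metis mset_subset_size order_less_irrefl subset_mset.le_less)
    moreover have "\<Union>(set_mset J) \<subseteq> E"
      using mset_subset_eqD[OF J(1)] T by blast
    ultimately have "\<Union>(set_mset Z) \<subseteq> F" using rflat_rank_union_eq[OF F(1)] 1(3) by blast
    then show ?thesis using 1(2) by auto
  qed
  moreover have "\<not> hall (add_mset F Z)" if "Suc (size Z) = r F" "\<forall>G\<in>#Z. G \<subseteq> F"
  proof -
    have "F \<union> \<Union>(set_mset Z) = F" using that by auto
    then show ?thesis using that(1) by (intro not_hallI[of "add_mset F Z"]) auto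
  qed
  ultimately show ?thesis using eq sub by (auto simp: of_bool_def)
qed

text \<open>For \<open>C\<close> above the size of \<open>M\<close> this is a number in base
  \<open>C\<close> whose digit at place \<open>n\<close> counts the flats of rank \<open>n\<close>.
  Comparing weights compares these counts lexicographically from the top rank down.\<close>

definition rank_weight :: "nat \<Rightarrow> 'a set multiset \<Rightarrow> nat" where
  "rank_weight C M = (\<Sum>F\<in>#M. C ^ r F)"

text \<open>Flats properly inside \<open>T\<close> have smaller rank, and fewer than
  \<open>C\<close> of them cannot carry into the digit of \<open>T\<close>.\<close>

lemma rank_weight_split:
  assumes "\<And>G. G \<in># M \<Longrightarrow> rflat r E G \<and> G \<subseteq> T" "rflat r E T" "size M < C" "0 < r T"
  defines "M' \<equiv> filter_mset (\<lambda>G. G \<noteq> T) M"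
  shows "M = replicate_mset (count M T) T + M'"
    and "rank_weight C M = count M T * C ^ r T + rank_weight C M'"
    and "rank_weight C M' < C ^ r T"
proof -
  show eq: "M = replicate_mset (count M T) T + M'"
    by (rule multiset_eqI) (auto simp: M'_def)
  have "rank_weight C M = rank_weight C (replicate_mset (count M T) T + M')" using eq by simp
  then show "rank_weight C M = count M T * C ^ r T + rank_weight C M'"
    by (simp add: rank_weight_def)
  have le: "C ^ r G \<le> C ^ (r T - 1)" if "G \<in># M'" for G
  proof -
    have "G \<subset> T" "rflat r E G" "T \<subseteq> E" using that assms by (auto simp: M'_def rflat_def)
    then have "r G < r T" using rflat_rank_less by blast
    then show ?thesis using assms(3) by (intro power_increasing) auto
  qed
  have "rank_weight C M' \<le> (\<Sum>G\<in>#M'. C ^ (r T - 1))"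
    unfolding rank_weight_def by (rule sum_mset_mono) (rule le)
  also have "\<dots> = size M' * C ^ (r T - 1)" by simp
  also have "\<dots> < C * C ^ (r T - 1)"
  proof -
    have "size M' \<le> size M" unfolding M'_def by (rule size_filter_mset_lesseq)
    then show ?thesis using assms(3) by simp
  qed
  also have "\<dots> = C ^ r T" using assms(4) by (cases "r T") auto
  finally show "rank_weight C M' < C ^ r T" .
qed

lemma hall_deg_mult_const:
  assumes "\<And>N. N \<in> Poly_Mapping.keys y \<Longrightarrow>
     hall_deg (z * Poly_Mapping.single N 1) = c * of_bool (hall N)"
  shows "hall_deg (z * y) = c * hall_deg y"
  unfolding hall_deg_mult_expand[of z y] hall_deg_def[of y] sum_distrib_left
  using assms by (intro sum.cong) auto

text \<open>The dual of \<open>T\<^sup>a F\<^sup>b \<dots>\<close> (top flat first) is \<open>h\<^sub>T\<^sup>s (h\<^sub>T - h\<^sub>F)\<close> with \<open>s = r T - r F - a - 1\<close>, times the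
  dual of \<open>F\<^sup>b \<dots>\<close> inside \<open>F\<close>.\<close>

lemma nested_dual_exists:
  assumes "finite E" "rflat r E T" "0 < r T" "M \<in> nested r E {}" "\<And>F. F \<in># M \<Longrightarrow> F \<subseteq> T"
    "size M < C"
  shows "\<exists>y. (\<forall>N\<in>Poly_Mapping.keys y. size N + size M + 1 = r T \<and> (\<forall>G\<in>#N. G \<subseteq> T)) \<and>
    hall_deg (Poly_Mapping.single M 1 * y) = 1 \<and>
    (\<forall>M'. size M' = size M \<longrightarrow> (\<forall>F\<in>#M'. rflat r E F \<and> F \<subseteq> T) \<longrightarrow>
       rank_weight C M \<le> rank_weight C M' \<longrightarrow> hall_deg (Poly_Mapping.single M' 1 * y) \<noteq> 0 \<longrightarrow> M' = M)"
  using assms(2-)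
proof (induction "r T" arbitrary: T M rule: less_induct)
  case less
  note T = less.prems(1,2) and M = less.prems(3-5)
  define a where "a = count M T"
  define M1 where "M1 = filter_mset (\<lambda>G. G \<noteq> T) M"
  have flM: "rflat r E G \<and> G \<subseteq> T" if "G \<in># M" for G
    using M that by (auto simp: nested_def flats_above_def)
  note splitM = rank_weight_split[OF flM T(1) M(3) T(2), folded M1_def a_def]
  have TE: "T \<subseteq> E" using T by (simp add: rflat_def)
  \<comment> \<open>A weight at least that of \<open>M\<close> forces the leading digit to be at
    least \<open>a\<close>.\<close>
  have count_le: "a \<le> count M' T" if "size M' = size M" "\<forall>F\<in>#M'. rflat r E F \<and> F \<subseteq> T"
    "rank_weight C M \<le> rank_weight C M'" for M'
  proof -
    have M': "\<And>G. G \<in># M' \<Longrightarrow> rflat r E G \<and> G \<subseteq> T" "size M' < C" using that M(3) by auto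
    note s = rank_weight_split[OF M'(1) T(1) M'(2) T(2)]
    have "a * C ^ r T < (count M' T + 1) * C ^ r T"
      using that(3) s(2,3) splitM(2) by simp
    then have "a < count M' T + 1" by (metis mult_less_cancel2)
    then show ?thesis by simp
  qed
  show ?case
  proof (cases "M1 = {#}")
    case True
    then have Ma: "M = replicate_mset a T" "size M = a" using splitM(1) by simp_all
    have aT: "a < r T"
    proof (cases "a = 0")
      case False
      then have "T \<in># M" unfolding a_def by (metis not_in_iff)
      then show ?thesis using M(1) by (auto simp: nested_def a_def)
    qed (use T in simp)
    have hall: "hall (replicate_mset (r T - 1) T)"
      using hall_add_replicate[of "{#}" T "r T - 1"] T(2) by (simp add: hall_def)
    have sum: "replicate_mset a T + replicate_mset (r T - a - 1) T = replicate_mset (r T - 1) T"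
      using aT by (intro multiset_eqI) auto
    \<comment> \<open>The complementary power of \<open>T\<close> brings the product to size
      \<open>r T - 1\<close>, the largest that the Hall condition admits.\<close>
    let ?y = "Poly_Mapping.single (replicate_mset (r T - a - 1) T) (1::rat)"
    show ?thesis
    proof (rule exI[of _ ?y], intro conjI ballI allI impI)
      fix N assume "N \<in> Poly_Mapping.keys ?y"
      then have N: "N = replicate_mset (r T - a - 1) T" by simp
      show "size N + size M + 1 = r T" using N Ma aT by simp
      fix G assume "G \<in># N"
      then show "G \<subseteq> T" using N by (auto split: if_splits)
    next
      show "hall_deg (Poly_Mapping.single M 1 * ?y) = 1"
        unfolding Ma(1) mult_single sum using hall by (simp add: hall_deg_single)
    next
      fix M' assume M': "size M' = size M" "\<forall>F\<in>#M'. rflat r E F \<and> F \<subseteq> T"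
        "rank_weight C M \<le> rank_weight C M'"
      then have "size M' \<le> count M' T" using count_le Ma by auto
      moreover have eq: "M' = replicate_mset (count M' T) T + filter_mset (\<lambda>G. G \<noteq> T) M'"
        by (rule multiset_eqI) auto
      moreover have "size M' = count M' T + size (filter_mset (\<lambda>G. G \<noteq> T) M')"
        using arg_cong[OF eq, of size] by simp
      ultimately have "filter_mset (\<lambda>G. G \<noteq> T) M' = {#}" "count M' T = size M'" by auto
      then show "M' = M" using eq M'(1) Ma by (metis add.right_neutral)
    qed
  next
    case False
    have M1: "M1 \<subseteq># M" unfolding M1_def by simp
    have cnt: "count M1 G = count M G" if "G \<in># M1" for G using that by (auto simp: M1_def)
    have "\<exists>F\<in>set_mset M1. \<forall>G\<in>set_mset M1. F \<subseteq> G \<longrightarrow> F = G"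
      using False by (intro finite_has_maximal) auto
    then obtain F where F: "F \<in># M1" and max: "\<And>G. G \<in># M1 \<Longrightarrow> F \<subseteq> G \<Longrightarrow> F = G" by auto
    have FM: "F \<in># M" "F \<noteq> T" using F by (auto simp: M1_def)
    have greatest: "G \<subseteq> F" if "G \<in># M1" for G
    proof -
      have "G \<in># M" using that by (simp add: M1_def)
      then have "F \<subseteq> G \<or> G \<subseteq> F" using M(1) FM(1) by (auto simp: nested_def)
      then show ?thesis using max[OF that] by auto
    qed
    have FT: "F \<subset> T" "rflat r E F" using flM FM by auto
    have rFT: "r F < r T" using rflat_rank_less FT TE by blast
    have rF: "0 < r F" using M(1) FM(1) by (fastforce simp: nested_def)
    have aF: "r F + a < r T"
    proof (cases "a = 0")
      case False
      then have "T \<in># M" unfolding a_def by (metis not_in_iff)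
      then show ?thesis using M(1) FM(1) FT(1) by (auto simp: nested_def a_def)
    qed (use rFT in simp)
    have nestM1: "M1 \<in> nested r E {}"
      using M(1) cnt mset_subset_eqD[OF M1] by (auto simp: nested_def)
    have sizeM1: "size M1 < C" using M(3) size_mset_mono[OF M1] by simp
    obtain y' where y': "\<forall>N\<in>Poly_Mapping.keys y'. size N + size M1 + 1 = r F \<and> (\<forall>G\<in>#N. G \<subseteq> F)"
      "hall_deg (Poly_Mapping.single M1 1 * y') = 1"
      "\<And>M'. size M' = size M1 \<Longrightarrow> (\<forall>G\<in>#M'. rflat r E G \<and> G \<subseteq> F) \<Longrightarrow>
         rank_weight C M1 \<le> rank_weight C M' \<Longrightarrow> hall_deg (Poly_Mapping.single M' 1 * y') \<noteq> 0 \<Longrightarrow> M' = M1"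
      using less.hyps[OF rFT FT(2) rF nestM1 greatest sizeM1] by blast
    let ?s = "r T - r F - a - 1"
    define y where "y = Poly_Mapping.single (replicate_mset ?s T) 1 * (hvar T - hvar F) * y'"
    \<comment> \<open>The truncating factor detects whether the exponent of \<open>T\<close> equals
      \<open>a\<close> and the rest lies inside \<open>F\<close>; what survives is the pairing with
      the dual element \<open>y'\<close> inside \<open>F\<close>.\<close>
    have eval: "hall_deg (Poly_Mapping.single M' 1 * y) =
        of_bool (count M' T = a \<and> (\<forall>G\<in>#filter_mset (\<lambda>G. G \<noteq> T) M'. G \<subseteq> F)) *
        hall_deg (Poly_Mapping.single (filter_mset (\<lambda>G. G \<noteq> T) M') 1 * y')"
      if M': "size M' = size M" "\<forall>F\<in>#M'. rflat r E F \<and> F \<subseteq> T" "a \<le> count M' T" for M'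
    proof -
      define b where "b = count M' T"
      define M2 where "M2 = filter_mset (\<lambda>G. G \<noteq> T) M'"
      have eq: "M' = replicate_mset b T + M2"
        by (rule multiset_eqI) (auto simp: M2_def b_def)
      have size: "b + size M2 = a + size M1"
        using M'(1) arg_cong[OF eq, of size] arg_cong[OF splitM(1), of size] by simp
      have prod: "Poly_Mapping.single M' 1 * y =
          (Poly_Mapping.single (replicate_mset (b + ?s) T) 1 * (hvar T - hvar F)) *
          (Poly_Mapping.single M2 1 * y')"
      proof -
        have "Poly_Mapping.single M' (1::rat) =
            Poly_Mapping.single (replicate_mset b T) 1 * Poly_Mapping.single M2 1"
          by (subst eq) (simp add: mult_single)
        moreover have "Poly_Mapping.single (replicate_mset (b + ?s) T) (1::rat) =
            Poly_Mapping.single (replicate_mset b T) 1 * Poly_Mapping.single (replicate_mset ?s T) 1"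
          unfolding mult_single by (intro arg_cong2[of _ _ _ _ Poly_Mapping.single] multiset_eqI) auto
        ultimately show ?thesis unfolding y_def by (simp only: mult_ac)
      qed
      have "hall_deg (Poly_Mapping.single (replicate_mset (b + ?s) T) 1 * (hvar T - hvar F) *
            Poly_Mapping.single N 1) =
          of_bool (b = a \<and> (\<forall>G\<in>#M2. G \<subseteq> F)) * of_bool (hall N)"
        if "N \<in> Poly_Mapping.keys (Poly_Mapping.single M2 1 * y')" for N
      proof -
        have "\<exists>N1 N2. N = N1 + N2 \<and> N1 \<in> Poly_Mapping.keys (Poly_Mapping.single M2 (1::rat)) \<and>
            N2 \<in> Poly_Mapping.keys y'"
          using that keys_mult[of "Poly_Mapping.single M2 1" y'] by blast
        then obtain N' where N': "N = M2 + N'" "N' \<in> Poly_Mapping.keys y'" by auto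
        have N'2: "size N' + size M1 + 1 = r F" "\<forall>G\<in>#N'. G \<subseteq> F" using y'(1) N' by auto
        have sub: "\<forall>G\<in>#M2. G \<subseteq> T" using M'(2) by (auto simp: M2_def)
        have "hall_deg (Poly_Mapping.single (replicate_mset (b + ?s) T) 1 * (hvar T - hvar F) *
            Poly_Mapping.single N 1) =
            of_bool (Suc (size N) = r F \<and> (\<forall>G\<in>#N. G \<subseteq> F)) * of_bool (hall N)"
        proof (rule hall_deg_truncate[OF _ _ TE FT(2)])
          show "F \<subseteq> T" using FT by auto
          show "size N + (b + ?s) + 2 = r T" using N'(1) N'2(1) size aF by simp
          \<comment> \<open>Here \<open>size N = r F - 1 + a - b\<close>, so the truncation applies
            because \<open>a \<le> b\<close>, and the case \<open>b = a\<close> is exactly the top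
            degree of \<open>F\<close>.\<close>
          show "size N < r F" using N'(1) N'2(1) size M'(3) by (simp add: b_def)
          show "G \<subseteq> T" if "G \<in># N" for G using that N' N'2 sub FT by auto
        qed
        moreover have "Suc (size N) = r F \<and> (\<forall>G\<in>#N. G \<subseteq> F) \<longleftrightarrow> b = a \<and> (\<forall>G\<in>#M2. G \<subseteq> F)"
          using N' N'2 size by auto
        ultimately show ?thesis by simp
      qed
      then show ?thesis unfolding prod b_def[symmetric] M2_def[symmetric]
        by (rule hall_deg_mult_const)
    qed
    show ?thesis
    proof (rule exI[of _ y], intro conjI ballI allI impI)
      fix N assume "N \<in> Poly_Mapping.keys y"
      then obtain N1 N2 where N: "N = N1 + N2"
        "N1 \<in> Poly_Mapping.keys (Poly_Mapping.single (replicate_mset ?s T) 1 * (hvar T - hvar F))"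
        "N2 \<in> Poly_Mapping.keys y'"
        using keys_mult[of "Poly_Mapping.single (replicate_mset ?s T) 1 * (hvar T - hvar F)" y']
        unfolding y_def by blast
      have "Poly_Mapping.single (replicate_mset ?s T) 1 * (hvar T - hvar F) =
          Poly_Mapping.single (add_mset T (replicate_mset ?s T)) 1 -
          Poly_Mapping.single (add_mset F (replicate_mset ?s T)) (1::rat)"
        by (simp add: hvar_def algebra_simps mult_single)
      then have "N1 \<in> {add_mset T (replicate_mset ?s T), add_mset F (replicate_mset ?s T)}"
        using N(2) keys_diff[of "Poly_Mapping.single (add_mset T (replicate_mset ?s T)) (1::rat)"
            "Poly_Mapping.single (add_mset F (replicate_mset ?s T)) 1"] by auto
      then have N1: "size N1 = Suc ?s" "\<forall>G\<in>#N1. G \<subseteq> T" using FT by (auto split: if_splits)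
      have N2: "size N2 + size M1 + 1 = r F" "\<forall>G\<in>#N2. G \<subseteq> F" using y'(1) N(3) by auto
      show "size N + size M + 1 = r T"
        using N(1) N1 N2 aF arg_cong[OF splitM(1), of size] by simp
      show "G \<subseteq> T" if "G \<in># N" for G using that N(1) N1 N2 FT by auto
    next
      show "hall_deg (Poly_Mapping.single M 1 * y) = 1"
        using eval[of M] flM greatest y'(2) by (simp add: a_def[symmetric] M1_def[symmetric])
    next
      fix M' assume M': "size M' = size M" "\<forall>F\<in>#M'. rflat r E F \<and> F \<subseteq> T"
        "rank_weight C M \<le> rank_weight C M'" "hall_deg (Poly_Mapping.single M' 1 * y) \<noteq> 0"
      define M2 where "M2 = filter_mset (\<lambda>G. G \<noteq> T) M'"
      have 1: "count M' T = a" "\<forall>G\<in>#M2. G \<subseteq> F" "hall_deg (Poly_Mapping.single M2 1 * y') \<noteq> 0"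
        using eval[OF M'(1,2) count_le[OF M'(1-3)]] M'(4) unfolding M2_def
        by (auto simp: of_bool_def split: if_splits)
      have M'': "\<And>G. G \<in># M' \<Longrightarrow> rflat r E G \<and> G \<subseteq> T" "size M' < C" using M' M(3) by auto
      note s = rank_weight_split[OF M''(1) T(1) M''(2) T(2), folded M2_def, unfolded 1(1)]
      have "M2 = M1"
      proof (rule y'(3))
        show "size M2 = size M1"
          using M'(1) arg_cong[OF s(1), of size] arg_cong[OF splitM(1), of size] by simp
        show "\<forall>G\<in>#M2. rflat r E G \<and> G \<subseteq> F" using 1(2) M'(2) by (auto simp: M2_def)
        show "rank_weight C M1 \<le> rank_weight C M2" using M'(3) s(2) splitM(2) by simp
      qed (rule 1)
      then show "M' = M" using s(1) splitM(1) by simp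
    qed
  qed
qed

lemma nested_independent:
  assumes "finite E" "0 < r E" "(\<Sum>M\<in>{M \<in> nested r E {}. size M = k}. Poly_Mapping.single M (c M)) \<in> null_ideal"
    and "M \<in> nested r E {}" "size M = k"
  shows "c M = 0"
proof (rule ccontr)
  let ?B = "{M \<in> nested r E {}. size M = k}"
  assume "c M \<noteq> 0"
  define B where "B = {M \<in> ?B. c M \<noteq> 0}"
  have fin: "finite B" "finite ?B" using finite_nested[OF assms(1)] by (auto simp: B_def)
  have "B \<noteq> {}" using assms \<open>c M \<noteq> 0\<close> by (auto simp: B_def)
  \<comment> \<open>All other monomials of the support weigh at least as much as \<open>M0\<close>,
    and these are the ones that the dual element of \<open>M0\<close> annihilates.
    \<open>Suc k\<close> exceeds every size involved, as the weight requires.\<close>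
  define M0 where "M0 = arg_min_on (rank_weight (Suc k)) B"
  have M0: "M0 \<in> B" and min: "\<And>N. N \<in> B \<Longrightarrow> rank_weight (Suc k) M0 \<le> rank_weight (Suc k) N"
    using arg_min_if_finite[OF fin(1) \<open>B \<noteq> {}\<close>, of "rank_weight (Suc k)"] arg_min_least[OF fin(1) \<open>B \<noteq> {}\<close>]
    unfolding M0_def by auto
  have M0': "M0 \<in> nested r E {}" "size M0 = k" "c M0 \<noteq> 0" using M0 by (auto simp: B_def)
  have sub: "rflat r E F \<and> F \<subseteq> E" if "N \<in> nested r E {}" "F \<in># N" for N F
    using that by (auto simp: nested_def flats_above_def rflat_def)
  have "size M0 < Suc k" using M0' by simp
  then obtain y where y: "hall_deg (Poly_Mapping.single M0 1 * y) = 1"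
    "\<And>M'. size M' = size M0 \<Longrightarrow> (\<forall>F\<in>#M'. rflat r E F \<and> F \<subseteq> E) \<Longrightarrow>
       rank_weight (Suc k) M0 \<le> rank_weight (Suc k) M' \<Longrightarrow>
       hall_deg (Poly_Mapping.single M' 1 * y) \<noteq> 0 \<Longrightarrow> M' = M0"
    using nested_dual_exists[OF assms(1) rflat_self assms(2) M0'(1), of "Suc k"] sub[OF M0'(1)] by blast
  have scale: "hall_deg (Poly_Mapping.single N c * y) = c * hall_deg (Poly_Mapping.single N 1 * y)" for N c
    using hall_deg_single_scale[of y N c] by (simp add: mult.commute)
  have "0 = hall_deg ((\<Sum>M\<in>?B. Poly_Mapping.single M (c M)) * y)"
    using assms(3) by (simp add: null_ideal_def)
  also have "\<dots> = (\<Sum>N\<in>?B. c N * hall_deg (Poly_Mapping.single N 1 * y))"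
    by (simp add: sum_distrib_right hall_deg_sum scale[of _ "c _"])
  also have "\<dots> = (\<Sum>N\<in>?B. if N = M0 then c M0 else 0)"
  proof (rule sum.cong)
    fix N assume N: "N \<in> ?B"
    show "c N * hall_deg (Poly_Mapping.single N 1 * y) = (if N = M0 then c M0 else 0)"
    proof (cases "N = M0")
      case False
      have "c N = 0 \<or> hall_deg (Poly_Mapping.single N 1 * y) = 0"
      proof (rule ccontr)
        assume "\<not> ?thesis"
        then have "N \<in> B" "hall_deg (Poly_Mapping.single N 1 * y) \<noteq> 0" using N by (auto simp: B_def)
        then have "N = M0" using y(2)[of N] min[of N] N M0'(2) sub[of N] by auto
        then show False using False by simp
      qed
      then show ?thesis using False by auto
    qed (use y in simp)
  qed simp
  also have "\<dots> = c M0" using fin M0 by (simp add: B_def)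
  finally show False using M0' by simp
qed

end

section \<open>Polynomials over the rationals\<close>

interpretation qpoly: vector_space "qscale :: rat \<Rightarrow> 'v qpoly \<Rightarrow> 'v qpoly"
proof
  show "qscale a (qscale b x) = qscale (a * b) x" for a b and x :: "'v qpoly"
    by (simp add: qscale_def mult.assoc[symmetric] mult_single)
qed (simp_all add: qscale_def algebra_simps single_add)

lemma qscale_mult_left: "qscale c (p * q) = qscale c p * q"
  by (simp add: qscale_def mult.assoc)

lemma qscale_mult_right: "qscale c (p * q) = p * qscale c q"
  by (simp add: qscale_def mult.left_commute)

lemma qpoly_span_mult:
  assumes "p \<in> qpoly.span A" "q \<in> qpoly.span B" "\<And>a b. a \<in> A \<Longrightarrow> b \<in> B \<Longrightarrow> a * b \<in> qpoly.span C"
  shows "p * q \<in> qpoly.span C"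
  using assms(1)
proof (induction rule: qpoly.span_induct_alt)
  case base
  then show ?case by (simp add: qpoly.span_zero)
next
  case (step c x y)
  have "x * q \<in> qpoly.span C"
    using assms(2)
  proof (induction rule: qpoly.span_induct_alt)
    case base
    then show ?case by (simp add: qpoly.span_zero)
  next
    case (step d z w)
    then show ?case
      using assms(3)[OF \<open>x \<in> A\<close>]
      by (simp add: distrib_left qscale_mult_right[symmetric] qpoly.span_add qpoly.span_scale)
  qed
  then show ?case
    using step by (simp add: distrib_right qscale_mult_left[symmetric] qpoly.span_add qpoly.span_scale)
qed

text \<open>The family \<open>b\<close> is a basis of \<open>W\<close> modulo \<open>U\<close>, so a
  basis of \<open>U\<close> extended by it is a basis of \<open>W\<close>. The finite set
  \<open>S\<close> bounds the dimension, which makes the subtraction of dimensions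
  meaningful.\<close>

lemma (in vector_space) dim_minus_dim_eq_card:
  assumes "subspace U" "U \<subseteq> W" "W \<subseteq> span S" "finite S" "finite I" "b ` I \<subseteq> W"
    and W: "W \<subseteq> span (U \<union> b ` I)"
    and indep: "\<And>c. (\<Sum>i\<in>I. scale (c i) (b i)) \<in> U \<Longrightarrow> \<forall>i\<in>I. c i = 0"
  shows "dim W - dim U = card I"
proof -
  obtain C where C: "C \<subseteq> U" "independent C" "U \<subseteq> span C" "card C = dim U"
    using basis_exists[of U] by blast
  have finC: "finite C"
    using independent_span_bound[OF assms(4) C(2)] C(1) assms(2,3) by blast
  have inj: "inj_on b I"
  proof (rule inj_onI, rule ccontr)
    fix i j assume ij: "i \<in> I" "j \<in> I" "b i = b j" "i \<noteq> j"
    let ?c = "\<lambda>l. if l = i then 1 else if l = j then - 1 else (0::'a)"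
    have "(\<Sum>l\<in>I. scale (?c l) (b l)) = (\<Sum>l\<in>{i, j}. scale (?c l) (b l))"
      using ij assms(5) by (intro sum.mono_neutral_right) auto
    also have "\<dots> = 0" using ij by simp
    finally show False using indep[of ?c] ij subspace_0[OF assms(1)] by auto
  qed
  have disj: "C \<inter> b ` I = {}"
  proof (rule ccontr)
    assume "C \<inter> b ` I \<noteq> {}"
    then obtain i where i: "i \<in> I" "b i \<in> U" using C(1) by auto
    let ?c = "\<lambda>l. if l = i then 1 else (0::'a)"
    have "(\<Sum>l\<in>I. scale (?c l) (b l)) = (\<Sum>l\<in>{i}. scale (?c l) (b l))"
      using i assms(5) by (intro sum.mono_neutral_right) auto
    then show False using indep[of ?c] i by auto
  qed
  have "independent (C \<union> b ` I)"
  proof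
    assume "dependent (C \<union> b ` I)"
    then obtain u v where u: "v \<in> C \<union> b ` I" "u v \<noteq> 0" "(\<Sum>v\<in>C \<union> b ` I. scale (u v) v) = 0"
      using dependent_finite[of "C \<union> b ` I"] finC assms(5) by auto
    have sum: "(\<Sum>v\<in>C. scale (u v) v) + (\<Sum>i\<in>I. scale (u (b i)) (b i)) = 0"
      using u(3) disj finC assms(5) by (simp add: sum.union_disjoint sum.reindex[OF inj])
    have "(\<Sum>v\<in>C. scale (u v) v) \<in> U"
      using C(1) by (intro subspace_sum subspace_scale assms(1)) auto
    then have "- (\<Sum>v\<in>C. scale (u v) v) \<in> U" using subspace_neg[OF assms(1)] by blast
    moreover have "(\<Sum>i\<in>I. scale (u (b i)) (b i)) = - (\<Sum>v\<in>C. scale (u v) v)"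
      using sum by (simp add: eq_neg_iff_add_eq_0 add.commute)
    ultimately have I0: "\<forall>i\<in>I. u (b i) = 0" using indep[of "\<lambda>i. u (b i)"] by simp
    then have "(\<Sum>v\<in>C. scale (u v) v) = 0" using sum by simp
    then have "\<forall>v\<in>C. u v = 0" using C(2) dependent_finite[OF finC] by auto
    then show False using u(1,2) I0 by auto
  qed
  moreover have "W \<subseteq> span (C \<union> b ` I)"
  proof -
    have "U \<union> b ` I \<subseteq> span (C \<union> b ` I)"
      using C(3) span_mono[of C "C \<union> b ` I"] span_superset[of "C \<union> b ` I"] by blast
    then have "span (U \<union> b ` I) \<subseteq> span (C \<union> b ` I)" by (rule span_minimal) (rule subspace_span)
    then show ?thesis using W by blast
  qed
  moreover have "C \<union> b ` I \<subseteq> W" using C(1) assms(2,6) by auto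
  ultimately have "dim W = card (C \<union> b ` I)" by (intro dim_unique) auto
  also have "\<dots> = dim U + card I"
    using disj finC assms(5) C(4) by (simp add: card_Un_disjoint card_image[OF inj])
  finally show ?thesis by simp
qed

section \<open>Polynomials in given variables, homogeneity and generated ideals\<close>

lemma in_polyring_0: "in_polyring V 0"
  by (simp add: in_polyring_def)

lemma in_polyring_single: "Poly_Mapping.keys m \<subseteq> V \<Longrightarrow> in_polyring V (Poly_Mapping.single m c)"
  by (simp add: in_polyring_def)

lemma in_polyring_1: "in_polyring V 1"
  using in_polyring_single[of 0 V 1] by simp

lemma in_polyring_pvar: "v \<in> V \<Longrightarrow> in_polyring V (pvar v)"
  unfolding pvar_def by (rule in_polyring_single) simp

lemma in_polyring_add: "in_polyring V p \<Longrightarrow> in_polyring V q \<Longrightarrow> in_polyring V (p + q)"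
  unfolding in_polyring_def using keys_add[of p q] by blast

lemma in_polyring_uminus: "in_polyring V p \<Longrightarrow> in_polyring V (- p)"
  by (simp add: in_polyring_def)

lemma in_polyring_diff: "in_polyring V p \<Longrightarrow> in_polyring V q \<Longrightarrow> in_polyring V (p - q)"
  unfolding in_polyring_def using keys_diff[of p q] by blast

lemma in_polyring_mult:
  assumes "in_polyring V p" "in_polyring V q"
  shows "in_polyring V (p * q)"
  unfolding in_polyring_def
proof (intro allI impI)
  fix m assume "m \<in> Poly_Mapping.keys (p * q)"
  then obtain a b where "m = a + b" "a \<in> Poly_Mapping.keys p" "b \<in> Poly_Mapping.keys q"
    using keys_mult[of p q] by blast
  then show "Poly_Mapping.keys m \<subseteq> V"
    using assms keys_add[of a b] unfolding in_polyring_def by blast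
qed

lemma in_polyring_sum: "(\<And>i. i \<in> I \<Longrightarrow> in_polyring V (p i)) \<Longrightarrow> in_polyring V (\<Sum>i\<in>I. p i)"
  by (induction I rule: infinite_finite_induct) (auto simp: in_polyring_0 in_polyring_add)

lemma in_polyring_power: "in_polyring V p \<Longrightarrow> in_polyring V (p ^ n)"
  by (induction n) (auto simp: in_polyring_1 in_polyring_mult)

lemma in_polyring_prod_mset:
  "(\<And>x. x \<in># M \<Longrightarrow> in_polyring V (g x)) \<Longrightarrow> in_polyring V (\<Prod>x\<in>#M. g x)"
  by (induction M) (auto simp: in_polyring_1 in_polyring_mult)

definition mdegree :: "('v \<Rightarrow>\<^sub>0 nat) \<Rightarrow> nat" where
  "mdegree m = (\<Sum>v\<in>Poly_Mapping.keys m. Poly_Mapping.lookup m v)"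

lemma mdegree_add: "mdegree (a + b) = mdegree a + mdegree b"
  unfolding mdegree_def by (rule setsum_keys_plus_distrib) auto

lemma homogeneous_iff: "homogeneous k p \<longleftrightarrow> (\<forall>m\<in>Poly_Mapping.keys p. mdegree m = k)"
  by (simp add: homogeneous_def mdegree_def)

lemma homogeneous_0: "homogeneous k 0"
  by (simp add: homogeneous_def)

lemma homogeneous_add: "homogeneous k p \<Longrightarrow> homogeneous k q \<Longrightarrow> homogeneous k (p + q)"
  unfolding homogeneous_iff using keys_add[of p q] by blast

lemma homogeneous_diff: "homogeneous k p \<Longrightarrow> homogeneous k q \<Longrightarrow> homogeneous k (p - q)"
  unfolding homogeneous_iff using keys_diff[of p q] by blast

lemma homogeneous_sum: "(\<And>i. i \<in> I \<Longrightarrow> homogeneous k (p i)) \<Longrightarrow> homogeneous k (\<Sum>i\<in>I. p i)"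
  by (induction I rule: infinite_finite_induct) (auto simp: homogeneous_0 homogeneous_add)

lemma homogeneous_mult:
  assumes "homogeneous k p" "homogeneous l q"
  shows "homogeneous (k + l) (p * q)"
  unfolding homogeneous_iff
proof
  fix m assume "m \<in> Poly_Mapping.keys (p * q)"
  then obtain a b where "m = a + b" "a \<in> Poly_Mapping.keys p" "b \<in> Poly_Mapping.keys q"
    using keys_mult[of p q] by blast
  then show "mdegree m = k + l" using assms by (auto simp: homogeneous_iff mdegree_add)
qed

lemma homogeneous_const: "homogeneous 0 (Poly_Mapping.single 0 c)"
  by (simp add: homogeneous_def)

lemma homogeneous_1: "homogeneous 0 1"
  using homogeneous_const[of 1] by simp

lemma homogeneous_pvar: "homogeneous 1 (pvar v)"
  by (simp add: homogeneous_def pvar_def)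

lemma homogeneous_prod_mset:
  "(\<And>x. x \<in># M \<Longrightarrow> homogeneous 1 (g x)) \<Longrightarrow> homogeneous (size M) (\<Prod>x\<in>#M. g x)"
proof (induction M)
  case (add x M)
  then show ?case using homogeneous_mult[of 1 "g x" "size M"] by simp
qed (simp add: homogeneous_1)

lemma gen_ideal_base: "g \<in> G \<Longrightarrow> g \<in> gen_ideal V G"
  unfolding gen_ideal_def
  by (rule CollectI, rule exI[of _ "{g}"], rule exI[of _ "\<lambda>_. 1"]) (simp add: in_polyring_1)

lemma gen_ideal_0: "0 \<in> gen_ideal V G"
  unfolding gen_ideal_def by (rule CollectI, rule exI[of _ "{}"]) simp

lemma gen_ideal_add:
  assumes "p \<in> gen_ideal V G" "q \<in> gen_ideal V G"
  shows "p + q \<in> gen_ideal V G"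
proof -
  obtain S c where p: "p = (\<Sum>g\<in>S. c g * g)" "finite S" "S \<subseteq> G" "\<forall>g\<in>S. in_polyring V (c g)"
    using assms(1) by (auto simp: gen_ideal_def)
  obtain T d where q: "q = (\<Sum>g\<in>T. d g * g)" "finite T" "T \<subseteq> G" "\<forall>g\<in>T. in_polyring V (d g)"
    using assms(2) by (auto simp: gen_ideal_def)
  let ?e = "\<lambda>g. (if g \<in> S then c g else 0) + (if g \<in> T then d g else 0)"
  have "p = (\<Sum>g\<in>S \<union> T. (if g \<in> S then c g else 0) * g)"
    unfolding p(1) using p(2) q(2) by (intro sum.mono_neutral_cong_left) auto
  moreover have "q = (\<Sum>g\<in>S \<union> T. (if g \<in> T then d g else 0) * g)"
    unfolding q(1) using p(2) q(2) by (intro sum.mono_neutral_cong_left) auto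
  ultimately have "p + q = (\<Sum>g\<in>S \<union> T. ?e g * g)" by (simp only: sum.distrib distrib_right)
  moreover have "\<forall>g\<in>S \<union> T. in_polyring V (?e g)"
    using p q by (auto intro: in_polyring_add simp: in_polyring_0)
  ultimately show ?thesis
    unfolding gen_ideal_def using p q by (intro CollectI exI[of _ "S \<union> T"] exI[of _ ?e]) auto
qed

lemma gen_ideal_mult:
  assumes "p \<in> gen_ideal V G" "in_polyring V q"
  shows "q * p \<in> gen_ideal V G"
proof -
  obtain S c where p: "p = (\<Sum>g\<in>S. c g * g)" "finite S" "S \<subseteq> G" "\<forall>g\<in>S. in_polyring V (c g)"
    using assms(1) by (auto simp: gen_ideal_def)
  have "q * p = (\<Sum>g\<in>S. (q * c g) * g)" unfolding p(1) by (simp add: sum_distrib_left mult.assoc)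
  then show ?thesis
    unfolding gen_ideal_def using p assms(2)
    by (intro CollectI exI[of _ S] exI[of _ "\<lambda>g. q * c g"]) (auto intro: in_polyring_mult)
qed

lemma gen_ideal_mult_right:
  "p \<in> gen_ideal V G \<Longrightarrow> in_polyring V q \<Longrightarrow> p * q \<in> gen_ideal V G"
  by (subst mult.commute) (rule gen_ideal_mult)

lemma gen_ideal_uminus: "p \<in> gen_ideal V G \<Longrightarrow> - p \<in> gen_ideal V G"
  using gen_ideal_mult[of p V G "- 1"] by (simp add: in_polyring_uminus in_polyring_1)

lemma gen_ideal_diff: "p \<in> gen_ideal V G \<Longrightarrow> q \<in> gen_ideal V G \<Longrightarrow> p - q \<in> gen_ideal V G"
  using gen_ideal_add[of p V G "- q"] gen_ideal_uminus[of q] by simp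

lemma gen_ideal_sum: "(\<And>i. i \<in> I \<Longrightarrow> p i \<in> gen_ideal V G) \<Longrightarrow> (\<Sum>i\<in>I. p i) \<in> gen_ideal V G"
  by (induction I rule: infinite_finite_induct) (auto simp: gen_ideal_0 gen_ideal_add)

lemma subspace_gen_ideal: "qpoly.subspace (gen_ideal V G)"
  unfolding qpoly.subspace_def qscale_def
  by (auto simp: gen_ideal_0 gen_ideal_add intro!: gen_ideal_mult in_polyring_single)

section \<open>Substitution homomorphisms\<close>

definition mono_subst :: "('v \<Rightarrow> 'a mring) \<Rightarrow> ('v \<Rightarrow>\<^sub>0 nat) \<Rightarrow> 'a mring" where
  "mono_subst X m = (\<Prod>v\<in>Poly_Mapping.keys m. X v ^ Poly_Mapping.lookup m v)"

definition poly_subst :: "('v \<Rightarrow> 'a mring) \<Rightarrow> 'v qpoly \<Rightarrow> 'a mring" where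
  "poly_subst X p = (\<Sum>m\<in>Poly_Mapping.keys p.
     Poly_Mapping.single 0 (Poly_Mapping.lookup p m) * mono_subst X m)"

lemma mono_subst_superset:
  assumes "finite K" "Poly_Mapping.keys m \<subseteq> K"
  shows "mono_subst X m = (\<Prod>v\<in>K. X v ^ Poly_Mapping.lookup m v)"
  unfolding mono_subst_def using assms by (intro prod.mono_neutral_left) (auto simp: in_keys_iff)

lemma mono_subst_add: "mono_subst X (a + b) = mono_subst X a * mono_subst X b"
proof -
  let ?K = "Poly_Mapping.keys a \<union> Poly_Mapping.keys b"
  show ?thesis
    using keys_add[of a b]
    by (simp add: mono_subst_superset[of ?K] lookup_add power_add prod.distrib)
qed

lemma poly_subst_superset:
  assumes "finite K" "Poly_Mapping.keys p \<subseteq> K"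
  shows "poly_subst X p = (\<Sum>m\<in>K. Poly_Mapping.single 0 (Poly_Mapping.lookup p m) * mono_subst X m)"
  unfolding poly_subst_def using assms by (intro sum.mono_neutral_left) (auto simp: in_keys_iff)

lemma poly_subst_add: "poly_subst X (p + q) = poly_subst X p + poly_subst X q"
proof -
  let ?K = "Poly_Mapping.keys p \<union> Poly_Mapping.keys q"
  show ?thesis
    using keys_add[of p q]
    by (simp add: poly_subst_superset[of ?K] lookup_add single_add distrib_right sum.distrib)
qed

lemma poly_subst_0: "poly_subst X 0 = 0"
  by (simp add: poly_subst_def)

lemma poly_subst_uminus: "poly_subst X (- p) = - poly_subst X p"
  using poly_subst_add[of X p "- p"] by (simp add: poly_subst_0 eq_neg_iff_add_eq_0 add.commute)

lemma poly_subst_diff: "poly_subst X (p - q) = poly_subst X p - poly_subst X q"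
  using poly_subst_add[of X p "- q"] by (simp add: poly_subst_uminus)

lemma poly_subst_sum: "poly_subst X (\<Sum>i\<in>I. p i) = (\<Sum>i\<in>I. poly_subst X (p i))"
  by (induction I rule: infinite_finite_induct) (auto simp: poly_subst_0 poly_subst_add)

lemma poly_subst_single:
  "poly_subst X (Poly_Mapping.single m c) = Poly_Mapping.single 0 c * mono_subst X m"
  by (subst poly_subst_superset[of "{m}"]) auto

lemma poly_subst_mult: "poly_subst X (p * q) = poly_subst X p * poly_subst X q"
proof -
  have "p * q = (\<Sum>a\<in>Poly_Mapping.keys p. \<Sum>b\<in>Poly_Mapping.keys q.
      Poly_Mapping.single (a + b) (Poly_Mapping.lookup p a * Poly_Mapping.lookup q b))"
    by (subst (1) poly_mapping_sum_single[of p, symmetric],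
        subst (1) poly_mapping_sum_single[of q, symmetric])
       (simp only: sum_product mult_single)
  then have "poly_subst X (p * q) = (\<Sum>a\<in>Poly_Mapping.keys p. \<Sum>b\<in>Poly_Mapping.keys q.
      Poly_Mapping.single 0 (Poly_Mapping.lookup p a * Poly_Mapping.lookup q b) *
      (mono_subst X a * mono_subst X b))"
    by (simp only: poly_subst_sum poly_subst_single mono_subst_add)
  also have "\<dots> = (\<Sum>a\<in>Poly_Mapping.keys p. \<Sum>b\<in>Poly_Mapping.keys q.
      (Poly_Mapping.single 0 (Poly_Mapping.lookup p a) * mono_subst X a) *
      (Poly_Mapping.single 0 (Poly_Mapping.lookup q b) * mono_subst X b))"
  proof (intro sum.cong refl)
    fix a b
    have "Poly_Mapping.single (0::'a set multiset) (Poly_Mapping.lookup p a * Poly_Mapping.lookup q b) =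
      Poly_Mapping.single 0 (Poly_Mapping.lookup p a) * Poly_Mapping.single 0 (Poly_Mapping.lookup q b)"
      by (simp only: mult_single add_0)
    then show "Poly_Mapping.single 0 (Poly_Mapping.lookup p a * Poly_Mapping.lookup q b) *
      (mono_subst X a * mono_subst X b) =
      (Poly_Mapping.single 0 (Poly_Mapping.lookup p a) * mono_subst X a) *
      (Poly_Mapping.single 0 (Poly_Mapping.lookup q b) * mono_subst X b)"
      by (simp only: mult_ac)
  qed
  also have "\<dots> = poly_subst X p * poly_subst X q"
    by (simp only: poly_subst_def sum_product)
  finally show ?thesis .
qed

lemma poly_subst_pvar: "poly_subst X (pvar v) = X v"
  by (simp add: pvar_def poly_subst_single mono_subst_def)

lemma poly_subst_const: "poly_subst X (Poly_Mapping.single 0 c) = Poly_Mapping.single 0 c"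
  by (simp add: poly_subst_single mono_subst_def)

lemma poly_subst_1: "poly_subst X 1 = 1"
  using poly_subst_const[of X 1] by simp

section \<open>The rank function of a matroid\<close>

context
  fixes E :: "'a set" and indep :: "'a set \<Rightarrow> bool"
  assumes matroid: "matroid E indep"
begin

lemma indep_finite: "indep I \<Longrightarrow> finite I"
  using matroid by (auto simp: matroid_def intro: finite_subset)

lemma indep_subset: "indep J \<Longrightarrow> I \<subseteq> J \<Longrightarrow> indep I"
  using matroid unfolding matroid_def by blast

lemma finite_indep_cards: "finite {card I |I. I \<subseteq> X \<and> indep I}"
proof -
  have "{card I |I. I \<subseteq> X \<and> indep I} \<subseteq> card ` Pow E" using matroid by (auto simp: matroid_def)
  moreover have "finite E" using matroid by (simp add: matroid_def)
  ultimately show ?thesis using finite_subset by blast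
qed

lemma card_le_mrank: "I \<subseteq> X \<Longrightarrow> indep I \<Longrightarrow> card I \<le> mrank indep X"
  unfolding mrank_def by (rule Max_ge[OF finite_indep_cards]) auto

lemma mrank_basis_exists: "\<exists>B. B \<subseteq> X \<and> indep B \<and> card B = mrank indep X"
proof -
  have "indep {}" using matroid by (simp add: matroid_def)
  then have "{card I |I. I \<subseteq> X \<and> indep I} \<noteq> {}" by auto
  from Max_in[OF finite_indep_cards this] show ?thesis unfolding mrank_def by auto
qed

lemma mrank_basis_extend:
  assumes "I \<subseteq> X" "indep I"
  shows "\<exists>B. I \<subseteq> B \<and> B \<subseteq> X \<and> indep B \<and> card B = mrank indep X"
  using assms
proof (induction "mrank indep X - card I" arbitrary: I rule: less_induct)
  case less
  show ?case
  proof (cases "card I = mrank indep X")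
    case False
    then have lt: "card I < mrank indep X" using card_le_mrank less.prems by (simp add: le_neq_implies_less)
    obtain J where J: "J \<subseteq> X" "indep J" "card J = mrank indep X" using mrank_basis_exists by blast
    then obtain y where y: "y \<in> J - I" "indep (insert y I)"
      using matroid less.prems(2) lt unfolding matroid_def by metis
    have "card (insert y I) = Suc (card I)" using y indep_finite[OF less.prems(2)] by simp
    then have "\<exists>B. insert y I \<subseteq> B \<and> B \<subseteq> X \<and> indep B \<and> card B = mrank indep X"
      using lt y J less.prems by (intro less.hyps) auto
    then show ?thesis by auto
  qed (use less.prems in auto)
qed

lemma mrank_insert_le: "mrank indep (insert e X) \<le> Suc (mrank indep X)"
proof -
  obtain B where B: "B \<subseteq> insert e X" "indep B" "card B = mrank indep (insert e X)"
    using mrank_basis_exists by blast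
  have "card (B - {e}) \<le> mrank indep X"
    using B indep_subset[OF B(2)] by (intro card_le_mrank) auto
  moreover have "card B \<le> Suc (card (B - {e}))"
    by (metis card_Suc_Diff1 card_Diff_singleton_if indep_finite[OF B(2)] Diff_idemp Diff_insert_absorb
        insert_Diff_if le_SucI order_refl)
  ultimately show ?thesis using B(3) by simp
qed

lemma rank_function_mrank: "rank_function (mrank indep)"
proof
  show "mrank indep {} = 0"
    using mrank_basis_exists[of "{}"] by auto
  show mono: "mrank indep X \<le> mrank indep Y" if "X \<subseteq> Y" for X Y
    using mrank_basis_exists[of X] card_le_mrank[of _ Y] that by (metis subset_trans)
  show "mrank indep (X \<union> Y) + mrank indep (X \<inter> Y) \<le> mrank indep X + mrank indep Y" for X Y
  proof -
    obtain I where I: "I \<subseteq> X \<inter> Y" "indep I" "card I = mrank indep (X \<inter> Y)"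
      using mrank_basis_exists by blast
    obtain B where B: "I \<subseteq> B" "B \<subseteq> X \<union> Y" "indep B" "card B = mrank indep (X \<union> Y)"
      using mrank_basis_extend[of I "X \<union> Y"] I by auto
    have fin: "finite B" using B indep_finite by auto
    \<comment> \<open>\<open>I\<close> is contained in both \<open>B \<inter> X\<close> and
      \<open>B \<inter> Y\<close>, so \<open>B\<close> splits between \<open>X\<close> and
      \<open>Y\<close> with an overlap of at least \<open>card I\<close>.\<close>
    have "card B + card I \<le> card B + card (B \<inter> X \<inter> (B \<inter> Y))"
      using I B fin by (intro add_left_mono card_mono) auto
    also have "B = B \<inter> X \<union> B \<inter> Y" using B by auto
    then have "card B + card (B \<inter> X \<inter> (B \<inter> Y)) = card (B \<inter> X) + card (B \<inter> Y)"
      using card_Un_Int[of "B \<inter> X" "B \<inter> Y"] fin by simp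
    also have "\<dots> \<le> mrank indep X + mrank indep Y"
      using indep_subset[OF B(3)] by (intro add_mono card_le_mrank) auto
    finally show ?thesis using I B by simp
  qed
  show "mrank indep (insert e X) \<le> Suc (mrank indep X)" for e X
    by (rule mrank_insert_le)
qed

end

section \<open>A basis of the Chow ring\<close>

text \<open>The system is triangular: a minimal set \<open>F0\<close> occurs in no equation but its
  own, so its value can be chosen last. Solvability in an arbitrary abelian group is all that is
  asked, so no Moebius function appears.\<close>

lemma moebius_inversion_exists:
  fixes g :: "'a set \<Rightarrow> 'b::ab_group_add"
  assumes "finite P"
  shows "\<exists>X. \<forall>F\<in>P. (\<Sum>G\<in>{G \<in> P. F \<subseteq> G}. X G) = g F"
  using assms
proof (induction "card P" arbitrary: P)
  case (Suc n)
  then have "P \<noteq> {}" by auto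
  then obtain F0 where F0: "F0 \<in> P" and min: "\<And>G. G \<in> P \<Longrightarrow> G \<subseteq> F0 \<Longrightarrow> F0 = G"
    using finite_has_minimal[OF Suc.prems] by blast
  have "n = card (P - {F0})" using Suc.hyps(2) Suc.prems F0 by simp
  from Suc.hyps(1)[OF this] Suc.prems
  obtain X where X: "\<forall>F\<in>P - {F0}. (\<Sum>G\<in>{G \<in> P - {F0}. F \<subseteq> G}. X G) = g F" by blast
  define Y where "Y = X(F0 := g F0 - (\<Sum>G\<in>{G \<in> P - {F0}. F0 \<subseteq> G}. X G))"
  have "(\<Sum>G\<in>{G \<in> P. F \<subseteq> G}. Y G) = g F" if F: "F \<in> P" for F
  proof (cases "F = F0")
    case True
    have "{G \<in> P. F0 \<subseteq> G} = insert F0 {G \<in> P - {F0}. F0 \<subseteq> G}" using F0 by auto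
    then have "(\<Sum>G\<in>{G \<in> P. F0 \<subseteq> G}. Y G) = Y F0 + (\<Sum>G\<in>{G \<in> P - {F0}. F0 \<subseteq> G}. Y G)"
      using Suc.prems by simp
    also have "(\<Sum>G\<in>{G \<in> P - {F0}. F0 \<subseteq> G}. Y G) = (\<Sum>G\<in>{G \<in> P - {F0}. F0 \<subseteq> G}. X G)"
      by (rule sum.cong) (auto simp: Y_def)
    finally show ?thesis using True by (simp add: Y_def)
  next
    case False
    then have "{G \<in> P. F \<subseteq> G} = {G \<in> P - {F0}. F \<subseteq> G}" using min[OF F] by auto
    then have "(\<Sum>G\<in>{G \<in> P. F \<subseteq> G}. Y G) = (\<Sum>G\<in>{G \<in> P - {F0}. F \<subseteq> G}. Y G)" by simp
    also have "\<dots> = (\<Sum>G\<in>{G \<in> P - {F0}. F \<subseteq> G}. X G)"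
      by (rule sum.cong) (auto simp: Y_def)
    finally show ?thesis using X F False by simp
  qed
  then show ?case by blast
qed simp

locale pointed_loopless_matroid =
  fixes E :: "'a set" and indep :: "'a set \<Rightarrow> bool" and i0 :: 'a
  assumes matroid: "matroid E indep" and loopless: "loopless E indep" and i0: "i0 \<in> E"
begin

abbreviation "r \<equiv> mrank indep"
abbreviation "V \<equiv> proper_flats E indep"
abbreviation "NF \<equiv> flats_above r E {}"
abbreviation "CI \<equiv> chow_ideal E indep"
abbreviation "PR \<equiv> in_polyring V"
abbreviation "cl \<equiv> rclosure r E"

sublocale rank_function r
  by (rule rank_function_mrank[OF matroid])

lemma finite_E: "finite E"
  using matroid by (simp add: matroid_def)

lemma flat_iff: "flat E indep F \<longleftrightarrow> rflat r E F"
  by (auto simp: flat_def rflat_def)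

lemma V_eq: "V = NF - {E}"
  by (auto simp: proper_flats_def flats_above_def flat_iff)

lemma finite_NF: "finite NF"
  by (rule finite_flats_above[OF finite_E])

lemma finite_V: "finite V"
  using finite_NF by (simp add: V_eq)

lemma E_NF: "E \<in> NF"
  using i0 by (auto simp: flats_above_def rflat_self)

lemma NF_rflat: "F \<in> NF \<Longrightarrow> rflat r E F" and NF_subset: "F \<in> NF \<Longrightarrow> F \<subseteq> E"
  by (auto simp: flats_above_def rflat_def)

lemma rank_singleton: "i \<in> E \<Longrightarrow> r {i} = 1"
proof -
  assume "i \<in> E"
  then have "indep {i}" using loopless by (simp add: loopless_def)
  then have "1 \<le> r {i}" using card_le_mrank[OF matroid, of "{i}" "{i}"] by simp
  then show ?thesis using rank_insert_le[of i "{}"] rank_empty by simp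
qed

lemma cl_NF:
  assumes "X \<subseteq> E" "X \<noteq> {}"
  shows "cl X \<in> NF"
  using assms rflat_rclosure[OF finite_E assms(1)] subset_rclosure[OF assms(1)]
  by (auto simp: flats_above_def)

lemma cl_subset_iff: "X \<subseteq> E \<Longrightarrow> F \<in> NF \<Longrightarrow> cl X \<subseteq> F \<longleftrightarrow> X \<subseteq> F"
  using rclosure_subset_iff NF_rflat by blast

lemma rank_cl: "X \<subseteq> E \<Longrightarrow> r (cl X) = r X"
  using rank_rclosure[OF finite_E] .

lemma NF_rank_pos:
  assumes "F \<in> NF"
  shows "0 < r F"
proof -
  obtain i where "i \<in> F" using assms by (auto simp: flats_above_def)
  then have "r {i} \<le> r F" by (intro rank_mono) auto
  then show ?thesis using rank_singleton[of i] \<open>i \<in> F\<close> NF_subset[OF assms] by auto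
qed

lemma NF_rank_less: "F \<in> NF \<Longrightarrow> G \<in> NF \<Longrightarrow> F \<subset> G \<Longrightarrow> r F < r G"
  by (rule rflat_rank_less[OF NF_rflat _ NF_subset])

text \<open>The class of \<open>eta F\<close> is \<open>- (\<Sum>G \<supseteq> F. x\<^sub>G)\<close> once \<open>x\<^sub>E\<close> is adjoined with \<open>x\<^sub>E = - (\<Sum>G \<ni> i0. x\<^sub>G)\<close>.\<close>

definition eta :: "'a set \<Rightarrow> 'a set qpoly" where
  "eta F = (\<Sum>G\<in>{G \<in> V. i0 \<in> G}. pvar G) - (\<Sum>G\<in>{G \<in> V. F \<subseteq> G}. pvar G)"

definition eta_mset :: "'a set multiset \<Rightarrow> 'a set qpoly" where
  "eta_mset M = (\<Prod>F\<in>#M. eta F)"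

lemma eta_mset_simps:
  "eta_mset {#} = 1" "eta_mset (add_mset F M) = eta F * eta_mset M"
  "eta_mset (M + N) = eta_mset M * eta_mset N" "eta_mset (replicate_mset n F) = eta F ^ n"
  by (simp_all add: eta_mset_def)

lemma PR_pvar_sum: "PR (\<Sum>G\<in>{G \<in> V. P G}. pvar G)"
  by (intro in_polyring_sum in_polyring_pvar) auto

lemma PR_eta: "PR (eta F)"
  unfolding eta_def by (intro in_polyring_diff PR_pvar_sum)

lemma PR_eta_mset: "PR (eta_mset M)"
  unfolding eta_mset_def by (intro in_polyring_prod_mset PR_eta)

lemma homogeneous_eta: "homogeneous 1 (eta F)"
  unfolding eta_def by (intro homogeneous_diff homogeneous_sum homogeneous_pvar)

lemma homogeneous_eta_mset: "homogeneous (size M) (eta_mset M)"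
  unfolding eta_mset_def by (intro homogeneous_prod_mset homogeneous_eta)

lemmas CI_add = gen_ideal_add[of _ V "chow_I E indep \<union> chow_J E indep", folded chow_ideal_def]
  and CI_diff = gen_ideal_diff[of _ V "chow_I E indep \<union> chow_J E indep", folded chow_ideal_def]
  and CI_0 = gen_ideal_0[of V "chow_I E indep \<union> chow_J E indep", folded chow_ideal_def]
  and CI_mult = gen_ideal_mult_right[of _ V "chow_I E indep \<union> chow_J E indep", folded chow_ideal_def]
  and CI_sum = gen_ideal_sum[of _ _ V "chow_I E indep \<union> chow_J E indep", folded chow_ideal_def]
  and CI_subspace = subspace_gen_ideal[of V "chow_I E indep \<union> chow_J E indep", folded chow_ideal_def]

section \<open>Relations between the simplicial generators\<close>

lemma rank1_flat_subset_iff: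
  assumes "F \<in> NF" "r F = 1" "i \<in> F" "G \<in> NF"
  shows "F \<subseteq> G \<longleftrightarrow> i \<in> G"
proof
  assume "i \<in> G"
  have i: "i \<in> E" using assms NF_subset by auto
  have "F \<subseteq> cl {i}"
  proof
    fix e assume e: "e \<in> F"
    have "r (insert e {i}) \<le> r F" using e assms by (intro rank_mono) auto
    moreover have "r {i} \<le> r (insert e {i})" by (intro rank_mono) auto
    ultimately have "r (insert e {i}) = r {i}" using rank_singleton[OF i] assms(2) by simp
    then show "e \<in> cl {i}" using e NF_subset[OF assms(1)] by (auto simp: rclosure_def)
  qed
  moreover have "cl {i} \<subseteq> G" using cl_subset_iff[of "{i}" G] i assms(4) \<open>i \<in> G\<close> by simp
  ultimately show "F \<subseteq> G" by blast
qed (use assms in auto)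

lemma eta_rank1:
  assumes "F \<in> NF" "r F = 1"
  shows "eta F \<in> CI"
proof -
  obtain i where i: "i \<in> F" using assms(1) by (auto simp: flats_above_def)
  have "{G \<in> V. F \<subseteq> G} = {G \<in> V. i \<in> G}"
    using rank1_flat_subset_iff[OF assms i] by (auto simp: V_eq)
  then have "eta F \<in> chow_J E indep"
    using i i0 NF_subset[OF assms(1)] unfolding eta_def chow_J_def by auto
  then show ?thesis unfolding chow_ideal_def by (intro gen_ideal_base) auto
qed

text \<open>Flats above the join cancel in each difference. What remains are flats above
  \<open>F\<close> but not \<open>G\<close>, and flats above \<open>G\<close> but not
  \<open>F\<close>; any two of opposite kind are incomparable, so every product is a generator of
  \<open>chow_I\<close>.\<close>

lemma eta_exchange:
  assumes "F \<in> NF" "G \<in> NF"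
  shows "(eta F - eta (cl (F \<union> G))) * (eta G - eta (cl (F \<union> G))) \<in> CI"
proof -
  let ?K = "cl (F \<union> G)"
  have sub: "F \<union> G \<subseteq> E" using assms NF_subset by auto
  have iff: "?K \<subseteq> H \<longleftrightarrow> F \<subseteq> H \<and> G \<subseteq> H" if "H \<in> V" for H
    using cl_subset_iff[OF sub, of H] that by (auto simp: V_eq)
  have diff: "eta A - eta ?K = - (\<Sum>H\<in>{H \<in> V. A \<subseteq> H \<and> \<not> B \<subseteq> H}. pvar H)"
    if AB: "{A, B} = {F, G}" for A B
  proof -
    have "{H \<in> V. A \<subseteq> H} = {H \<in> V. ?K \<subseteq> H} \<union> {H \<in> V. A \<subseteq> H \<and> \<not> B \<subseteq> H}"
      using iff AB by (auto simp: doubleton_eq_iff)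
    moreover have "{H \<in> V. ?K \<subseteq> H} \<inter> {H \<in> V. A \<subseteq> H \<and> \<not> B \<subseteq> H} = {}"
      using iff AB by (auto simp: doubleton_eq_iff)
    ultimately have "(\<Sum>H\<in>{H \<in> V. A \<subseteq> H}. pvar H) =
        (\<Sum>H\<in>{H \<in> V. ?K \<subseteq> H}. pvar H) + (\<Sum>H\<in>{H \<in> V. A \<subseteq> H \<and> \<not> B \<subseteq> H}. pvar H)"
      using finite_V by (simp add: sum.union_disjoint)
    then show ?thesis by (simp add: eta_def)
  qed
  have "(eta F - eta ?K) * (eta G - eta ?K) =
      (\<Sum>H\<in>{H \<in> V. F \<subseteq> H \<and> \<not> G \<subseteq> H}. \<Sum>H'\<in>{H \<in> V. G \<subseteq> H \<and> \<not> F \<subseteq> H}. pvar H * pvar H')"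
    using diff[of F G] diff[of G F] by (simp add: insert_commute sum_product)
  also have "\<dots> \<in> CI"
  proof (intro CI_sum)
    fix H H' assume "H \<in> {H \<in> V. F \<subseteq> H \<and> \<not> G \<subseteq> H}" "H' \<in> {H \<in> V. G \<subseteq> H \<and> \<not> F \<subseteq> H}"
    then have "pvar H * pvar H' \<in> chow_I E indep" unfolding chow_I_def by blast
    then show "pvar H * pvar H' \<in> CI" unfolding chow_ideal_def by (intro gen_ideal_base) auto
  qed
  finally show ?thesis .
qed

text \<open>The exchange relation for \<open>F\<close> and the rank-one flat \<open>cl {i}\<close>,
  whose own generator vanishes.\<close>

lemma eta_cover:
  assumes "F \<in> NF" "i \<in> E"
  shows "(eta F - eta (cl (insert i F))) * eta (cl (insert i F)) \<in> CI"
proof -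
  let ?K = "cl (insert i F)" and ?G = "cl {i}"
  have G: "?G \<in> NF" "r ?G = 1" using cl_NF[of "{i}"] rank_cl[of "{i}"] rank_singleton assms by auto
  have sub: "insert i F \<subseteq> E" "F \<union> ?G \<subseteq> E" using assms NF_subset G by auto
  have K: "?K \<in> NF" "cl (F \<union> ?G) \<in> NF" using cl_NF[OF sub(1)] cl_NF[OF sub(2)] G by (auto simp: flats_above_def)
  have "?K \<subseteq> cl (F \<union> ?G)"
    using cl_subset_iff[OF sub(1) K(2)] subset_rclosure[OF sub(2)] subset_rclosure[of "{i}" E] assms(2) by auto
  moreover have "?G \<subseteq> ?K"
    using cl_subset_iff[of "{i}" ?K] K(1) assms(2) subset_rclosure[OF sub(1)] by auto
  then have "cl (F \<union> ?G) \<subseteq> ?K"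
    using cl_subset_iff[OF sub(2) K(1)] subset_rclosure[OF sub(1)] by auto
  ultimately have eq: "cl (F \<union> ?G) = ?K" by auto
  have "(eta F - eta ?K) * (eta ?G - eta ?K) \<in> CI" using eta_exchange[OF assms(1) G(1)] eq by simp
  moreover have "eta ?G * (eta F - eta ?K) \<in> CI"
    using eta_rank1[OF G] by (intro CI_mult in_polyring_diff PR_eta)
  ultimately have "eta ?G * (eta F - eta ?K) - (eta F - eta ?K) * (eta ?G - eta ?K) \<in> CI"
    by (intro CI_diff)
  then show ?thesis by (simp add: algebra_simps)
qed

text \<open>One climbs from \<open>F\<close> to \<open>G\<close> by adjoining single elements; every
  cover relation costs one factor \<open>eta G\<close>.\<close>

lemma eta_power_diff:
  assumes "F \<in> NF" "G \<in> NF" "F \<subseteq> G"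
  shows "(eta F - eta G) * eta G ^ (r G - r F) \<in> CI"
  using assms
proof (induction "r G - r F" arbitrary: F rule: less_induct)
  case less
  show ?case
  proof (cases "F = G")
    case True
    then show ?thesis by (simp add: CI_0)
  next
    case False
    then obtain i where i: "i \<in> G" "i \<notin> F" using less.prems by auto
    then have iE: "i \<in> E" using less.prems NF_subset by auto
    let ?F = "cl (insert i F)"
    have sub: "insert i F \<subseteq> E" using iE NF_subset less.prems by auto
    have F': "?F \<in> NF" "?F \<subseteq> G" using cl_NF[OF sub] cl_subset_iff[OF sub less.prems(2)] i less.prems by auto
    have rF: "r ?F = Suc (r F)" using rank_cl[OF sub] rflat_rank_insert[OF NF_rflat iE i(2)] less.prems by simp
    have "r ?F \<le> r G" using F' rank_mono by auto
    define n where "n = r G - r ?F"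
    have n: "r G - r F = Suc n" using rF \<open>r ?F \<le> r G\<close> by (simp add: n_def)
    define a b c where "a = eta F" and "b = eta ?F" and "c = eta G"
    have PR: "PR a" "PR b" "PR c" by (simp_all add: a_def b_def c_def PR_eta)
    have bc: "(b - c) * c ^ n \<in> CI"
      using less.hyps[OF _ F'(1) less.prems(2) F'(2)] n by (simp add: a_def b_def c_def n_def)
    have ab: "(a - b) * b \<in> CI" using eta_cover[OF less.prems(1) iE] by (simp add: a_def b_def)
    \<comment> \<open>The combination rests on the identity
      \<open>(a - c) * c = (a - b) * b + (b - c) * (b + c - a)\<close>.\<close>
    have "(b - c) * c ^ n * (b + c - a) + (a - b) * b * c ^ n \<in> CI"
      using PR by (intro CI_add CI_mult[OF bc] CI_mult[OF ab] in_polyring_diff in_polyring_add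
          in_polyring_power)
    also have "(b - c) * c ^ n * (b + c - a) + (a - b) * b * c ^ n = (a - c) * c ^ Suc n"
      by (simp add: algebra_simps)
    finally show ?thesis unfolding n by (simp add: a_def c_def)
  qed
qed

text \<open>A climb that starts at a rank-one flat inside \<open>G\<close>, where the generator
  vanishes, leaves a pure power of \<open>eta G\<close>.\<close>

lemma eta_power_rank:
  assumes "G \<in> NF"
  shows "eta G ^ r G \<in> CI"
proof -
  obtain i where i: "i \<in> G" using assms by (auto simp: flats_above_def)
  then have iE: "i \<in> E" using NF_subset[OF assms] by auto
  let ?F = "cl {i}"
  have F: "?F \<in> NF" "r ?F = 1" "?F \<subseteq> G"
    using cl_NF[of "{i}"] rank_cl[of "{i}"] rank_singleton cl_subset_iff[of "{i}" G] iE i assms by auto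
  have "(eta ?F - eta G) * eta G ^ (r G - 1) \<in> CI"
    using eta_power_diff[OF F(1) assms F(3)] F(2) by simp
  then have "eta ?F * eta G ^ (r G - 1) - (eta ?F - eta G) * eta G ^ (r G - 1) \<in> CI"
    by (intro CI_diff CI_mult[OF eta_rank1[OF F(1,2)]] in_polyring_power PR_eta)
  moreover have "eta G * eta G ^ (r G - 1) = eta G ^ r G"
    using NF_rank_pos[OF assms] by (simp add: power_eq_if)
  ultimately show ?thesis by (simp add: algebra_simps)
qed

section \<open>Spanning by nested monomials\<close>

abbreviation "basis_index k \<equiv> {M \<in> nested r E {}. size M = k}"

definition rank_sum :: "'a set multiset \<Rightarrow> nat" where
  "rank_sum M = (\<Sum>F\<in>#M. r F)"

lemma rank_sum_le:
  assumes "set_mset M \<subseteq> NF"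
  shows "rank_sum M \<le> size M * r E"
proof -
  have "rank_sum M \<le> (\<Sum>F\<in>#M. r E)"
    unfolding rank_sum_def using assms NF_subset by (intro sum_mset_mono rank_mono) auto
  then show ?thesis by simp
qed

lemma replicate_mset_split:
  assumes "n \<le> count M x"
  obtains N where "M = replicate_mset n x + N"
proof
  have "replicate_mset n x \<subseteq># M" using assms by (simp add: count_le_replicate_mset_subset_eq)
  then show "M = replicate_mset n x + (M - replicate_mset n x)" by simp
qed

text \<open>Every rewriting step raises the total rank, which is bounded.\<close>

lemma eta_mset_span:
  assumes "set_mset M \<subseteq> NF" "size M = k"
  shows "eta_mset M \<in> qpoly.span (CI \<union> eta_mset ` basis_index k)"
  using assms
proof (induction "k * r E - rank_sum M" arbitrary: M rule: less_induct)
  case less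
  let ?Q = "qpoly.span (CI \<union> eta_mset ` basis_index k)"
  have CIQ: "p \<in> ?Q" if "p \<in> CI" for p using that by (intro qpoly.span_base) auto
  have IH: "eta_mset N \<in> ?Q" if "set_mset N \<subseteq> NF" "size N = k" "rank_sum M < rank_sum N" for N
  proof (rule less.hyps[OF _ that(1,2)])
    show "k * r E - rank_sum N < k * r E - rank_sum M"
      using rank_sum_le[OF that(1)] that(2,3) by simp
  qed
  \<comment> \<open>Each failure of nestedness has its own relation: \<open>eta_power_rank\<close>
    kills the monomial, \<open>eta_exchange\<close> replaces two incomparable flats using their
    join, and \<open>eta_power_diff\<close> moves one copy of \<open>F\<close> up to
    \<open>G\<close>.\<close>
  consider "M \<in> nested r E {}"
    | F where "F \<in># M" "r F \<le> count M F"
    | F G where "F \<in># M" "G \<in># M" "\<not> F \<subseteq> G" "\<not> G \<subseteq> F"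
    | F G where "F \<in># M" "G \<in># M" "F \<subset> G" "r G \<le> r F + count M G"
    using less.prems(1) rank_empty unfolding nested_def mem_Collect_eq by (fastforce simp: not_less)
  then show ?case
  proof cases
    case 1
    then show ?thesis using less.prems by (intro qpoly.span_base) auto
  next
    case (2 F)
    obtain N where N: "M = replicate_mset (r F) F + N" by (rule replicate_mset_split[OF 2(2)])
    have "F \<in> NF" using 2(1) less.prems by auto
    then have "eta F ^ r F * eta_mset N \<in> CI"
      by (intro CI_mult[OF eta_power_rank] PR_eta_mset)
    then show ?thesis by (intro CIQ) (simp add: N eta_mset_simps)
  next
    case (3 F G)
    obtain M1 where "M = add_mset F M1" using 3(1) by (metis insert_DiffM)
    moreover have "G \<in># M1" using 3 calculation by auto
    then obtain N where "M1 = add_mset G N" by (metis insert_DiffM)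
    ultimately have M: "M = add_mset F (add_mset G N)" by simp
    let ?K = "cl (F \<union> G)"
    have FG: "F \<in> NF" "G \<in> NF" "set_mset N \<subseteq> NF" using less.prems M by auto
    have sub: "F \<union> G \<subseteq> E" using FG NF_subset by auto
    have K: "?K \<in> NF" using cl_NF[OF sub] 3(3) by blast
    have lt: "r F < r ?K" "r G < r ?K"
      using NF_rank_less[OF FG(1) K] NF_rank_less[OF FG(2) K] subset_rclosure[OF sub] 3 by auto
    have "eta_mset M = (eta F - eta ?K) * (eta G - eta ?K) * eta_mset N +
        eta_mset (add_mset F (add_mset ?K N)) + eta_mset (add_mset G (add_mset ?K N)) -
        eta_mset (add_mset ?K (add_mset ?K N))"
      by (simp add: M eta_mset_simps algebra_simps)
    also have "\<dots> \<in> ?Q"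
      using FG K M less.prems(2) lt
      by (intro qpoly.span_add qpoly.span_diff IH CIQ CI_mult[OF eta_exchange[OF FG(1,2)]] PR_eta_mset)
         (auto simp: rank_sum_def)
    finally show ?thesis .
  next
    case (4 F G)
    have FG: "F \<in> NF" "G \<in> NF" using 4 less.prems by auto
    have rk: "r F < r G" using NF_rank_less[OF FG 4(3)] .
    obtain M1 where M1: "M = add_mset F M1" using 4(1) by (metis insert_DiffM)
    have "F \<noteq> G" using 4(3) by auto
    then have "r G - r F \<le> count M1 G" using 4(4) M1 by simp
    then obtain N where "M1 = replicate_mset (r G - r F) G + N" by (rule replicate_mset_split)
    then have M: "M = add_mset F (replicate_mset (r G - r F) G + N)" using M1 by simp
    have N: "set_mset N \<subseteq> NF" using less.prems M by auto
    have "eta_mset M = (eta F - eta G) * eta G ^ (r G - r F) * eta_mset N +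
        eta_mset (add_mset G (replicate_mset (r G - r F) G + N))"
      by (simp add: M eta_mset_simps algebra_simps)
    also have "\<dots> \<in> ?Q"
    proof (intro qpoly.span_add IH CIQ CI_mult[OF eta_power_diff] PR_eta_mset FG)
      show "F \<subseteq> G" using 4(3) by auto
      show "set_mset (add_mset G (replicate_mset (r G - r F) G + N)) \<subseteq> NF"
        using FG N by (auto split: if_splits)
      show "size (add_mset G (replicate_mset (r G - r F) G + N)) = k"
        using less.prems(2) M by simp
      show "rank_sum M < rank_sum (add_mset G (replicate_mset (r G - r F) G + N))"
        using rk by (simp add: M rank_sum_def)
    qed
    finally show ?thesis .
  qed
qed

text \<open>\<open>eta E - eta F\<close> is the sum of the variables of all proper flats above
  \<open>F\<close>, a triangular expression that is solved from the large flats downwards.\<close>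

lemma pvar_eta_span:
  assumes "F \<in> V"
  shows "pvar F \<in> qpoly.span (eta ` NF)"
  using assms
proof (induction "card (E - F)" arbitrary: F rule: less_induct)
  case less
  have F: "F \<in> NF" using less.prems by (simp add: V_eq)
  have empty: "{G \<in> V. E \<subseteq> G} = {}" using NF_subset by (auto simp: V_eq)
  have split: "{G \<in> V. F \<subseteq> G} = insert F {G \<in> V. F \<subset> G}" using less.prems by auto
  have "eta E - eta F = pvar F + (\<Sum>G\<in>{G \<in> V. F \<subset> G}. pvar G)"
    unfolding eta_def empty split using finite_V by simp
  then have "pvar F = eta E - eta F - (\<Sum>G\<in>{G \<in> V. F \<subset> G}. pvar G)" by simp
  also have "\<dots> \<in> qpoly.span (eta ` NF)"
  proof (intro qpoly.span_diff qpoly.span_sum)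
    fix G assume G: "G \<in> {G \<in> V. F \<subset> G}"
    then have "G \<subseteq> E" using NF_subset by (auto simp: V_eq)
    then have "card (E - G) < card (E - F)" using G finite_E by (intro psubset_card_mono) auto
    then show "pvar G \<in> qpoly.span (eta ` NF)" using less.hyps G by blast
  qed (use E_NF F in \<open>auto intro: qpoly.span_base\<close>)
  finally show ?case .
qed

abbreviation "flat_msets k \<equiv> multisets_of_size NF k"

lemma monomial_eta_span:
  assumes "Poly_Mapping.keys m \<subseteq> V" "mdegree m = k"
  shows "Poly_Mapping.single m 1 \<in> qpoly.span (eta_mset ` flat_msets k)"
  using assms
proof (induction k arbitrary: m)
  case 0
  then have "m = 0"
    by (intro poly_mapping_eqI) (auto simp: mdegree_def in_keys_iff)
  then have "Poly_Mapping.single m 1 = eta_mset {#}" by (simp add: eta_mset_simps)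
  then show ?case by (auto intro: qpoly.span_base)
next
  case (Suc k)
  then obtain v where v: "v \<in> Poly_Mapping.keys m" by (fastforce simp: mdegree_def)
  define m' where "m' = m - Poly_Mapping.single v 1"
  have m: "m = m' + Poly_Mapping.single v 1"
    using v by (intro poly_mapping_eqI)
      (auto simp: m'_def lookup_add lookup_minus lookup_single when_def in_keys_iff)
  have sub: "Poly_Mapping.keys m' \<subseteq> V"
    using Suc.prems(1) by (auto simp: m in_keys_iff lookup_add)
  have "mdegree m' = k" using Suc.prems(2) by (simp add: m mdegree_add) (simp add: mdegree_def)
  then have m'_span: "Poly_Mapping.single m' 1 \<in> qpoly.span (eta_mset ` flat_msets k)"
    using Suc.IH sub by blast
  have v_span: "pvar v \<in> qpoly.span (eta ` NF)" using pvar_eta_span v Suc.prems(1) by blast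
  have "a * b \<in> qpoly.span (eta_mset ` flat_msets (Suc k))"
    if ab: "a \<in> eta ` NF" "b \<in> eta_mset ` flat_msets k" for a b
  proof -
    obtain F M where "a = eta F" "F \<in> NF" "b = eta_mset M" "M \<in> flat_msets k" using ab by auto
    then have "a * b = eta_mset (add_mset F M)" "add_mset F M \<in> flat_msets (Suc k)"
      by (auto simp: eta_mset_simps multisets_of_size_def)
    then show ?thesis by (auto intro: qpoly.span_base)
  qed
  then have "pvar v * Poly_Mapping.single m' 1 \<in> qpoly.span (eta_mset ` flat_msets (Suc k))"
    by (rule qpoly_span_mult[OF v_span m'_span])
  then show ?case by (simp add: m pvar_def mult_single add.commute)
qed

lemma homog_part_eta_span:
  "homog_part E indep k \<subseteq> qpoly.span (eta_mset ` flat_msets k)"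
proof
  fix p assume p: "p \<in> homog_part E indep k"
  have "p = (\<Sum>m\<in>Poly_Mapping.keys p. qscale (Poly_Mapping.lookup p m) (Poly_Mapping.single m 1))"
    by (simp add: qscale_def mult_single poly_mapping_sum_single)
  also have "\<dots> \<in> qpoly.span (eta_mset ` flat_msets k)"
    using p by (intro qpoly.span_sum qpoly.span_scale monomial_eta_span)
      (auto simp: homog_part_def in_polyring_def homogeneous_iff)
  finally show "p \<in> qpoly.span (eta_mset ` flat_msets k)" .
qed

lemma subspace_homog_part: "qpoly.subspace (homog_part E indep k)"
proof (rule qpoly.subspaceI)
  show "0 \<in> homog_part E indep k" by (simp add: homog_part_def in_polyring_0 homogeneous_0)
  show "p + q \<in> homog_part E indep k" if "p \<in> homog_part E indep k" "q \<in> homog_part E indep k" for p q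
    using that by (simp add: homog_part_def in_polyring_add homogeneous_add)
  show "qscale c p \<in> homog_part E indep k" if "p \<in> homog_part E indep k" for c p
  proof -
    have "homogeneous (0 + k) (qscale c p)"
      unfolding qscale_def using that by (intro homogeneous_mult homogeneous_const) (simp add: homog_part_def)
    moreover have "PR (qscale c p)"
      unfolding qscale_def using that by (intro in_polyring_mult in_polyring_single) (auto simp: homog_part_def)
    ultimately show ?thesis by (simp add: homog_part_def)
  qed
qed

lemma eta_mset_homog_part: "eta_mset M \<in> homog_part E indep (size M)"
  by (simp add: homog_part_def PR_eta_mset homogeneous_eta_mset)

lemma homog_part_span_basis:
  "homog_part E indep k \<subseteq> qpoly.span ((homog_part E indep k \<inter> CI) \<union> eta_mset ` basis_index k)"
proof
  fix p assume p: "p \<in> homog_part E indep k"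
  have "eta_mset ` flat_msets k \<subseteq> qpoly.span (CI \<union> eta_mset ` basis_index k)"
    using eta_mset_span by (auto simp: multisets_of_size_def)
  then have "qpoly.span (eta_mset ` flat_msets k) \<subseteq> qpoly.span (CI \<union> eta_mset ` basis_index k)"
    by (rule qpoly.span_minimal) (rule qpoly.subspace_span)
  then have "p \<in> qpoly.span (CI \<union> eta_mset ` basis_index k)" using p homog_part_eta_span by blast
  then obtain u b where ub: "p = u + b" "u \<in> CI" "b \<in> qpoly.span (eta_mset ` basis_index k)"
    unfolding qpoly.span_Un using CI_subspace by (auto simp: qpoly.span_eq_iff[THEN iffD2])
  have "eta_mset ` basis_index k \<subseteq> homog_part E indep k" using eta_mset_homog_part by auto
  then have "b \<in> homog_part E indep k"
    using ub(3) qpoly.span_minimal[OF _ subspace_homog_part] by blast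
  \<comment> \<open>The ideal component is homogeneous as the difference of two elements of degree
    \<open>k\<close>.\<close>
  then have "u \<in> homog_part E indep k"
    using p ub(1) qpoly.subspace_diff[OF subspace_homog_part, of p k b] by simp
  then show "p \<in> qpoly.span ((homog_part E indep k \<inter> CI) \<union> eta_mset ` basis_index k)"
    unfolding ub(1) using ub(2,3)
    by (intro qpoly.span_add) (auto intro: qpoly.span_base qpoly.span_mono[THEN subsetD])
qed

section \<open>Linear independence through substitution into the Hall-Rado pairing\<close>

definition Xsub :: "'a set \<Rightarrow> 'a mring" where
  "Xsub = (SOME X. \<forall>F\<in>NF. (\<Sum>G\<in>{G \<in> NF. F \<subseteq> G}. X G) = - hvar F)"

text \<open>\<open>Xsub\<close> inverts the definition of the simplicial generators, with the
  variable of \<open>E\<close> included, so that \<open>eta F\<close> is sent to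
  \<open>hvar F\<close> up to the rank-one class of \<open>i0\<close>.\<close>

lemma Xsub_sum: "F \<in> NF \<Longrightarrow> (\<Sum>G\<in>{G \<in> NF. F \<subseteq> G}. Xsub G) = - hvar F"
  using someI_ex[OF moebius_inversion_exists[OF finite_NF, of "\<lambda>F. - hvar F"]]
  unfolding Xsub_def by blast

lemma Xsub_sum_proper:
  assumes "F \<in> NF"
  shows "(\<Sum>G\<in>{G \<in> V. F \<subseteq> G}. Xsub G) = - hvar F - Xsub E"
proof -
  have "{G \<in> NF. F \<subseteq> G} = insert E {G \<in> V. F \<subseteq> G}" using E_NF NF_subset[OF assms] by (auto simp: V_eq)
  moreover have "E \<notin> {G \<in> V. F \<subseteq> G}" by (simp add: V_eq)
  ultimately have "- hvar F = Xsub E + (\<Sum>G\<in>{G \<in> V. F \<subseteq> G}. Xsub G)"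
    using Xsub_sum[OF assms] finite_V by simp
  then show ?thesis by (simp add: algebra_simps)
qed

lemma Xsub_sum_point:
  assumes "i \<in> E"
  shows "(\<Sum>G\<in>{G \<in> V. i \<in> G}. Xsub G) = - hvar (cl {i}) - Xsub E"
proof -
  have "{G \<in> V. i \<in> G} = {G \<in> V. cl {i} \<subseteq> G}"
    using cl_subset_iff[of "{i}"] assms by (auto simp: V_eq)
  then show ?thesis using Xsub_sum_proper[of "cl {i}"] cl_NF[of "{i}"] assms by simp
qed

lemma hvar_point_null: "i \<in> E \<Longrightarrow> hvar (cl {i}) \<in> null_ideal"
  using hvar_rank1_null[of "cl {i}"] rank_cl[of "{i}"] rank_singleton by simp

text \<open>Expanding the exchange relation of \<open>F\<close> and \<open>G\<close> gives a sum of
  products over incomparable pairs of larger or equal flats. All pairs except (F, G) are null by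
  induction on the complements, and so is the total.\<close>

lemma Xsub_incomparable_null:
  assumes "F \<in> NF" "G \<in> NF" "\<not> F \<subseteq> G" "\<not> G \<subseteq> F"
  shows "Xsub F * Xsub G \<in> null_ideal"
  using assms
proof (induction "card (E - F) + card (E - G)" arbitrary: F G rule: less_induct)
  case less
  let ?K = "cl (F \<union> G)"
  have sub: "F \<union> G \<subseteq> E" using less.prems NF_subset by auto
  have K: "?K \<in> NF" using cl_NF[OF sub] less.prems by auto
  define A where "A = {H \<in> NF. F \<subseteq> H \<and> \<not> G \<subseteq> H}"
  define B where "B = {H \<in> NF. G \<subseteq> H \<and> \<not> F \<subseteq> H}"
  have iff: "?K \<subseteq> H \<longleftrightarrow> F \<subseteq> H \<and> G \<subseteq> H" if "H \<in> NF" for H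
    using cl_subset_iff[OF sub that] by auto
  have fin: "finite A" "finite B" using finite_NF by (auto simp: A_def B_def)
  have "{H \<in> NF. F \<subseteq> H} = A \<union> {H \<in> NF. ?K \<subseteq> H}" "A \<inter> {H \<in> NF. ?K \<subseteq> H} = {}"
    using iff by (auto simp: A_def)
  then have sumA: "(\<Sum>H\<in>A. Xsub H) = hvar ?K - hvar F"
    using Xsub_sum[OF less.prems(1)] Xsub_sum[OF K] fin finite_NF
    by (simp add: sum.union_disjoint algebra_simps eq_neg_iff_add_eq_0)
  have "{H \<in> NF. G \<subseteq> H} = B \<union> {H \<in> NF. ?K \<subseteq> H}" "B \<inter> {H \<in> NF. ?K \<subseteq> H} = {}"
    using iff by (auto simp: B_def)
  then have sumB: "(\<Sum>H\<in>B. Xsub H) = hvar ?K - hvar G"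
    using Xsub_sum[OF less.prems(2)] Xsub_sum[OF K] fin finite_NF
    by (simp add: sum.union_disjoint algebra_simps eq_neg_iff_add_eq_0)
  \<comment> \<open>The exchange relation is available for the union \<open>F \<union> G\<close>,
    whereas the sums produce the join \<open>?K\<close>; \<open>D\<close> corrects for the
    difference modulo the null ideal.\<close>
  define D where "D = hvar ?K - hvar (F \<union> G)"
  have D: "D \<in> null_ideal" unfolding D_def by (rule hvar_cong_rclosure[OF finite_E sub])
  have "(hvar ?K - hvar F) * (hvar ?K - hvar G) =
      (hvar F - hvar (F \<union> G)) * (hvar G - hvar (F \<union> G)) -
      D * (hvar F - hvar (F \<union> G)) - D * (hvar G - hvar (F \<union> G)) + D * D"
    by (simp add: D_def algebra_simps)
  also have "\<dots> \<in> null_ideal"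
    using D by (intro null_ideal_add null_ideal_diff null_ideal_mult hvar_exchange_null)
  finally have total: "(\<Sum>H\<in>A. Xsub H) * (\<Sum>H\<in>B. Xsub H) \<in> null_ideal" by (simp only: sumA sumB)
  have mem: "(F, G) \<in> A \<times> B" using less.prems by (simp add: A_def B_def)
  have "(\<Sum>H\<in>A. Xsub H) * (\<Sum>H\<in>B. Xsub H) = (\<Sum>p\<in>A \<times> B. Xsub (fst p) * Xsub (snd p))"
    by (simp add: sum_product sum.cartesian_product case_prod_unfold)
  also have "\<dots> = Xsub F * Xsub G + (\<Sum>p\<in>A \<times> B - {(F, G)}. Xsub (fst p) * Xsub (snd p))"
    using sum.remove[OF _ mem, of "\<lambda>p. Xsub (fst p) * Xsub (snd p)"] fin by simp
  finally have eq: "Xsub F * Xsub G = (\<Sum>H\<in>A. Xsub H) * (\<Sum>H\<in>B. Xsub H) -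
      (\<Sum>p\<in>A \<times> B - {(F, G)}. Xsub (fst p) * Xsub (snd p))" by simp
  have "(\<Sum>p\<in>A \<times> B - {(F, G)}. Xsub (fst p) * Xsub (snd p)) \<in> null_ideal"
  proof (rule null_ideal_sum)
    fix p assume p: "p \<in> A \<times> B - {(F, G)}"
    obtain H H' where HH: "p = (H, H')" by (cases p)
    have H: "H \<in> NF" "F \<subseteq> H" "\<not> G \<subseteq> H" "H' \<in> NF" "G \<subseteq> H'" "\<not> F \<subseteq> H'" "H \<noteq> F \<or> H' \<noteq> G"
      using p HH by (auto simp: A_def B_def)
    have le: "card (E - H) \<le> card (E - F)" "card (E - H') \<le> card (E - G)"
      using H finite_E by (auto intro!: card_mono)
    have "card (E - H) < card (E - F) \<or> card (E - H') < card (E - G)"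
    proof (cases "H = F")
      case True
      then have "E - H' \<subset> E - G" using H NF_subset[OF H(4)] by auto
      then show ?thesis using finite_E by (simp add: psubset_card_mono)
    next
      case False
      then have "E - H \<subset> E - F" using H NF_subset[OF H(1)] by auto
      then show ?thesis using finite_E by (simp add: psubset_card_mono)
    qed
    then have lt: "card (E - H) + card (E - H') < card (E - F) + card (E - G)" using le by linarith
    have "\<not> H \<subseteq> H'" "\<not> H' \<subseteq> H" using H by auto
    then show "Xsub (fst p) * Xsub (snd p) \<in> null_ideal"
      using less.hyps[OF lt H(1,4)] HH by simp
  qed
  then show ?case unfolding eq using total by (intro null_ideal_diff)
qed

text \<open>This lets the pairing descend to the Chow ring: a relation among nested monomials there
  becomes one modulo \<open>null_ideal\<close>, where \<open>nested_independent\<close>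
  applies.\<close>

lemma chow_ideal_null:
  assumes "p \<in> CI"
  shows "poly_subst Xsub p \<in> null_ideal"
proof -
  have gen: "poly_subst Xsub g \<in> null_ideal" if "g \<in> chow_I E indep \<union> chow_J E indep" for g
    using that
  proof
    assume "g \<in> chow_I E indep"
    then obtain F G where "g = pvar F * pvar G" "F \<in> V" "G \<in> V" "\<not> F \<subseteq> G" "\<not> G \<subseteq> F"
      by (auto simp: chow_I_def)
    then show ?thesis
      using Xsub_incomparable_null[of F G] by (simp add: poly_subst_mult poly_subst_pvar V_eq)
  next
    assume "g \<in> chow_J E indep"
    then obtain i j where g: "g = (\<Sum>F\<in>{F \<in> V. i \<in> F}. pvar F) - (\<Sum>F\<in>{F \<in> V. j \<in> F}. pvar F)"
      "i \<in> E" "j \<in> E" unfolding chow_J_def by blast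
    have "poly_subst Xsub g = hvar (cl {j}) - hvar (cl {i})"
      using Xsub_sum_point[OF g(2)] Xsub_sum_point[OF g(3)]
      by (simp add: g(1) poly_subst_diff poly_subst_sum poly_subst_pvar)
    then show ?thesis using null_ideal_diff hvar_point_null g by simp
  qed
  obtain S c where p: "p = (\<Sum>g\<in>S. c g * g)" "S \<subseteq> chow_I E indep \<union> chow_J E indep"
    using assms by (auto simp: chow_ideal_def gen_ideal_def)
  show ?thesis
    unfolding p(1) poly_subst_sum poly_subst_mult
    using gen p(2) by (intro null_ideal_sum null_ideal_mult_left) auto
qed

lemma poly_subst_eta:
  assumes "F \<in> NF"
  shows "poly_subst Xsub (eta F) - hvar F \<in> null_ideal"
proof -
  have "poly_subst Xsub (eta F) - hvar F = - hvar (cl {i0})"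
    using Xsub_sum_point[OF i0] Xsub_sum_proper[OF assms]
    by (simp add: eta_def poly_subst_diff poly_subst_sum poly_subst_pvar)
  then show ?thesis using null_ideal_uminus hvar_point_null i0 by simp
qed

lemma poly_subst_eta_mset:
  assumes "set_mset M \<subseteq> NF"
  shows "poly_subst Xsub (eta_mset M) - Poly_Mapping.single M 1 \<in> null_ideal"
  using assms
proof (induction M)
  case empty
  have "Poly_Mapping.single ({#} :: 'a set multiset) (1::rat) = 1" by (metis single_one zero_multiset_def)
  then show ?case by (simp add: eta_mset_simps poly_subst_1 null_ideal_0)
next
  case (add F M)
  have "Poly_Mapping.single (add_mset F M) (1::rat) = hvar F * Poly_Mapping.single M 1"
    by (simp add: hvar_def mult_single)
  then have "poly_subst Xsub (eta_mset (add_mset F M)) - Poly_Mapping.single (add_mset F M) 1 =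
      (poly_subst Xsub (eta F) - hvar F) * poly_subst Xsub (eta_mset M) +
      hvar F * (poly_subst Xsub (eta_mset M) - Poly_Mapping.single M 1)"
    by (simp add: eta_mset_simps poly_subst_mult algebra_simps)
  also have "\<dots> \<in> null_ideal"
    using add poly_subst_eta[of F]
    by (intro null_ideal_add null_ideal_mult null_ideal_mult_left) auto
  finally show ?case .
qed

lemma eta_mset_independent:
  assumes "(\<Sum>M\<in>basis_index k. qscale (c M) (eta_mset M)) \<in> CI"
  shows "\<forall>M\<in>basis_index k. c M = 0"
proof -
  have sub: "set_mset M \<subseteq> NF" if "M \<in> basis_index k" for M
    using that by (auto simp: nested_def)
  have "poly_subst Xsub (\<Sum>M\<in>basis_index k. qscale (c M) (eta_mset M)) -
      (\<Sum>M\<in>basis_index k. Poly_Mapping.single M (c M)) =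
      (\<Sum>M\<in>basis_index k. Poly_Mapping.single 0 (c M) *
        (poly_subst Xsub (eta_mset M) - Poly_Mapping.single M 1))"
    unfolding poly_subst_sum sum_subtractf[symmetric] qscale_def
    by (intro sum.cong refl)
       (simp only: poly_subst_mult poly_subst_const right_diff_distrib mult_single add_0 mult_1_right)
  also have "\<dots> \<in> null_ideal"
    using poly_subst_eta_mset sub by (intro null_ideal_sum null_ideal_mult_left) auto
  finally have "poly_subst Xsub (\<Sum>M\<in>basis_index k. qscale (c M) (eta_mset M)) -
      (\<Sum>M\<in>basis_index k. Poly_Mapping.single M (c M)) \<in> null_ideal" .
  from null_ideal_diff[OF chow_ideal_null[OF assms] this]
  have "(\<Sum>M\<in>basis_index k. Poly_Mapping.single M (c M)) \<in> null_ideal" by simp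
  then show ?thesis
    using nested_independent[OF finite_E NF_rank_pos[OF E_NF], of c k] by blast
qed

theorem chow_dim_eq_coeff: "real (chow_dim E indep k) = coeff (chow_poly r E {}) k"
proof -
  have "qpoly.dim (homog_part E indep k) - qpoly.dim (homog_part E indep k \<inter> CI) = card (basis_index k)"
  proof (rule qpoly.dim_minus_dim_eq_card)
    show "qpoly.subspace (homog_part E indep k \<inter> CI)"
      by (intro qpoly.subspace_inter subspace_homog_part CI_subspace)
    show "homog_part E indep k \<subseteq> qpoly.span (eta_mset ` flat_msets k)" by (rule homog_part_eta_span)
    show "finite (eta_mset ` flat_msets k)" using finite_NF by (intro finite_imageI finite_multisets_of_size)
    show "finite (basis_index k)" using finite_nested[OF finite_E] by auto
    show "eta_mset ` basis_index k \<subseteq> homog_part E indep k" using eta_mset_homog_part by auto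
    show "\<forall>M\<in>basis_index k. c M = 0"
      if "(\<Sum>M\<in>basis_index k. qscale (c M) (eta_mset M)) \<in> homog_part E indep k \<inter> CI" for c
      using eta_mset_independent that by blast
  qed (use homog_part_span_basis in auto)
  then show ?thesis by (simp add: chow_dim_def coeff_chow_poly[OF finite_E])
qed

end

section \<open>Moments of the Chow polynomial\<close>

context pointed_loopless_matroid
begin

lemma rflat_empty: "rflat r E {}"
  using rank_singleton rank_empty by (auto simp: rflat_def)

lemma chow_moment_eq:
  "chow_moment E indep c t = cmoment t c (chow_poly r E {}) / poly (chow_poly r E {}) 1"
proof -
  have deg: "degree (chow_poly r E {}) \<le> r E - 1"
    using degree_chow_poly[OF finite_E rflat_empty] rank_empty by simp
  have "chow_moment E indep c t = cmoment t c (chow_poly r E {}) / cmoment 0 c (chow_poly r E {})"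
    by (simp add: chow_moment_def Let_def chow_dim_eq_coeff cmoment_bound[OF deg])
  then show ?thesis by (simp only: cmoment_0_eq_poly)
qed

end

lemma mrank_boolean: "mrank (boolean_indep d) X = card (X \<inter> boolean_ground d)"
proof -
  have fin: "finite (X \<inter> boolean_ground d)" by (simp add: boolean_ground_def)
  have "finite {card I |I. I \<subseteq> X \<and> boolean_indep d I}"
    by (rule finite_subset[of _ "card ` Pow (boolean_ground d)"])
       (auto simp: boolean_indep_def boolean_ground_def)
  then show ?thesis
    unfolding mrank_def using fin by (intro Max_eqI) (auto simp: boolean_indep_def intro: card_mono)
qed

lemma matroid_boolean: "matroid (boolean_ground d) (boolean_indep d)"
  unfolding matroid_def
proof (intro conjI allI impI)
  fix X Y assume XY: "boolean_indep d X \<and> boolean_indep d Y \<and> card X < card Y"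
  then have "finite X" by (auto simp: boolean_indep_def boolean_ground_def intro: finite_subset)
  then have "\<not> Y \<subseteq> X" using XY card_mono[of X Y] by auto
  then show "\<exists>y\<in>Y - X. boolean_indep d (insert y X)" using XY by (auto simp: boolean_indep_def)
qed (auto simp: boolean_indep_def boolean_ground_def)

lemma pointed_loopless_boolean:
  "pointed_loopless_matroid (boolean_ground d) (boolean_indep d) 0"
proof
  show "matroid (boolean_ground d) (boolean_indep d)" by (rule matroid_boolean)
qed (auto simp: loopless_def boolean_indep_def boolean_ground_def)

lemma all_coloops_boolean: "all_coloops (mrank (boolean_indep d)) (boolean_ground d) {}"
  unfolding all_coloops_def mrank_boolean
proof (intro conjI ballI psubset_card_mono)
  show "finite (boolean_ground d \<inter> boolean_ground d)" by (simp add: boolean_ground_def)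
qed auto

theorem theorem3p3:
  fixes t :: nat and f :: "nat \<Rightarrow> nat \<Rightarrow> real"
    and E :: "'a set" and indep :: "'a set \<Rightarrow> bool" and d :: nat
  assumes "CMFS t f"
    and "\<And>d' k. k \<le> t \<Longrightarrow>
           chow_moment (boolean_ground d') (boolean_indep d') (real d' / 2) k \<le> f k d'"
    and "matroid E indep" and "loopless E indep"
    and "mrank indep E = d + 1"
  shows "chow_moment E indep (real d / 2) t \<le> f t d"
proof -
  interpret rank_function "mrank indep" by (rule rank_function_mrank[OF assms(3)])
  have "E \<noteq> {}" using assms(5) rank_empty by auto
  then obtain i0 where i0: "i0 \<in> E" by auto
  interpret M: pointed_loopless_matroid E indep i0
    using assms(3,4) i0 by unfold_locales
  define B where "B d = chow_poly (mrank (boolean_indep d)) (boolean_ground d) {}" for d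
  have B_pos: "0 < poly (B d) 1" for d
  proof -
    interpret B: pointed_loopless_matroid "boolean_ground d" "boolean_indep d" 0
      by (rule pointed_loopless_boolean)
    show ?thesis unfolding B_def by (rule B.poly_chow_poly_pos[OF B.finite_E])
  qed
  have B_le: "cmoment k (real d / 2) (B d) \<le> f k d * poly (B d) 1"
    and B_nonneg: "0 \<le> cmoment k (real d / 2) (B d)" if "k \<le> t" for d k
  proof -
    interpret B: pointed_loopless_matroid "boolean_ground d" "boolean_indep d" 0
      by (rule pointed_loopless_boolean)
    have "cmoment k (real d / 2) (B d) / poly (B d) 1 \<le> f k d"
      using assms(2)[OF that, of d] unfolding B.chow_moment_eq B_def .
    then show "cmoment k (real d / 2) (B d) \<le> f k d * poly (B d) 1"
      using B_pos[of d] by (simp add: divide_le_eq)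
    show "0 \<le> cmoment k (real d / 2) (B d)"
      unfolding B_def
      by (rule B.cmoment_chow_poly_nonneg[OF B.finite_E B.rflat_empty])
         (simp add: mrank_boolean boolean_ground_def)
  qed
  \<comment> \<open>The Boolean moments are nonnegative and bounded by \<open>f k d\<close> times a
    positive number.\<close>
  have f_nonneg: "0 \<le> f k d" if "k \<le> t" for d k
    using B_le[OF that, of d] B_nonneg[OF that, of d] B_pos[of d]
    by (meson dual_order.trans zero_le_mult_iff not_less)
  have base: "cmoment k (real d / 2) (chow_poly (mrank indep) E' A) \<le>
      f k d * poly (chow_poly (mrank indep) E' A) 1"
    if "finite E'" "all_coloops (mrank indep) E' A" "mrank indep E' = mrank indep A + d + 1" "k \<le> t"
    for E' A d k
  proof -
    have "A \<subseteq> E'" using that(2) by (simp add: all_coloops_def)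
    \<comment> \<open>In a Boolean minor the rank is the number of remaining elements, so it has the
      polynomial of the standard Boolean matroid on \<open>d + 1\<close> elements.\<close>
    then have "card (E' - A) = Suc d" using all_coloops_rank(1)[OF that(1,2), of E'] that(3) by simp
    then have "chow_poly (mrank indep) E' A = B d"
      unfolding B_def using that all_coloops_boolean
      by (intro chow_poly_all_coloops_cong rank_function_mrank[OF matroid_boolean] rank_function_axioms)
         (auto simp: boolean_ground_def)
    then show ?thesis using B_le[OF that(4)] by simp
  qed
  have "cmoment t (real d / 2) (chow_poly (mrank indep) E {}) \<le>
      f t d * poly (chow_poly (mrank indep) E {}) 1"
    by (rule cmoment_chow_poly_le[OF assms(1) f_nonneg base M.finite_E M.rflat_empty])
       (use assms(5) rank_empty in auto)
  then show ?thesis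
    using poly_chow_poly_pos[OF M.finite_E, of "{}"] by (simp add: M.chow_moment_eq divide_le_eq)
qed

end
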